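(* Let $H:\mathbb{R}_+\to\mathbb{R}$ be a strictly convex function that is smooth on $\mathbb{R}_+^*$ and satisfies $H(0)=0$. On $\mathbb{R}_+^*$ define $\psi=H'$, $U(x)=xH'(x)-H(x)$ and $U_2(x)=xU'(x)-U(x)$. Let $\overline\Omega\subset\mathbb{R}^d$ be a closed convex set, let $V:\overline\Omega\to\mathbb{R}$ be a smooth function, and define $v=\psi^{-1*}(-V)$, where $\psi^{-1*}$ is the generalized inverse of $\psi$. Suppose that $v$ is integrable. Assume that $U_2+\frac1d U\ge 0$ on $\mathbb{R}_+^*$, that $-V<\psi(+\infty)$ everywhere on $\overline\Omega$, and that there is a constant $C>0$ such that $\nabla^2V\ge C I_d$ on $\overline\Omega$ (as symmetric matrices). Then for every positive function $u\in C^\infty(\overline\Omega)$ such that $\int_\Omega u=\int_\Omega v$, $$\int_\Omega \Big(H(u)-H(v)+(u-v)V\Big)\le \frac{1}{2C}\int_\Omega u\,\|\nabla\psi(u)+\nabla V\|^2 .$$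
   Context: $\mathbb{R}_+=[0,\infty)$, $\mathbb{R}_+^*=(0,\infty)$. For a continuous strictly increasing function $\psi:\mathbb{R}_+^*\to\mathbb{R}$, write $\psi(0^+)=\lim_{x\to0^+}\psi(x)$ and $\psi(+\infty)=\lim_{x\to+\infty}\psi(x)$ (in $[-\infty,+\infty]$). The generalized inverse $\psi^{-1*}$ is defined for $x\in[-\infty,+\infty]$ by $\psi^{-1*}(x)=\psi^{-1}(x)$ if $x\in(\psi(0^+),\psi(+\infty))$, $\psi^{-1*}(x)=0$ if $x\le\psi(0^+)$, and $\psi^{-1*}(x)=+\infty$ if $x\ge\psi(+\infty)$. $\Omega$ is the interior of the closed convex set $\overline\Omega$; functions in $C^\infty(\overline\Omega)$ are smooth up to the boundary and need not vanish on $\partial\Omega$. All integrals over $\Omega$ are with respect to Lebesgue measure; $\|\cdot\|$ is the Euclidean norm, $\nabla^2$ the Hessian and $I_d$ the identity matrix. *)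

theory Defs
  imports "HOL-Analysis.Analysis"
begin

definition strictly_convex_on :: "'a::real_vector set \<Rightarrow> ('a \<Rightarrow> real) \<Rightarrow> bool" where
  "strictly_convex_on S f \<longleftrightarrow> convex S \<and>
     (\<forall>x\<in>S. \<forall>y\<in>S. \<forall>t. x \<noteq> y \<longrightarrow> 0 < t \<longrightarrow> t < 1 \<longrightarrow>
        f ((1 - t) *\<^sub>R x + t *\<^sub>R y) < (1 - t) * f x + t * f y)"

text \<open>
  All derivatives are taken within \<open>S\<close>.  On an open set these are the ordinary derivatives.
  On a closed convex set with nonempty interior they are uniquely determined at boundary points
  too, and a smooth function in this sense is one that is smooth in the interior and all of
  whose partial derivatives extend continuously to \<open>S\<close> (smooth up to the boundary).
\<close>

fun Ck_on :: "nat \<Rightarrow> 'a::real_normed_vector set \<Rightarrow> ('a \<Rightarrow> real) \<Rightarrow> bool" where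
  "Ck_on 0 S f \<longleftrightarrow> continuous_on S f"
| "Ck_on (Suc k) S f \<longleftrightarrow> (\<forall>x\<in>S. f differentiable (at x within S)) \<and>
     (\<forall>h. Ck_on k S (\<lambda>x. frechet_derivative f (at x within S) h))"

definition smooth_on :: "'a::real_normed_vector set \<Rightarrow> ('a \<Rightarrow> real) \<Rightarrow> bool" where
  "smooth_on S f \<longleftrightarrow> (\<forall>k. Ck_on k S f)"

definition gradient_on :: "(real^'n) set \<Rightarrow> (real^'n \<Rightarrow> real) \<Rightarrow> real^'n \<Rightarrow> real^'n" where
  "gradient_on S f x = (\<chi> i. frechet_derivative f (at x within S) (axis i 1))"

definition hessian_on :: "(real^'n) set \<Rightarrow> (real^'n \<Rightarrow> real) \<Rightarrow> real^'n \<Rightarrow> real^'n^'n" where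
  "hessian_on S f x = jacobian (gradient_on S f) (at x within S)"

text \<open>The usual (Loewner) order on symmetric matrices.\<close>

definition matrix_le :: "real^'n^'n \<Rightarrow> real^'n^'n \<Rightarrow> bool" where
  "matrix_le A B \<longleftrightarrow> (\<forall>h. h \<bullet> (A *v h) \<le> h \<bullet> (B *v h))"

definition lim_zero :: "(real \<Rightarrow> real) \<Rightarrow> ereal" where
  "lim_zero \<psi> = Lim (at_right 0) (\<lambda>x. ereal (\<psi> x))"

definition lim_infty :: "(real \<Rightarrow> real) \<Rightarrow> ereal" where
  "lim_infty \<psi> = Lim at_top (\<lambda>x. ereal (\<psi> x))"

text \<open>
  The generalized inverse of a continuous strictly increasing function on the open half-line.
\<close>

definition gen_inverse :: "(real \<Rightarrow> real) \<Rightarrow> ereal \<Rightarrow> ereal" where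
  "gen_inverse \<psi> y =
     (if y \<le> lim_zero \<psi> then 0
      else if lim_infty \<psi> \<le> y then \<infinity>
      else ereal (the_inv_into {0<..} (\<lambda>x. ereal (\<psi> x)) y))"

definition U_of :: "(real \<Rightarrow> real) \<Rightarrow> real \<Rightarrow> real" where
  "U_of H x = x * deriv H x - H x"

definition U2_of :: "(real \<Rightarrow> real) \<Rightarrow> real \<Rightarrow> real" where
  "U2_of H x = x * deriv (U_of H) x - U_of H x"

text \<open>
  The integral with values in the extended reals: integral of the positive part minus integral
  of the negative part.  It agrees with the Bochner integral for integrable functions, but does
  not collapse to 0 for a nonintegrable function.  In the indeterminate case, \<^typ>\<open>ereal\<close> has
  \<open>\<infinity> - \<infinity> = \<infinity>\<close>.
\<close>

definition ext_integral :: "'a::euclidean_space set \<Rightarrow> ('a \<Rightarrow> real) \<Rightarrow> ereal" where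
  "ext_integral A f =
     enn2ereal (\<integral>\<^sup>+x\<in>A. ennreal (f x) \<partial>lborel) - enn2ereal (\<integral>\<^sup>+x\<in>A. ennreal (- f x) \<partial>lborel)"

lemma ext_integral_eq_LINT:
  assumes "set_integrable lborel A f"
  shows "ext_integral A f = ereal (LINT x:A|lborel. f x)"
proof -
  let ?g = "\<lambda>x. indicator A x *\<^sub>R f x"
  have g: "integrable lborel ?g"
    using assms by (simp add: set_integrable_def)
  have pos: "(\<integral>\<^sup>+x\<in>A. ennreal (f x) \<partial>lborel) = (\<integral>\<^sup>+x. ennreal (?g x) \<partial>lborel)"
    by (rule nn_integral_cong) (simp add: indicator_def)
  have neg: "(\<integral>\<^sup>+x\<in>A. ennreal (- f x) \<partial>lborel) = (\<integral>\<^sup>+x. ennreal (- ?g x) \<partial>lborel)"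
    by (rule nn_integral_cong) (simp add: indicator_def)
  have fin: "(\<integral>\<^sup>+x. ennreal (?g x) \<partial>lborel) \<noteq> \<infinity>" "(\<integral>\<^sup>+x. ennreal (- ?g x) \<partial>lborel) \<noteq> \<infinity>"
    using g by (auto simp: real_integrable_def)
  have enn: "enn2ereal a = ereal (enn2real a)" if "a \<noteq> \<infinity>" for a
    using that by (cases a) auto
  show ?thesis
    unfolding ext_integral_def set_lebesgue_integral_def pos neg
      real_lebesgue_integral_def[OF g] enn[OF fin(1)] enn[OF fin(2)] by simp
qed

end

theory Submission
  imports Defs
begin

text \<open>
  The inequality says that the relative energy of \<open>u\<close> with respect to the minimizer \<open>v\<close> is controlled by
  its dissipation.  It follows from the convexity of the energy \<open>E w = \<integral> H w + w V\<close> along displacements of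
  mass.  If \<open>w\<^sub>s\<close> is obtained from \<open>u\<close> by moving each particle \<open>x\<close> to \<open>x + s * \<delta> x\<close>, where \<open>\<delta>\<close> leads from \<open>u\<close> to
  a density \<open>w\<close> of the same mass, then McCann's condition on \<open>U\<close> and \<open>\<nabla>\<^sup>2 V \<ge> C\<close> give
  \<open>(1 - s) * E u + s * E w \<ge> E w\<^sub>s + C / 2 * s * (1 - s) * \<integral> u |\<delta>|\<^sup>2\<close>.  On the other hand \<open>H\<close> lies above its tangents,
  so \<open>E w\<^sub>s - E u \<ge> \<integral> (\<psi> u + V) (w\<^sub>s - u)\<close>, which is \<open>s * \<integral> u * (\<nabla>(\<psi> u + V) \<bullet> \<delta>)\<close> to first order in \<open>s\<close>.  Dividing by
  \<open>s\<close>, letting \<open>s\<close> tend to \<open>0\<close> and completing the square in \<open>\<delta>\<close> yields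
  \<open>E u - E w \<le> 1 / (2 * C) * \<integral> u |\<nabla>(\<psi> u + V)|\<^sup>2\<close>.

  The displacement is built from boxes.  Both densities are replaced by their averages on small boxes, and a cutting argument in the style of Hadwiger and Ohmann (\<open>brick_induction\<close>)
  reduces the two families of boxes to pairs of boxes of equal mass, between which the affine map
  does the transport.  For a single pair, displacement convexity is the Brunn--Minkowski inequality
  for boxes together with the convexity of the energy of a cube in its edge (\<open>box_energy_convex\<close>), and
  \<open>brick_pair\<close> combines it with the tangents of \<open>H\<close> and the convexity of \<open>V\<close>.  Refining the boxes gives
  the inequality on bounded convex domains (\<open>entropy_inequality\<close>).

  For an unbounded domain this is applied to its intersections with balls and to \<open>w = v\<close>, corrected on
  a fixed ball where \<open>v\<close> is bounded away from \<open>0\<close> so that the masses agree; the correction disappears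
  in the limit (\<open>energy_comparison_inequality\<close>).  As \<open>v x\<close> minimizes \<open>H z + z * V x\<close> over \<open>z \<ge> 0\<close>, the
  integrand of \<open>E u - E v\<close> is nonnegative and monotone convergence applies.  Finally, \<open>H\<close> may jump at
  \<open>0\<close>; removing the jump only increases the left-hand side.
\<close>

section \<open>Displacement convexity of the internal energy of a box\<close>

text \<open>
  The hypotheses are what the transport argument uses about an energy density: it lies above its
  tangents, and \<open>mccann\<close> is McCann's condition \<open>U\<^sub>2 + U / n \<ge> 0\<close> for the pressure
  \<open>U x = x * H' x - H x\<close>, rewritten with \<open>U' x = x * H'' x\<close>.
\<close>

locale internal_energy =
  fixes H psi psi' :: "real \<Rightarrow> real" and n :: nat
  assumes n_pos: "n \<ge> 1"
    and H_zero: "H 0 = 0"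
    and DERIV_H: "x > 0 \<Longrightarrow> (H has_real_derivative psi x) (at x)"
    and DERIV_psi: "x > 0 \<Longrightarrow> (psi has_real_derivative psi' x) (at x)"
    and tangent: "z > 0 \<Longrightarrow> x \<ge> 0 \<Longrightarrow> H z + psi z * (x - z) \<le> H x"
    \<comment> \<open>the pressure tends to \<open>0\<close> at \<open>0\<close>, that is, \<open>H\<close> does not jump there\<close>
    and pressure_vanishes: "e > 0 \<Longrightarrow> \<exists>x>0. x * psi x - H x < e"
    and mccann: "x > 0 \<Longrightarrow> (1 - 1 / real n) * (x * psi x - H x) \<le> x\<^sup>2 * psi' x"
begin

definition pressure :: "real \<Rightarrow> real" where
  "pressure x = x * psi x - H x"

lemma pressure_nonneg: "x > 0 \<Longrightarrow> pressure x \<ge> 0"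
  using tangent[of x 0] by (simp add: pressure_def H_zero algebra_simps)

text \<open>Convexity between \<open>0\<close> and \<open>x\<close>, obtained from the tangent at \<open>t * x\<close>.\<close>

lemma H_scale_le:
  assumes "0 \<le> t" "t \<le> 1" "x \<ge> 0"
  shows "H (t * x) \<le> t * H x"
proof (cases "t * x = 0")
  case True
  then show ?thesis using H_zero by auto
next
  case False
  with assms have "t * x > 0" by (simp add: less_le)
  then have "t * (H (t * x) + psi (t * x) * (x - t * x)) \<le> t * H x"
    and "(1 - t) * (H (t * x) + psi (t * x) * (0 - t * x)) \<le> (1 - t) * H 0"
    using tangent[of "t * x" x] tangent[of "t * x" 0] assms by (auto intro: mult_left_mono)
  then have "t * (H (t * x) + psi (t * x) * (x - t * x))
      + (1 - t) * (H (t * x) + psi (t * x) * (0 - t * x)) \<le> t * H x"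
    using H_zero by simp
  moreover have "t * (H (t * x) + psi (t * x) * (x - t * x))
      + (1 - t) * (H (t * x) + psi (t * x) * (0 - t * x)) = H (t * x)"
    by (simp add: algebra_simps)
  ultimately show ?thesis by simp
qed

lemma psi_mono:
  assumes "0 < x" "x \<le> y"
  shows "psi x \<le> psi y"
proof (cases "x = y")
  case False
  have "H x + psi x * (y - x) \<le> H y" "H y + psi y * (x - y) \<le> H x"
    using tangent assms by auto
  then have "psi x * (y - x) \<le> psi y * (y - x)" by (simp add: algebra_simps)
  then show ?thesis using False assms by simp
qed auto

lemma DERIV_pressure:
  assumes "x > 0" shows "(pressure has_real_derivative x * psi' x) (at x)"
proof -
  have "((\<lambda>x. x * psi x - H x) has_real_derivative x * psi' x) (at x)"
    by (rule derivative_eq_intros DERIV_psi DERIV_H assms refl | simp)+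
  then show ?thesis by (simp add: pressure_def[abs_def])
qed

lemma continuous_on_H: "continuous_on {0<..} H"
  and continuous_on_psi: "continuous_on {0<..} psi"
  and continuous_on_pressure: "continuous_on {0<..} pressure"
  using DERIV_H DERIV_psi DERIV_pressure
  by (auto intro!: continuous_at_imp_continuous_on DERIV_isCont)

text \<open>\<open>H\<close> is unconstrained on the negative half-line, hence the truncation.\<close>

lemma H_measurable: "(\<lambda>x. if x \<ge> 0 then H x else 0) \<in> borel_measurable borel"
proof -
  have "(\<lambda>x. if x \<in> {0<..} then H x else 0) \<in> borel_measurable borel"
    by (rule borel_measurable_continuous_on_if) (auto simp: continuous_on_H)
  moreover have "(\<lambda>x. if x \<ge> 0 then H x else 0) = (\<lambda>x. if x \<in> {0<..} then H x else 0)"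
    by (auto simp: H_zero fun_eq_iff)
  ultimately show ?thesis by simp
qed

lemma H_bounds:
  assumes "0 \<le> x" "x \<le> M" "M > 0"
  shows "\<bar>H x\<bar> \<le> \<bar>H M\<bar> + \<bar>psi M\<bar> * M"
proof -
  have "\<bar>psi M * (x - M)\<bar> \<le> \<bar>psi M\<bar> * M"
    unfolding abs_mult by (rule mult_left_mono) (use assms in auto)
  then have "H x \<ge> - (\<bar>H M\<bar> + \<bar>psi M\<bar> * M)"
    using tangent[of M x] assms by linarith
  moreover have "H x \<le> \<bar>H M\<bar>"
  proof -
    have "H (x / M * M) \<le> x / M * H M"
      by (rule H_scale_le) (use assms in auto)
    also have "\<dots> \<le> x / M * \<bar>H M\<bar>" by (rule mult_left_mono) (use assms in auto)
    also have "\<dots> \<le> 1 * \<bar>H M\<bar>" by (rule mult_right_mono) (use assms in auto)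
    finally show ?thesis using assms by simp
  qed
  moreover have "\<bar>psi M\<bar> * M \<ge> 0" using assms by simp
  ultimately show ?thesis by linarith
qed

text \<open>
  The internal energy of mass \<open>m\<close> spread evenly over a cube of edge \<open>r\<close>.  Its derivative is
  \<open>- n r^(n-1) U (m / r^n)\<close>, so \<open>U \<ge> 0\<close> makes it decrease, and McCann's condition is precisely the
  sign of the second derivative.
\<close>

definition cube_energy :: "real \<Rightarrow> real \<Rightarrow> real" where
  "cube_energy m r = r ^ n * H (m / r ^ n)"

lemma DERIV_cube_density:
  "r > 0 \<Longrightarrow> ((\<lambda>r. m / r ^ n) has_real_derivative - m * real n * r ^ (n - 1) / (r ^ n * r ^ n)) (at r)"
  by (rule derivative_eq_intros refl | simp)+

lemma DERIV_cube_energy: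
  assumes "m > 0" "r > 0"
  shows "(cube_energy m has_real_derivative - real n * (r ^ (n - 1) * pressure (m / r ^ n))) (at r)"
proof -
  have z: "m / r ^ n > 0" using assms by simp
  have "((\<lambda>r. r ^ n * H (m / r ^ n)) has_real_derivative
      real n * r ^ (n - 1) * H (m / r ^ n)
      + psi (m / r ^ n) * (- m * real n * r ^ (n - 1) / (r ^ n * r ^ n)) * r ^ n) (at r)"
    using DERIV_mult[OF DERIV_pow[of n] DERIV_chain2[OF DERIV_H[OF z] DERIV_cube_density[OF assms(2)]]]
    by (simp only: One_nat_def)
  also have "real n * r ^ (n - 1) * H (m / r ^ n)
      + psi (m / r ^ n) * (- m * real n * r ^ (n - 1) / (r ^ n * r ^ n)) * r ^ n
      = - real n * (r ^ (n - 1) * pressure (m / r ^ n))"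
    using assms by (simp add: pressure_def field_simps)
  finally show ?thesis by (simp add: cube_energy_def[abs_def])
qed

lemma cube_energy_antimono:
  assumes "m > 0" "0 < r" "r \<le> r'"
  shows "cube_energy m r' \<le> cube_energy m r"
proof (rule DERIV_nonpos_imp_nonincreasing[OF assms(3)])
  fix x assume "r \<le> x" "x \<le> r'"
  with assms have "x > 0" by simp
  then show "\<exists>y. (cube_energy m has_real_derivative y) (at x) \<and> y \<le> 0"
    using DERIV_cube_energy[OF assms(1)] pressure_nonneg[of "m / x ^ n"] assms(1) by fastforce
qed

lemma convex_on_cube_energy:
  assumes "m > 0"
  shows "convex_on {0<..} (cube_energy m)"
proof (rule f''_ge0_imp_convex)
  fix r :: real assume r: "r \<in> {0<..}"
  then have r: "r > 0" by simp
  let ?z = "m / r ^ n"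
  let ?d2 = "- real n * (real (n - 1) * r ^ (n - 1 - 1) * pressure ?z
    + ?z * psi' ?z * (- m * real n * r ^ (n - 1) / (r ^ n * r ^ n)) * r ^ (n - 1))"
  show "(cube_energy m has_real_derivative - real n * (r ^ (n - 1) * pressure ?z)) (at r)"
    using DERIV_cube_energy assms r .
  have z: "?z > 0" using assms r by simp
  show "((\<lambda>r. - real n * (r ^ (n - 1) * pressure (m / r ^ n))) has_real_derivative ?d2) (at r)"
    using DERIV_cmult[OF DERIV_mult[OF DERIV_pow
        DERIV_chain2[OF DERIV_pressure[OF z] DERIV_cube_density[OF r]]], of "- real n" "n - 1"]
    by simp
  obtain k where k: "n = Suc k" using n_pos by (cases n) auto
  have "real n * (r * r ^ (n - 1)) * ((1 - 1 / real n) * pressure ?z) \<le>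
      real n * (r * r ^ (n - 1)) * (?z\<^sup>2 * psi' ?z)"
    by (rule mult_left_mono) (use mccann[OF z] r in \<open>auto simp: pressure_def\<close>)
  moreover have "r\<^sup>2 * ?d2 = real n * (real n * (r * r ^ (n - 1)) * (?z\<^sup>2 * psi' ?z)
      - real n * (r * r ^ (n - 1)) * ((1 - 1 / real n) * pressure ?z))"
  proof (cases k)
    case 0
    with k r show ?thesis by (simp add: field_simps power2_eq_square)
  next
    case (Suc j)
    define z P P' p where "z = ?z" and "P = pressure ?z" and "P' = psi' ?z" and "p = r ^ j"
    have n: "real n = real j + 2" "real (n - 1) = real j + 1" "r ^ n = r * (r * p)"
      "r ^ (n - 1) = r * p" "r ^ (n - 1 - 1) = p"
      using k Suc by (auto simp: p_def)
    have p: "p > 0" using r by (simp add: p_def)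
    have m: "m = z * (r * (r * p))" using p r by (simp add: z_def n)
    show ?thesis
      unfolding P_def[symmetric] P'_def[symmetric] z_def[symmetric] n
      unfolding m using p r by (simp add: field_simps power2_eq_square)
  qed
  ultimately have "r\<^sup>2 * ?d2 \<ge> 0" by simp
  moreover have "r\<^sup>2 > 0" using r by simp
  ultimately show "?d2 \<ge> 0" using mult_pos_neg[of "r\<^sup>2" ?d2] by linarith
qed auto

end

text \<open>
  The Brunn--Minkowski inequality for boxes with parallel edges, by the inequality between the
  arithmetic and the geometric mean for the ratios of edges.
\<close>

lemma box_Brunn_Minkowski:
  fixes a b :: "'i \<Rightarrow> real"
  assumes fin: "finite I" and ne: "I \<noteq> {}"
    and a: "\<And>i. i \<in> I \<Longrightarrow> a i > 0" and b: "\<And>i. i \<in> I \<Longrightarrow> b i > 0"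
    and s: "0 \<le> s" "s \<le> 1"
  shows "(1 - s) * root (card I) (\<Prod>i\<in>I. a i) + s * root (card I) (\<Prod>i\<in>I. b i)
    \<le> root (card I) (\<Prod>i\<in>I. (1 - s) * a i + s * b i)"
proof -
  define c where "c i = (1 - s) * a i + s * b i" for i
  have c: "c i > 0" if "i \<in> I" for i
  proof (cases "s = 0")
    case True then show ?thesis using a[OF that] by (simp add: c_def)
  next
    case False
    then have "s * b i > 0" using s b[OF that] by simp
    moreover have "(1 - s) * a i \<ge> 0" using s a[OF that] by simp
    ultimately show ?thesis by (simp add: c_def)
  qed
  let ?k = "card I"
  have k: "?k > 0" using fin ne by (simp add: card_gt_0_iff)
  have mean: "root ?k (\<Prod>i\<in>I. x i / c i) \<le> (\<Sum>i\<in>I. x i / c i) / ?k"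
    if "\<And>i. i \<in> I \<Longrightarrow> x i > 0" for x
  proof -
    have "(\<Prod>i\<in>I. x i / c i) powr (1 / ?k) \<le> (\<Sum>i\<in>I. x i / c i / ?k)"
      by (rule arith_geom_mean[OF fin ne]) (use that c in \<open>force intro: less_imp_le\<close>)
    moreover have "(\<Prod>i\<in>I. x i / c i) > 0"
      using that c by (intro prod_pos) simp
    ultimately show ?thesis
      using k by (simp add: root_powr_inverse sum_divide_distrib)
  qed
  from mean[of a] mean[of b] a b have "(1 - s) * root ?k (\<Prod>i\<in>I. a i / c i) + s * root ?k (\<Prod>i\<in>I. b i / c i)
      \<le> (1 - s) * ((\<Sum>i\<in>I. a i / c i) / ?k) + s * ((\<Sum>i\<in>I. b i / c i) / ?k)"
    using s by (intro add_mono mult_left_mono) auto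
  also have "\<dots> = (\<Sum>i\<in>I. ((1 - s) * a i + s * b i) / c i) / ?k"
    by (simp add: sum_distrib_left sum_divide_distrib sum.distrib[symmetric] add_divide_distrib)
  also have "(\<Sum>i\<in>I. ((1 - s) * a i + s * b i) / c i) = (\<Sum>i\<in>I. 1)"
    by (rule sum.cong) (use c in \<open>force simp: c_def\<close>)+
  also have "(\<Sum>i\<in>I. 1) / ?k = (1::real)" using k by simp
  finally have *: "(1 - s) * (root ?k (\<Prod>i\<in>I. a i) / root ?k (\<Prod>i\<in>I. c i))
      + s * (root ?k (\<Prod>i\<in>I. b i) / root ?k (\<Prod>i\<in>I. c i)) \<le> 1"
    using k by (simp add: prod_dividef real_root_divide)
  have "root ?k (\<Prod>i\<in>I. c i) > 0" using k c by (simp add: prod_pos)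
  then show ?thesis using * by (simp add: field_simps c_def)
qed

context internal_energy
begin

text \<open>
  Displacement convexity.  A box of volume \<open>A\<close> carries the same energy as the cube of edge \<open>A^(1/n)\<close>;
  by Brunn--Minkowski the interpolated box is at least as large as the cube with the interpolated
  edge, and the energy of a cube is decreasing and convex in the edge.
\<close>

lemma box_energy_convex:
  fixes a b :: "'i \<Rightarrow> real"
  assumes fin: "finite I" and card: "card I = n"
    and a: "\<And>i. i \<in> I \<Longrightarrow> a i > 0" and b: "\<And>i. i \<in> I \<Longrightarrow> b i > 0"
    and s: "0 \<le> s" "s \<le> 1" and m: "m > 0"
  defines "A \<equiv> \<Prod>i\<in>I. a i" and "B \<equiv> \<Prod>i\<in>I. b i" and "D \<equiv> \<Prod>i\<in>I. (1 - s) * a i + s * b i"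
  shows "D * H (m / D) \<le> (1 - s) * (A * H (m / A)) + s * (B * H (m / B))"
proof -
  have ne: "I \<noteq> {}" using card n_pos by auto
  have AB: "A > 0" "B > 0" unfolding A_def B_def using a b by (auto intro: prod_pos)
  have c: "(1 - s) * a i + s * b i > 0" if "i \<in> I" for i
  proof (cases "s = 0")
    case True then show ?thesis using a[OF that] by simp
  next
    case False
    then have "s * b i > 0" using s b[OF that] by simp
    moreover have "(1 - s) * a i \<ge> 0" using s a[OF that] by simp
    ultimately show ?thesis by simp
  qed
  have D: "D > 0" unfolding D_def using c by (auto intro: prod_pos)
  have n: "n > 0" using n_pos by simp
  have cube: "X * H (m / X) = cube_energy m (root n X)" if "X > 0" for X
    using that n by (simp add: cube_energy_def)
  let ?r = "(1 - s) * root n A + s * root n B"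
  have "?r > 0"
  proof (cases "s = 0")
    case True then show ?thesis using AB n by simp
  next
    case False
    then have "s * root n B > 0" using s AB n by simp
    moreover have "(1 - s) * root n A \<ge> 0" using s AB n by simp
    ultimately show ?thesis by simp
  qed
  moreover have "?r \<le> root n D"
    using box_Brunn_Minkowski[OF fin ne a b s] by (simp add: A_def B_def D_def card)
  ultimately have "cube_energy m (root n D) \<le> cube_energy m ?r"
    using cube_energy_antimono m by blast
  also have "\<dots> \<le> (1 - s) * cube_energy m (root n A) + s * cube_energy m (root n B)"
    using convex_onD[OF convex_on_cube_energy[OF m], of s "root n A" "root n B"] s AB n by simp
  finally show ?thesis using cube AB D by simp
qed

end

section \<open>Cutting two families of boxes of equal mass\<close>

abbreviation vol :: "'a::euclidean_space set \<Rightarrow> real" where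
  "vol \<equiv> measure lborel"

definition is_cbox :: "'a::euclidean_space set \<Rightarrow> bool" where
  "is_cbox K \<longleftrightarrow> (\<exists>a b. K = cbox a b)"

lemma is_cbox_halfspace:
  assumes "k \<in> Basis" "is_cbox K"
  shows "is_cbox (K \<inter> {x. x \<bullet> k \<le> c})" "is_cbox (K \<inter> {x. x \<bullet> k \<ge> c})"
proof -
  obtain a b where "K = cbox a b" using assms(2) by (auto simp: is_cbox_def)
  then show "is_cbox (K \<inter> {x. x \<bullet> k \<le> c})" "is_cbox (K \<inter> {x. x \<bullet> k \<ge> c})"
    by (auto simp: interval_split[OF assms(1)] is_cbox_def)
qed

lemma content_is_cbox_split:
  assumes "k \<in> Basis" "is_cbox K"
  shows "vol K = vol (K \<inter> {x. x \<bullet> k \<le> c}) + vol (K \<inter> {x. x \<bullet> k \<ge> c})"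
  using assms content_split unfolding is_cbox_def by blast

lemma content_cbox_max: "vol (cbox a b) = (\<Prod>i\<in>Basis. max 0 (b \<bullet> i - a \<bullet> i))"
proof (cases "cbox a b = {}")
  case True
  then obtain i where "i \<in> Basis" "b \<bullet> i < a \<bullet> i" by (auto simp: box_eq_empty)
  then have "(\<Prod>i\<in>Basis. max 0 (b \<bullet> i - a \<bullet> i)) = 0" by (auto intro!: prod_zero bexI[of _ i])
  with True show ?thesis by simp
next
  case False
  then have "(\<Prod>i\<in>Basis. max 0 (b \<bullet> i - a \<bullet> i)) = (\<Prod>i\<in>Basis. b \<bullet> i - a \<bullet> i)"
    by (intro prod.cong) (auto simp: box_ne_empty)
  with False show ?thesis by (simp add: content_cbox')
qed

lemma continuous_on_content_halfspace:
  assumes k: "k \<in> Basis" and K: "is_cbox K"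
  shows "continuous_on UNIV (\<lambda>c. vol (K \<inter> {x. x \<bullet> k \<le> c}))"
proof -
  obtain a b where "K = cbox a b" using K by (auto simp: is_cbox_def)
  then have "vol (K \<inter> {x. x \<bullet> k \<le> c}) =
      (\<Prod>i\<in>Basis. max 0 ((if i = k then min (b \<bullet> k) c else b \<bullet> i) - a \<bullet> i))" for c
    by (simp add: interval_split[OF k] content_cbox_max)
  moreover have "continuous_on UNIV
      (\<lambda>c. \<Prod>i\<in>Basis. max 0 ((if i = k then min (b \<bullet> k) c else b \<bullet> i) - a \<bullet> i))"
  proof (intro continuous_on_prod)
    fix i
    show "continuous_on UNIV (\<lambda>c. max 0 ((if i = k then min (b \<bullet> k) c else b \<bullet> i) - a \<bullet> i))"
      by (cases "i = k") (auto intro!: continuous_intros)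
  qed
  ultimately show ?thesis by simp
qed

lemma boxes_separated:
  assumes K: "is_cbox K" "vol K > 0" and L: "is_cbox L" "vol L > 0"
    and disj: "interior K \<inter> interior L = {}"
  obtains k c where "k \<in> Basis"
    "K \<subseteq> {x. x \<bullet> k \<le> c} \<and> L \<subseteq> {x. x \<bullet> k \<ge> c} \<or> L \<subseteq> {x. x \<bullet> k \<le> c} \<and> K \<subseteq> {x. x \<bullet> k \<ge> c}"
proof -
  obtain a b c d where ab: "K = cbox a b" "L = cbox c d"
    using K L by (auto simp: is_cbox_def)
  then have "\<forall>i\<in>Basis. a \<bullet> i < b \<bullet> i" "\<forall>i\<in>Basis. c \<bullet> i < d \<bullet> i"
    using K L by (auto simp: content_pos_lt_eq)
  moreover obtain i where i: "i \<in> Basis" "b\<bullet>i \<le> a\<bullet>i \<or> d\<bullet>i \<le> c\<bullet>i \<or> b\<bullet>i \<le> c\<bullet>i \<or> d\<bullet>i \<le> a\<bullet>i"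
    using disj disjoint_interval(4)[of a b c d] by (auto simp: ab)
  ultimately have "b\<bullet>i \<le> c\<bullet>i \<or> d\<bullet>i \<le> a\<bullet>i" by force
  then show thesis
  proof
    assume "b\<bullet>i \<le> c\<bullet>i"
    then have "K \<subseteq> {x. x \<bullet> i \<le> b \<bullet> i} \<and> L \<subseteq> {x. x \<bullet> i \<ge> b \<bullet> i}"
      using i by (fastforce simp: ab mem_box dest: bspec)
    then show thesis using i that by blast
  next
    assume "d\<bullet>i \<le> a\<bullet>i"
    then have "L \<subseteq> {x. x \<bullet> i \<le> d \<bullet> i} \<and> K \<subseteq> {x. x \<bullet> i \<ge> d \<bullet> i}"
      using i by (fastforce simp: ab mem_box dest: bspec)
    then show thesis using i that by blast
  qed
qed

text \<open>
  A brick is a box with a constant density of mass on it.  Bricks are indexed because after a cut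
  the pieces on one side keep the index and the density of the brick that they come from.
\<close>

definition bricks :: "'a::euclidean_space set \<Rightarrow> 'i set \<Rightarrow> ('i \<Rightarrow> 'a set) \<Rightarrow> ('i \<Rightarrow> real) \<Rightarrow> bool" where
  "bricks D I K \<rho> \<longleftrightarrow> finite I \<and>
     (\<forall>i\<in>I. is_cbox (K i) \<and> K i \<subseteq> D \<and> vol (K i) > 0 \<and> \<rho> i > 0) \<and>
     (\<forall>i\<in>I. \<forall>j\<in>I. i \<noteq> j \<longrightarrow> interior (K i) \<inter> interior (K j) = {})"

lemma bricksD:
  assumes "bricks D I K \<rho>"
  shows "finite I" "i \<in> I \<Longrightarrow> is_cbox (K i)" "i \<in> I \<Longrightarrow> K i \<subseteq> D" "i \<in> I \<Longrightarrow> vol (K i) > 0"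
    "i \<in> I \<Longrightarrow> \<rho> i > 0" "i \<in> I \<Longrightarrow> j \<in> I \<Longrightarrow> i \<noteq> j \<Longrightarrow> interior (K i) \<inter> interior (K j) = {}"
  using assms by (auto simp: bricks_def)

text \<open>
  Additivity includes the value \<open>0\<close> on null boxes: a cut may leave nothing but a face of a brick on
  one side of the hyperplane, and such remnants are dropped.
\<close>

definition additive_on_boxes :: "'a::euclidean_space set \<Rightarrow> ('a set \<Rightarrow> real \<Rightarrow> real) \<Rightarrow> bool" where
  "additive_on_boxes D F \<longleftrightarrow> (\<forall>K \<rho>. is_cbox K \<longrightarrow> K \<subseteq> D \<longrightarrow>
     (vol K = 0 \<longrightarrow> F K \<rho> = 0) \<and>
     (\<forall>k\<in>Basis. \<forall>c. F K \<rho> = F (K \<inter> {x. x \<bullet> k \<le> c}) \<rho> + F (K \<inter> {x. x \<bullet> k \<ge> c}) \<rho>))"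

abbreviation mass :: "'a::euclidean_space set \<Rightarrow> real \<Rightarrow> real" where
  "mass K \<rho> \<equiv> \<rho> * vol K"

lemma additive_on_boxesD:
  assumes "additive_on_boxes D F" "is_cbox K" "K \<subseteq> D"
  shows "vol K = 0 \<Longrightarrow> F K \<rho> = 0"
    "k \<in> Basis \<Longrightarrow> F K \<rho> = F (K \<inter> {x. x \<bullet> k \<le> c}) \<rho> + F (K \<inter> {x. x \<bullet> k \<ge> c}) \<rho>"
  using assms unfolding additive_on_boxes_def by blast+

lemma additive_on_boxes_mass: "additive_on_boxes D mass"
proof -
  have "\<rho> * vol K = \<rho> * vol (K \<inter> {x. x \<bullet> k \<le> c}) + \<rho> * vol (K \<inter> {x. x \<bullet> k \<ge> c})"
    if "is_cbox K" "k \<in> Basis" for K :: "'a set" and k \<rho> c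
    using content_is_cbox_split[OF that(2,1), of c] by (simp add: distrib_left)
  then show ?thesis by (auto simp: additive_on_boxes_def)
qed

abbreviation meeting :: "'i set \<Rightarrow> ('i \<Rightarrow> 'a::euclidean_space set) \<Rightarrow> 'a set \<Rightarrow> 'i set" where
  "meeting I K E \<equiv> {i \<in> I. vol (K i \<inter> E) > 0}"

lemma bricks_cut:
  assumes "bricks D I K \<rho>" "k \<in> Basis" "E = {x. x \<bullet> k \<le> c} \<or> E = {x. x \<bullet> k \<ge> c}"
  shows "bricks D (meeting I K E) (\<lambda>i. K i \<inter> E) \<rho>"
  unfolding bricks_def
proof (intro conjI ballI impI)
  show "finite (meeting I K E)" using assms(1) by (simp add: bricks_def)
  fix i assume i: "i \<in> meeting I K E"
  then have K: "is_cbox (K i)" "K i \<subseteq> D" "\<rho> i > 0"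
    using assms(1) by (auto simp: bricks_def)
  show "is_cbox (K i \<inter> E)"
    using is_cbox_halfspace[OF assms(2) K(1)] assms(3) by metis
  show "K i \<inter> E \<subseteq> D" "vol (K i \<inter> E) > 0" "\<rho> i > 0" using i K by auto
  fix j assume "j \<in> meeting I K E" "i \<noteq> j"
  then have "interior (K i) \<inter> interior (K j) = {}"
    using assms(1) i by (simp add: bricks_def)
  then show "interior (K i \<inter> E) \<inter> interior (K j \<inter> E) = {}" by auto
qed

lemma sum_bricks_cut:
  assumes B: "bricks D I K \<rho>" and k: "k \<in> Basis" and F: "additive_on_boxes D F"
  shows "(\<Sum>i\<in>I. F (K i) (\<rho> i)) =
    (\<Sum>i\<in>meeting I K {x. x \<bullet> k \<le> c}. F (K i \<inter> {x. x \<bullet> k \<le> c}) (\<rho> i)) +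
    (\<Sum>i\<in>meeting I K {x. x \<bullet> k \<ge> c}. F (K i \<inter> {x. x \<bullet> k \<ge> c}) (\<rho> i))"
proof -
  have null: "(\<Sum>i\<in>meeting I K E. F (K i \<inter> E) (\<rho> i)) = (\<Sum>i\<in>I. F (K i \<inter> E) (\<rho> i))"
    if "E = {x. x \<bullet> k \<le> c} \<or> E = {x. x \<bullet> k \<ge> c}" for E
  proof (rule sum.mono_neutral_left)
    show "\<forall>i\<in>I - meeting I K E. F (K i \<inter> E) (\<rho> i) = 0"
    proof
      fix i assume i: "i \<in> I - meeting I K E"
      then have "vol (K i \<inter> E) = 0"
        using measure_nonneg[of lborel "K i \<inter> E"] by simp
      moreover have "is_cbox (K i \<inter> E)"
        using is_cbox_halfspace[OF k, of "K i" c] bricksD(2)[OF B, of i] i that by blast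
      moreover have "K i \<inter> E \<subseteq> D" using bricksD(3)[OF B, of i] i by blast
      ultimately show "F (K i \<inter> E) (\<rho> i) = 0" using additive_on_boxesD(1)[OF F] by metis
    qed
  qed (use bricksD(1)[OF B] in auto)
  have "(\<Sum>i\<in>I. F (K i) (\<rho> i)) =
      (\<Sum>i\<in>I. F (K i \<inter> {x. x \<bullet> k \<le> c}) (\<rho> i) + F (K i \<inter> {x. x \<bullet> k \<ge> c}) (\<rho> i))"
    by (intro sum.cong refl additive_on_boxesD(2)[OF F] bricksD[OF B] k)
  then show ?thesis by (simp add: null sum.distrib)
qed

text \<open>
  The mass below a moving hyperplane is a continuous function of its position, so it takes every
  value between \<open>0\<close> and the total mass.
\<close>

lemma cut_at_mass:
  assumes B: "bricks D I K \<rho>" and k: "k \<in> Basis"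
    and m: "0 \<le> m" "m \<le> (\<Sum>i\<in>I. mass (K i) (\<rho> i))"
  obtains c where
    "(\<Sum>i\<in>meeting I K {x. x \<bullet> k \<le> c}. mass (K i \<inter> {x. x \<bullet> k \<le> c}) (\<rho> i)) = m"
proof -
  let ?f = "\<lambda>c. \<Sum>i\<in>I. mass (K i \<inter> {x. x \<bullet> k \<le> c}) (\<rho> i)"
  have "bounded (\<Union>i\<in>I. K i)"
    using bricksD(1,2)[OF B] by (fastforce simp: is_cbox_def)
  then obtain R where R: "R > 0" "\<And>x i. i \<in> I \<Longrightarrow> x \<in> K i \<Longrightarrow> norm x \<le> R"
    by (auto simp: bounded_pos)
  have abs: "\<bar>x \<bullet> k\<bar> \<le> R" if "i \<in> I" "x \<in> K i" for x i
    using Basis_le_norm[OF k, of x] R(2)[OF that] by linarith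
  have "K i \<inter> {x. x \<bullet> k \<le> - R - 1} = {}" "K i \<inter> {x. x \<bullet> k \<le> R} = K i" if "i \<in> I" for i
    using abs[OF that] by fastforce+
  then have ends: "?f (- R - 1) = 0" "?f R = (\<Sum>i\<in>I. mass (K i) (\<rho> i))" by auto
  have "continuous_on {- R - 1..R} ?f"
    by (intro continuous_intros continuous_on_subset[OF continuous_on_content_halfspace[OF k]])
      (use bricksD(2)[OF B] in auto)
  then obtain c where c: "?f c = m"
    using IVT'[of ?f "- R - 1" m R] ends m R by auto
  have "(\<Sum>i\<in>meeting I K {x. x \<bullet> k \<le> c}. mass (K i \<inter> {x. x \<bullet> k \<le> c}) (\<rho> i)) = ?f c"
    by (rule sum.mono_neutral_left) (use bricksD(1)[OF B] in \<open>auto simp: zero_less_measure_iff\<close>)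
  with c show thesis using that by simp
qed

text \<open>
  Some axis-parallel hyperplane leaves fewer bricks on either side: the one that separates two of
  them.  This makes the induction terminate.
\<close>

lemma bricks_cut_proper:
  assumes B: "bricks D I K \<rho>" and two: "card I \<ge> 2"
  obtains k c where "k \<in> Basis"
    "card (meeting I K {x. x \<bullet> k \<le> c}) < card I" "card (meeting I K {x. x \<bullet> k \<ge> c}) < card I"
proof -
  have fin: "finite I" using B by (simp add: bricks_def)
  obtain i j where ij: "i \<in> I" "j \<in> I" "i \<noteq> j"
    using two card_le_Suc0_iff_eq[OF fin] by force
  have null: "vol (L \<inter> E') = 0"
    if "is_cbox L" "k \<in> Basis" "L \<subseteq> E" "E = {x. x \<bullet> k \<le> c} \<and> E' = {x. x \<bullet> k \<ge> c} \<or>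
      E' = {x. x \<bullet> k \<le> c} \<and> E = {x. x \<bullet> k \<ge> c}" for L k E c E'
    using content_is_cbox_split[OF that(2,1), of c] that(3,4) by (auto simp: Int_absorb2)
  have cards: "card (meeting I K {x. x \<bullet> k \<le> c}) < card I \<and> card (meeting I K {x. x \<bullet> k \<ge> c}) < card I"
    if "i \<in> I" "j \<in> I" "k \<in> Basis" "K i \<subseteq> {x. x \<bullet> k \<le> c}" "K j \<subseteq> {x. x \<bullet> k \<ge> c}" for i j k c
  proof -
    have "vol (K i \<inter> {x. x \<bullet> k \<ge> c}) = 0" "vol (K j \<inter> {x. x \<bullet> k \<le> c}) = 0"
      using null[of "K i" k "{x. x \<bullet> k \<le> c}" c "{x. x \<bullet> k \<ge> c}"]
        null[of "K j" k "{x. x \<bullet> k \<ge> c}" c "{x. x \<bullet> k \<le> c}"] bricksD(2)[OF B] that by simp_all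
    then have "j \<notin> meeting I K {x. x \<bullet> k \<le> c}" "i \<notin> meeting I K {x. x \<bullet> k \<ge> c}"
      by simp_all
    then have "meeting I K {x. x \<bullet> k \<le> c} \<subset> I" "meeting I K {x. x \<bullet> k \<ge> c} \<subset> I"
      using that by blast+
    then show ?thesis using fin by (auto intro: psubset_card_mono)
  qed
  obtain k c where "k \<in> Basis"
    "K i \<subseteq> {x. x \<bullet> k \<le> c} \<and> K j \<subseteq> {x. x \<bullet> k \<ge> c} \<or> K j \<subseteq> {x. x \<bullet> k \<le> c} \<and> K i \<subseteq> {x. x \<bullet> k \<ge> c}"
    using boxes_separated[of "K i" "K j"] bricksD[OF B] ij by metis
  then show thesis using that[of k c] cards[of i j k c] cards[of j i k c] ij by blast
qed

definition interpolate :: "real \<Rightarrow> 'a::real_vector set \<Rightarrow> 'a set \<Rightarrow> 'a set" where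
  "interpolate s A B = {(1 - s) *\<^sub>R x + s *\<^sub>R y | x y. x \<in> A \<and> y \<in> B}"

text \<open>
  The cutting argument of Hadwiger and Ohmann, used as an induction principle: an inequality for
  pairs of bricks of equal mass, with functionals additive under cutting, passes to pairs of
  families of equal mass.  If a family has two bricks, a hyperplane orthogonal to an axis separates
  them; a parallel hyperplane cuts the other family in the same proportion of mass, and the
  interpolated hyperplane separates the interpolants of the two halves.  This plays the part of the
  optimal transport map between the two densities.
\<close>

theorem brick_induction:
  fixes I :: "'i set" and J :: "'j set" and \<phi> \<theta> :: "'a::euclidean_space set \<Rightarrow> real \<Rightarrow> real"
  assumes s: "0 < s" "s < 1"
    and \<phi>: "additive_on_boxes D \<phi>" and \<theta>: "additive_on_boxes D \<theta>"
    and N_nonneg: "\<And>Z. is_cbox Z \<Longrightarrow> N Z \<ge> (0::real)"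
    and N_split: "\<And>Z k c. is_cbox Z \<Longrightarrow> k \<in> Basis \<Longrightarrow>
      N (Z \<inter> {x. x \<bullet> k \<le> c}) + N (Z \<inter> {x. x \<bullet> k \<ge> c}) \<le> N Z"
    and pair: "\<And>A B Z \<rho> \<sigma>. is_cbox A \<Longrightarrow> is_cbox B \<Longrightarrow> is_cbox Z \<Longrightarrow> A \<subseteq> D \<Longrightarrow> B \<subseteq> D \<Longrightarrow>
      vol A > 0 \<Longrightarrow> vol B > 0 \<Longrightarrow> \<rho> > 0 \<Longrightarrow> \<sigma> > 0 \<Longrightarrow> mass A \<rho> = mass B \<sigma> \<Longrightarrow>
      interpolate s A B \<subseteq> Z \<Longrightarrow> - N Z \<le> \<phi> A \<rho> + \<theta> B \<sigma>"
    and "bricks D I K \<rho>" "bricks D J L \<sigma>"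
    and "(\<Sum>i\<in>I. mass (K i) (\<rho> i)) = (\<Sum>j\<in>J. mass (L j) (\<sigma> j))"
    and "is_cbox Z" "\<And>i j. i \<in> I \<Longrightarrow> j \<in> J \<Longrightarrow> interpolate s (K i) (L j) \<subseteq> Z"
  shows "- N Z \<le> (\<Sum>i\<in>I. \<phi> (K i) (\<rho> i)) + (\<Sum>j\<in>J. \<theta> (L j) (\<sigma> j))"
  using assms(8-)
proof (induction "card I + card J" arbitrary: I J K L Z rule: less_induct)
  case less
  note BI = less.prems(1) and BJ = less.prems(2) and eq = less.prems(3)
    and Z = less.prems(4) and sub = less.prems(5)
  let ?lo = "\<lambda>k c. {x. x \<bullet> k \<le> c}" and ?hi = "\<lambda>k c. {x. x \<bullet> k \<ge> c}"
  have fin: "finite I" "finite J" using BI BJ by (auto simp: bricks_def)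
  have cut: ?case
    if k: "k \<in> Basis"
      and m: "(\<Sum>i\<in>meeting I K (?lo k c). mass (K i \<inter> ?lo k c) (\<rho> i)) =
        (\<Sum>j\<in>meeting J L (?lo k d). mass (L j \<inter> ?lo k d) (\<sigma> j))"
      and cards: "card (meeting I K (?lo k c)) + card (meeting J L (?lo k d)) < card I + card J"
        "card (meeting I K (?hi k c)) + card (meeting J L (?hi k d)) < card I + card J" for k c d
  proof -
    define e where "e = (1 - s) * c + s * d"
    have "- N (Z \<inter> ?lo k e) \<le>
        (\<Sum>i\<in>meeting I K (?lo k c). \<phi> (K i \<inter> ?lo k c) (\<rho> i)) +
        (\<Sum>j\<in>meeting J L (?lo k d). \<theta> (L j \<inter> ?lo k d) (\<sigma> j))"
    proof (rule less.hyps[OF cards(1) bricks_cut[OF BI k] bricks_cut[OF BJ k] m])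
      fix i j assume "i \<in> meeting I K (?lo k c)" "j \<in> meeting J L (?lo k d)"
      then have "interpolate s (K i) (L j) \<subseteq> Z" using sub by simp
      then show "interpolate s (K i \<inter> ?lo k c) (L j \<inter> ?lo k d) \<subseteq> Z \<inter> ?lo k e"
        using s by (fastforce simp: interpolate_def e_def inner_simps intro!: add_mono mult_left_mono)
    qed (use k Z is_cbox_halfspace in auto)
    moreover have "- N (Z \<inter> ?hi k e) \<le>
        (\<Sum>i\<in>meeting I K (?hi k c). \<phi> (K i \<inter> ?hi k c) (\<rho> i)) +
        (\<Sum>j\<in>meeting J L (?hi k d). \<theta> (L j \<inter> ?hi k d) (\<sigma> j))"
    proof (rule less.hyps[OF cards(2) bricks_cut[OF BI k] bricks_cut[OF BJ k]])
      show "(\<Sum>i\<in>meeting I K (?hi k c). mass (K i \<inter> ?hi k c) (\<rho> i)) =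
          (\<Sum>j\<in>meeting J L (?hi k d). mass (L j \<inter> ?hi k d) (\<sigma> j))"
        using sum_bricks_cut[OF BI k additive_on_boxes_mass, of c]
          sum_bricks_cut[OF BJ k additive_on_boxes_mass, of d] m eq by linarith
      fix i j assume "i \<in> meeting I K (?hi k c)" "j \<in> meeting J L (?hi k d)"
      then have "interpolate s (K i) (L j) \<subseteq> Z" using sub by simp
      then show "interpolate s (K i \<inter> ?hi k c) (L j \<inter> ?hi k d) \<subseteq> Z \<inter> ?hi k e"
        using s by (fastforce simp: interpolate_def e_def inner_simps intro!: add_mono mult_left_mono)
    qed (use k Z is_cbox_halfspace in auto)
    ultimately show ?case
      using N_split[OF Z k, of e] sum_bricks_cut[OF BI k \<phi>, of c] sum_bricks_cut[OF BJ k \<theta>, of d]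
      by linarith
  qed
  have le: "card (meeting I K E) \<le> card I" "card (meeting J L E) \<le> card J" for E
    using fin by (auto intro: card_mono)
  have nonneg: "0 \<le> (\<Sum>i\<in>meeting I K E. mass (K i \<inter> E) (\<rho> i))"
    "0 \<le> (\<Sum>j\<in>meeting J L E. mass (L j \<inter> E) (\<sigma> j))" for E
    using BI BJ by (force simp: bricks_def intro!: sum_nonneg)+
  consider "card I \<ge> 2" | "card J \<ge> 2" | "card I \<le> 1" "card J \<le> 1" by linarith
  then show ?case
  proof cases
    case 1
    from bricks_cut_proper[OF BI 1] obtain k c where k: "k \<in> Basis"
      and card: "card (meeting I K (?lo k c)) < card I" "card (meeting I K (?hi k c)) < card I" .
    have "(\<Sum>i\<in>meeting I K (?lo k c). mass (K i \<inter> ?lo k c) (\<rho> i)) \<le> (\<Sum>j\<in>J. mass (L j) (\<sigma> j))"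
      using sum_bricks_cut[OF BI k additive_on_boxes_mass, of c] nonneg(1)[of "?hi k c"] eq by linarith
    from cut_at_mass[OF BJ k nonneg(1) this] obtain d where
      "(\<Sum>j\<in>meeting J L (?lo k d). mass (L j \<inter> ?lo k d) (\<sigma> j)) =
        (\<Sum>i\<in>meeting I K (?lo k c). mass (K i \<inter> ?lo k c) (\<rho> i))" .
    from cut[OF k this[symmetric]] show ?thesis
      using card le(2)[of "?lo k d"] le(2)[of "?hi k d"] by linarith
  next
    case 2
    from bricks_cut_proper[OF BJ 2] obtain k d where k: "k \<in> Basis"
      and card: "card (meeting J L (?lo k d)) < card J" "card (meeting J L (?hi k d)) < card J" .
    have "(\<Sum>j\<in>meeting J L (?lo k d). mass (L j \<inter> ?lo k d) (\<sigma> j)) \<le> (\<Sum>i\<in>I. mass (K i) (\<rho> i))"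
      using sum_bricks_cut[OF BJ k additive_on_boxes_mass, of d] nonneg(2)[of "?hi k d"] eq by linarith
    from cut_at_mass[OF BI k nonneg(2) this] obtain c where
      "(\<Sum>i\<in>meeting I K (?lo k c). mass (K i \<inter> ?lo k c) (\<rho> i)) =
        (\<Sum>j\<in>meeting J L (?lo k d). mass (L j \<inter> ?lo k d) (\<sigma> j))" .
    from cut[OF k this] show ?thesis
      using card le(1)[of "?lo k c"] le(1)[of "?hi k c"] by linarith
  next
    case 3
    have pos: "(\<Sum>i\<in>I. mass (K i) (\<rho> i)) > 0" if "I \<noteq> {}"
      by (rule sum_pos) (use fin that BI in \<open>auto simp: bricks_def\<close>)
    have pos': "(\<Sum>j\<in>J. mass (L j) (\<sigma> j)) > 0" if "J \<noteq> {}"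
      by (rule sum_pos) (use fin that BJ in \<open>auto simp: bricks_def\<close>)
    show ?thesis
    proof (cases "I = {}")
      case True
      then have "J = {}" using eq pos' by force
      with True N_nonneg[OF Z] show ?thesis by simp
    next
      case False
      then have "J \<noteq> {}" using eq pos by force
      with False 3 fin have "card I = 1" "card J = 1"
        by (simp_all add: le_Suc_eq)
      then obtain i j where "I = {i}" "J = {j}" by (auto simp: card_1_singleton_iff)
      then show ?thesis using pair[of "K i" "L j" Z "\<rho> i" "\<sigma> j"] BI BJ eq Z sub
        by (simp add: bricks_def)
    qed
  qed
qed

section \<open>The inequality for a pair of boxes of equal mass\<close>

text \<open>
  The affine bijection of the unit cube onto \<open>cbox a b\<close>.  It is linear in \<open>(a, b)\<close>, so interpolating
  between two boxes amounts to interpolating between the points with the same parameter.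
\<close>

definition box_point :: "'a::euclidean_space \<Rightarrow> 'a \<Rightarrow> 'a \<Rightarrow> 'a" where
  "box_point a b y = a + (\<Sum>k\<in>Basis. (((b - a) \<bullet> k) * (y \<bullet> k)) *\<^sub>R k)"

abbreviation unit_cube :: "'a::euclidean_space set" where
  "unit_cube \<equiv> cbox 0 One"

lemma box_point_image: "cbox a b \<noteq> {} \<Longrightarrow> box_point a b ` unit_cube = cbox a b"
  using cbox_image_unit_interval[of a b] by (simp add: box_point_def[abs_def] inner_diff_left image_image)

lemma box_point_in: "cbox a b \<noteq> {} \<Longrightarrow> y \<in> unit_cube \<Longrightarrow> box_point a b y \<in> cbox a b"
  using box_point_image by blast

lemma box_point_inner:
  "k \<in> Basis \<Longrightarrow> box_point a b y \<bullet> k = a \<bullet> k + (b \<bullet> k - a \<bullet> k) * (y \<bullet> k)"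
  unfolding box_point_def by (simp add: inner_add_left inner_diff_left)

lemma box_point_interpolate:
  "(1 - s) *\<^sub>R box_point a b y + s *\<^sub>R box_point c d y =
    box_point ((1 - s) *\<^sub>R a + s *\<^sub>R c) ((1 - s) *\<^sub>R b + s *\<^sub>R d) y"
  by (rule euclidean_eqI) (simp add: box_point_inner inner_add_left algebra_simps)

lemma has_integral_unit_cube:
  fixes f :: "'a::euclidean_space \<Rightarrow> real"
  assumes f: "f integrable_on cbox a b" and pos: "vol (cbox a b) > 0"
  shows "((\<lambda>y. f (box_point a b y)) has_integral integral (cbox a b) f / vol (cbox a b)) unit_cube"
proof -
  have ab: "\<forall>i\<in>Basis. a \<bullet> i < b \<bullet> i" using pos by (simp add: content_pos_lt_eq)
  have "((f \<circ> (+) a) has_integral integral (cbox a b) f) (cbox 0 (b - a))"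
    using f has_integral_shift_cbox_iff[of f a _ 0 "b - a"] by (simp add: has_integral_integral)
  moreover have "\<forall>k\<in>Basis. (b - a) \<bullet> k \<noteq> 0" using ab by (auto simp: inner_diff_left)
  ultimately have "((\<lambda>y. f (box_point a b y)) has_integral
      (1 / \<bar>\<Prod>k\<in>Basis. (b - a) \<bullet> k\<bar>) *\<^sub>R integral (cbox a b) f)
      ((\<lambda>x. \<Sum>k\<in>Basis. (1 / ((b - a) \<bullet> k) * (x \<bullet> k)) *\<^sub>R k) ` cbox 0 (b - a))"
    using has_integral_stretch[of "f \<circ> (+) a" _ 0 "b - a" "\<lambda>k. (b - a) \<bullet> k"]
    by (simp add: box_point_def[abs_def] o_def)
  also have "(\<lambda>x. \<Sum>k\<in>Basis. (1 / ((b - a) \<bullet> k) * (x \<bullet> k)) *\<^sub>R k) ` cbox 0 (b - a) = unit_cube"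
  proof -
    have "(\<Sum>k\<in>Basis. max (1 / ((b - a) \<bullet> k) * ((0::'a) \<bullet> k)) (1 / ((b - a) \<bullet> k) * ((b - a) \<bullet> k)) *\<^sub>R k)
        = (One::'a)"
      using ab by (intro sum.cong refl) (auto simp: inner_diff_left)
    moreover have "(\<Sum>k\<in>Basis. min (1 / ((b - a) \<bullet> k) * ((0::'a) \<bullet> k)) (1 / ((b - a) \<bullet> k) * ((b - a) \<bullet> k)) *\<^sub>R k)
        = (0::'a)"
      using ab by (intro sum.neutral) (auto simp: inner_diff_left)
    moreover have "cbox 0 (b - a) \<noteq> {}" using ab by (simp add: box_ne_empty inner_diff_left less_imp_le)
    ultimately show ?thesis by (simp only: image_stretch_interval if_False)
  qed
  also have "\<bar>\<Prod>k\<in>Basis. (b - a) \<bullet> k\<bar> = vol (cbox a b)"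
  proof -
    have "vol (cbox a b) = (\<Prod>k\<in>Basis. (b - a) \<bullet> k)"
      unfolding content_cbox_max using ab
      by (intro prod.cong) (auto simp: inner_diff_left)
    then show ?thesis using pos by simp
  qed
  finally show ?thesis by simp
qed

text \<open>
  A bounded convex domain \<open>D\<close> with a positive density \<open>u\<close> and a potential \<open>V\<close> on it.  The vector
  field \<open>g\<close> is the gradient of \<open>H' \<circ> u + V\<close>, and \<open>V_convex\<close> is the integrated form of \<open>\<nabla>\<^sup>2 V \<ge> C\<close>.
\<close>

locale transport_data = internal_energy H psi psi' "DIM('a)"
  for H psi psi' and D :: "'a::euclidean_space set" and u V :: "'a \<Rightarrow> real" and g :: "'a \<Rightarrow> 'a"
    and C c0 :: real +
  assumes D: "open D" "convex D" "bounded D"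
    and c0_pos: "c0 > 0" and u_lower: "x \<in> D \<Longrightarrow> c0 \<le> u x"
    and unif_u: "uniformly_continuous_on D u"
    and unif_V: "uniformly_continuous_on D V"
    and unif_g: "uniformly_continuous_on D g"
    and grad: "x \<in> D \<Longrightarrow> ((\<lambda>x. psi (u x) + V x) has_derivative (\<lambda>h. g x \<bullet> h)) (at x)"
    and C_pos: "C > 0"
    and V_convex: "x \<in> D \<Longrightarrow> y \<in> D \<Longrightarrow> 0 \<le> s \<Longrightarrow> s \<le> 1 \<Longrightarrow>
      V ((1 - s) *\<^sub>R x + s *\<^sub>R y) + C / 2 * (s * (1 - s)) * (norm (x - y))\<^sup>2
        \<le> (1 - s) * V x + s * V y"
begin

lemma u_pos: "x \<in> D \<Longrightarrow> u x > 0"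
  using u_lower c0_pos by force

lemma continuous_on_data:
  "continuous_on D u" "continuous_on D V" "continuous_on D g"
  "continuous_on D (\<lambda>x. psi (u x))" "continuous_on D (\<lambda>x. H (u x))"
  "continuous_on D (\<lambda>x. pressure (u x))"
proof -
  show u: "continuous_on D u" and "continuous_on D V" and "continuous_on D g"
    using unif_u unif_V unif_g by (auto intro: uniformly_continuous_imp_continuous)
  show "continuous_on D (\<lambda>x. psi (u x))" "continuous_on D (\<lambda>x. H (u x))"
    "continuous_on D (\<lambda>x. pressure (u x))"
    by (rule continuous_on_compose2[OF continuous_on_psi u] continuous_on_compose2[OF continuous_on_H u]
        continuous_on_compose2[OF continuous_on_pressure u]; use u_pos in auto)+
qed

text \<open>
  What remains of \<open>H' \<circ> u + V\<close> after paying for a displacement of unknown length: by Young's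
  inequality, \<open>C / 2 * (1 - s) * |\<delta>|\<^sup>2 + g \<bullet> \<delta> \<ge> - |g|\<^sup>2 / (2 * C * (1 - s))\<close>, and \<open>s * e\<close> is the
  error of the linearization.
\<close>

definition residue_density :: "real \<Rightarrow> real \<Rightarrow> 'a \<Rightarrow> real" where
  "residue_density s e x = psi (u x) + V x - s * (norm (g x))\<^sup>2 / (2 * C * (1 - s)) - s * e"

lemma continuous_on_residue_density: "continuous_on D (residue_density s e)"
  unfolding residue_density_def[abs_def] divide_inverse
  by (intro continuous_intros continuous_on_data)

text \<open>
  A particle moves from \<open>x\<close> to \<open>z\<close> and is at \<open>(1 - s) x + s z\<close> at time \<open>s\<close>.  The gain
  \<open>C / 2 * s * (1 - s) * |z - x|\<^sup>2\<close> from the convexity of \<open>V\<close> absorbs the first variation \<open>s * g x \<bullet> (z - x)\<close>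
  of \<open>H' \<circ> u + V\<close> along the path.
\<close>

lemma pointwise_transport:
  assumes x: "x \<in> D" and z: "z \<in> D" and s: "0 < s" "s < 1"
    and R: "\<And>x y. x \<in> D \<Longrightarrow> y \<in> D \<Longrightarrow> norm (x - y) \<le> R"
    and osc: "\<And>x y. x \<in> D \<Longrightarrow> y \<in> D \<Longrightarrow> norm (x - y) \<le> s * R \<Longrightarrow> norm (g x - g y) \<le> e"
    and e: "e \<ge> 0"
  shows "residue_density s (e * R) x
    \<le> (1 - s) * V x + s * V z + psi (u ((1 - s) *\<^sub>R x + s *\<^sub>R z))"
proof -
  define c where "c = (1 - s) *\<^sub>R x + s *\<^sub>R z"
  define \<delta> where "\<delta> = z - x"
  let ?G = "\<lambda>x. psi (u x) + V x"
  have c: "c \<in> D" unfolding c_def using D(2) x z s by (simp add: convex_alt)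
  have cx: "c - x = s *\<^sub>R \<delta>" by (simp add: c_def \<delta>_def algebra_simps)
  have seg: "closed_segment x c \<subseteq> D" using D(2) x c by (simp add: closed_segment_subset)
  have "\<exists>\<xi>\<in>closed_segment x c. ?G c - ?G x = g \<xi> \<bullet> (c - x)"
  proof -
    have "\<exists>t\<in>{0<..<1}. ?G (x + 1 *\<^sub>R (c - x)) - ?G (x + 0 *\<^sub>R (c - x)) =
        (1 - 0) * (g (x + t *\<^sub>R (c - x)) \<bullet> (c - x))"
    proof -
      have pt: "x + t *\<^sub>R (c - x) \<in> D" if "0 \<le> t" "t \<le> 1" for t
      proof -
        have "(1 - t) *\<^sub>R x + t *\<^sub>R c \<in> D" using D(2) x c that by (simp add: convex_alt)
        then show ?thesis by (simp add: algebra_simps)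
      qed
      have "((\<lambda>t. ?G (x + t *\<^sub>R (c - x))) has_real_derivative g (x + t *\<^sub>R (c - x)) \<bullet> (c - x)) (at t)"
        if "0 \<le> t" "t \<le> 1" for t
      proof -
        have "((\<lambda>t. x + t *\<^sub>R (c - x)) has_derivative (\<lambda>h. h *\<^sub>R (c - x))) (at t)"
          by (auto intro!: derivative_eq_intros)
        from has_derivative_compose[OF this grad[OF pt[OF that]]]
        show ?thesis
          by (simp add: has_field_derivative_def inner_scaleR_right mult_commute_abs)
      qed
      then obtain t where "t > 0" "t < 1" "?G (x + 1 *\<^sub>R (c - x)) - ?G (x + 0 *\<^sub>R (c - x)) =
        (1 - 0) * (g (x + t *\<^sub>R (c - x)) \<bullet> (c - x))"
        using MVT2[of 0 1 "\<lambda>t. ?G (x + t *\<^sub>R (c - x))" "\<lambda>t. g (x + t *\<^sub>R (c - x)) \<bullet> (c - x)"]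
        by auto
      then show ?thesis by force
    qed
    then obtain t where "0 < t" "t < 1" "?G c - ?G x = g (x + t *\<^sub>R (c - x)) \<bullet> (c - x)" by auto
    moreover from this have "x + t *\<^sub>R (c - x) \<in> closed_segment x c"
      by (auto simp: in_segment algebra_simps intro!: exI[of _ t])
    ultimately show ?thesis by blast
  qed
  then obtain \<xi> where \<xi>: "\<xi> \<in> closed_segment x c" "?G c - ?G x = s * (g \<xi> \<bullet> \<delta>)"
    by (auto simp: cx)
  have "norm (\<xi> - x) \<le> norm (c - x)"
    using segment_bound(1)[OF \<xi>(1)] by simp
  also have "\<dots> \<le> s * R" using R[OF z x] s by (simp add: cx \<delta>_def)
  finally have gap: "norm (g \<xi> - g x) \<le> e" using osc seg \<xi> x by blast
  have "\<bar>(g \<xi> - g x) \<bullet> \<delta>\<bar> \<le> norm (g \<xi> - g x) * norm \<delta>" by (rule Cauchy_Schwarz_ineq2)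
  also have "\<dots> \<le> e * R" using gap R[OF z x] e by (intro mult_mono) (auto simp: \<delta>_def)
  finally have lin: "g \<xi> \<bullet> \<delta> \<ge> g x \<bullet> \<delta> - e * R" by (simp add: inner_diff_left)
  have young: "g x \<bullet> \<delta> + C / 2 * (1 - s) * (norm \<delta>)\<^sup>2 \<ge> - (norm (g x))\<^sup>2 / (2 * C * (1 - s))"
  proof -
    define k where "k = C * (1 - s)"
    have k: "k > 0" using C_pos s by (simp add: k_def)
    have "0 \<le> (norm (g x + k *\<^sub>R \<delta>))\<^sup>2" by simp
    also have "\<dots> = (norm (g x))\<^sup>2 + 2 * k * (g x \<bullet> \<delta>) + k\<^sup>2 * (norm \<delta>)\<^sup>2"
      unfolding power2_norm_eq_inner
      by (simp add: inner_simps inner_commute power2_eq_square algebra_simps)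
    also have "\<dots> = 2 * k * ((norm (g x))\<^sup>2 / (2 * k) + g x \<bullet> \<delta> + k / 2 * (norm \<delta>)\<^sup>2)"
      using k by (simp add: field_simps power2_eq_square)
    finally have "0 \<le> (norm (g x))\<^sup>2 / (2 * k) + g x \<bullet> \<delta> + k / 2 * (norm \<delta>)\<^sup>2"
      using k by (simp add: zero_le_mult_iff)
    then show ?thesis by (simp add: k_def mult.assoc)
  qed
  have "s * (g \<xi> \<bullet> \<delta> + C / 2 * (1 - s) * (norm \<delta>)\<^sup>2) \<ge>
      s * (- (norm (g x))\<^sup>2 / (2 * C * (1 - s)) - e * R)"
    using lin young s by (intro mult_left_mono) auto
  moreover have "V c + C / 2 * (s * (1 - s)) * (norm \<delta>)\<^sup>2 \<le> (1 - s) * V x + s * V z"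
    using V_convex[OF x z, of s] s by (simp add: c_def \<delta>_def norm_minus_commute)
  ultimately show ?thesis
    using \<xi>(2) unfolding residue_density_def c_def[symmetric] by (simp add: algebra_simps)
qed

lemma bounded_data:
  "bounded (u ` D)" "bounded (V ` D)" "bounded (g ` D)"
  "bounded ((\<lambda>x. psi (u x)) ` D)" "bounded ((\<lambda>x. H (u x)) ` D)" "bounded ((\<lambda>x. pressure (u x)) ` D)"
proof -
  show u: "bounded (u ` D)" and "bounded (V ` D)" and "bounded (g ` D)"
    using bounded_uniformly_continuous_image[OF _ D(3)] unif_u unif_V unif_g by auto
  obtain c1 where c1: "\<And>x. x \<in> D \<Longrightarrow> \<bar>u x\<bar> \<le> c1"
    using u by (auto simp: bounded_iff)
  have bdd: "bounded ((\<lambda>x. f (u x)) ` D)" if "continuous_on {0<..} f" for f :: "real \<Rightarrow> real"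
  proof (rule bounded_subset)
    show "bounded (f ` {c0..c1})"
      by (intro compact_imp_bounded compact_continuous_image continuous_on_subset[OF that])
        (use c0_pos in auto)
    show "(\<lambda>x. f (u x)) ` D \<subseteq> f ` {c0..c1}"
      using u_lower c1 by (force simp: abs_le_iff)
  qed
  show "bounded ((\<lambda>x. psi (u x)) ` D)" "bounded ((\<lambda>x. H (u x)) ` D)"
    "bounded ((\<lambda>x. pressure (u x)) ` D)"
    by (intro bdd continuous_on_psi continuous_on_H continuous_on_pressure)+
qed

lemma D_lmeasurable: "D \<in> lmeasurable"
  using D by (simp add: lmeasurable_open)

lemma absolutely_integrable_on_D:
  fixes f :: "'a \<Rightarrow> real"
  assumes "continuous_on D f" "bounded (f ` D)"
  shows "f absolutely_integrable_on D"
proof -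
  obtain M where "\<And>x. x \<in> D \<Longrightarrow> norm (f x) \<le> M" using assms(2) by (auto simp: bounded_iff)
  then show ?thesis
    using D_lmeasurable assms(1)
    by (intro measurable_bounded_by_integrable_imp_absolutely_integrable[where g = "\<lambda>_. M"]
        continuous_imp_measurable_on_sets_lebesgue integrable_on_const) (auto simp: fmeasurableD)
qed

lemma integrable_on_box:
  fixes f :: "'a \<Rightarrow> real"
  assumes "continuous_on D f" "is_cbox K" "K \<subseteq> D"
  shows "f integrable_on K"
  using assms(2,3) continuous_on_subset[OF assms(1,3)]
  by (auto simp: is_cbox_def intro: integrable_continuous)

text \<open>
  Along an interpolation the energy satisfies \<open>E s \<le> (1 - s) * E 0 + s * E 1\<close>, and the tangents of \<open>H\<close>
  bound \<open>E s\<close> from below by an integral against the moved mass less an integral of the pressure.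
  The values of the bricks collect \<open>(1 - s) * E 0\<close> and \<open>s * E 1\<close>, the first one less what
  \<open>pointwise_transport\<close> guarantees for the moved mass; the pressure is kept apart because it is
  integrated over the interpolated box.
\<close>

definition source_value :: "real \<Rightarrow> real \<Rightarrow> 'a set \<Rightarrow> real \<Rightarrow> real" where
  "source_value s e A \<rho> =
    (1 - s) * (vol A * H \<rho> + \<rho> * integral A V) - \<rho> * integral A (residue_density s e)"

definition target_value :: "real \<Rightarrow> 'a set \<Rightarrow> real \<Rightarrow> real" where
  "target_value s B \<sigma> = s * (vol B * H \<sigma> + \<sigma> * integral B V)"

definition pressure_on :: "'a set \<Rightarrow> real" where
  "pressure_on Z = integral Z (\<lambda>x. if x \<in> D then pressure (u x) else 0)"

lemma additive_on_boxes_integral: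
  assumes "continuous_on D f"
  shows "additive_on_boxes D (\<lambda>A \<rho>. a \<rho> * vol A + b \<rho> * integral A f)"
  unfolding additive_on_boxes_def
proof (intro allI impI conjI ballI)
  fix K :: "'a set" and \<rho> :: real and k :: 'a and c :: real
  assume K: "is_cbox K" "K \<subseteq> D"
  then obtain p q where pq: "K = cbox p q" by (auto simp: is_cbox_def)
  show "a \<rho> * vol K + b \<rho> * integral K f = 0" if "vol K = 0"
    using that integral_null[of p q f] by (simp add: pq)
  assume k: "k \<in> Basis"
  have "vol K = vol (K \<inter> {x. x \<bullet> k \<le> c}) + vol (K \<inter> {x. x \<bullet> k \<ge> c})"
    "integral K f = integral (K \<inter> {x. x \<bullet> k \<le> c}) f + integral (K \<inter> {x. x \<bullet> k \<ge> c}) f"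
    using content_split[OF k, of p q c] integral_split[OF _ k, of f p q c]
      integrable_on_box[OF assms K] by (simp_all add: pq)
  then show "a \<rho> * vol K + b \<rho> * integral K f =
      a \<rho> * vol (K \<inter> {x. x \<bullet> k \<le> c}) + b \<rho> * integral (K \<inter> {x. x \<bullet> k \<le> c}) f +
      (a \<rho> * vol (K \<inter> {x. x \<bullet> k \<ge> c}) + b \<rho> * integral (K \<inter> {x. x \<bullet> k \<ge> c}) f)"
    by (simp only: distrib_left add_ac)
qed

lemma additive_on_boxes_values:
  "additive_on_boxes D (source_value s e)" "additive_on_boxes D (target_value s)"
proof -
  have V: "continuous_on D V" and W: "continuous_on D (residue_density s e)"
    by (rule continuous_on_data continuous_on_residue_density)+
  have plus: "additive_on_boxes D (\<lambda>A \<rho>. F A \<rho> + F' A \<rho>)"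
    if F: "additive_on_boxes D F" and F': "additive_on_boxes D F'" for F F' :: "'a set \<Rightarrow> real \<Rightarrow> real"
    unfolding additive_on_boxes_def
  proof (intro allI impI conjI ballI)
    fix K :: "'a set" and \<rho> :: real and k :: 'a and c :: real
    assume K: "is_cbox K" "K \<subseteq> D"
    show "F K \<rho> + F' K \<rho> = 0" if "vol K = 0"
      by (simp add: additive_on_boxesD(1)[OF F K that] additive_on_boxesD(1)[OF F' K that])
    assume k: "k \<in> Basis"
    show "F K \<rho> + F' K \<rho> =
        F (K \<inter> {x. x \<bullet> k \<le> c}) \<rho> + F' (K \<inter> {x. x \<bullet> k \<le> c}) \<rho> +
        (F (K \<inter> {x. x \<bullet> k \<ge> c}) \<rho> + F' (K \<inter> {x. x \<bullet> k \<ge> c}) \<rho>)"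
      using additive_on_boxesD(2)[OF F K k, of \<rho> c] additive_on_boxesD(2)[OF F' K k, of \<rho> c]
      by simp
  qed
  from plus[OF additive_on_boxes_integral[OF V, of "\<lambda>\<rho>. (1 - s) * H \<rho>" "\<lambda>\<rho>. (1 - s) * \<rho>"]
      additive_on_boxes_integral[OF W, of "\<lambda>_. 0" "\<lambda>\<rho>. - \<rho>"]]
  show "additive_on_boxes D (source_value s e)"
    by (simp add: source_value_def[abs_def] algebra_simps)
  from additive_on_boxes_integral[OF V, of "\<lambda>\<rho>. s * H \<rho>" "\<lambda>\<rho>. s * \<rho>"]
  show "additive_on_boxes D (target_value s)"
    by (simp add: target_value_def[abs_def] algebra_simps)
qed

lemma pressure_on_integrable:
  assumes "is_cbox Z"
  shows "(\<lambda>x. if x \<in> D then pressure (u x) else 0) integrable_on Z"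
proof -
  have "(\<lambda>x. pressure (u x)) absolutely_integrable_on D"
    by (intro absolutely_integrable_on_D continuous_on_data bounded_data)
  then have "(\<lambda>x. if x \<in> D then pressure (u x) else 0) integrable_on UNIV"
    by (simp add: integrable_restrict_UNIV set_lebesgue_integral_eq_integral(1))
  then show ?thesis using assms by (auto simp: is_cbox_def intro: integrable_on_subcbox)
qed

lemma pressure_on_nonneg: "is_cbox Z \<Longrightarrow> pressure_on Z \<ge> 0"
  unfolding pressure_on_def
  by (intro integral_nonneg pressure_on_integrable) (auto simp: pressure_nonneg u_pos)

lemma pressure_on_split:
  assumes "is_cbox Z" "k \<in> Basis"
  shows "pressure_on (Z \<inter> {x. x \<bullet> k \<le> c}) + pressure_on (Z \<inter> {x. x \<bullet> k \<ge> c}) \<le> pressure_on Z"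
  using assms pressure_on_integrable[OF assms(1)]
  by (auto simp: is_cbox_def pressure_on_def integral_split[OF _ assms(2), of _ _ _ c])

lemma pressure_on_le: "is_cbox Z \<Longrightarrow> pressure_on Z \<le> integral D (\<lambda>x. pressure (u x))"
proof -
  assume Z: "is_cbox Z"
  have "(\<lambda>x. pressure (u x)) absolutely_integrable_on D"
    by (intro absolutely_integrable_on_D continuous_on_data bounded_data)
  then have "(\<lambda>x. if x \<in> D then pressure (u x) else 0) integrable_on UNIV"
    by (simp add: integrable_restrict_UNIV set_lebesgue_integral_eq_integral(1))
  then have "pressure_on Z \<le> integral UNIV (\<lambda>x. if x \<in> D then pressure (u x) else 0)"
    unfolding pressure_on_def
    by (rule integral_subset_le[OF subset_UNIV pressure_on_integrable[OF Z]])
      (auto simp: pressure_nonneg u_pos)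
  then show ?thesis by (simp add: integral_restrict_UNIV)
qed

text \<open>
  The mass \<open>m\<close> is moved affinely from \<open>A\<close> to \<open>B\<close>; at time \<open>s\<close> it fills the interpolated box \<open>E\<close>
  evenly.  The energy of \<open>E\<close> is bounded above by displacement convexity and below by the tangents
  of \<open>H\<close> at the values of \<open>u\<close> on \<open>E\<close>.
\<close>

lemma brick_pair:
  assumes s: "0 < s" "s < 1"
    and R: "\<And>x y. x \<in> D \<Longrightarrow> y \<in> D \<Longrightarrow> norm (x - y) \<le> R"
    and osc: "\<And>x y. x \<in> D \<Longrightarrow> y \<in> D \<Longrightarrow> norm (x - y) \<le> s * R \<Longrightarrow> norm (g x - g y) \<le> e"
    and e: "e \<ge> 0"
    and A: "is_cbox A" "A \<subseteq> D" "vol A > 0" and B: "is_cbox B" "B \<subseteq> D" "vol B > 0"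
    and \<rho>: "\<rho> > 0" and \<sigma>: "\<sigma> > 0" and mass: "mass A \<rho> = mass B \<sigma>"
    and Z: "is_cbox Z" "interpolate s A B \<subseteq> Z"
  shows "- pressure_on Z \<le> source_value s (e * R) A \<rho> + target_value s B \<sigma>"
proof -
  obtain a b c d where ab: "A = cbox a b" and cd: "B = cbox c d"
    using A(1) B(1) by (auto simp: is_cbox_def)
  define p q where "p = (1 - s) *\<^sub>R a + s *\<^sub>R c" and "q = (1 - s) *\<^sub>R b + s *\<^sub>R d"
  define E where "E = cbox p q"
  have edges: "\<forall>i\<in>Basis. a \<bullet> i < b \<bullet> i" "\<forall>i\<in>Basis. c \<bullet> i < d \<bullet> i"
    using A(3) B(3) by (simp_all add: ab cd content_pos_lt_eq)
  have "p \<bullet> i < q \<bullet> i" if "i \<in> Basis" for i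
    unfolding p_def q_def inner_add_left inner_scaleR_left
    by (rule add_strict_mono; rule mult_strict_left_mono) (use edges that s in auto)
  then have E_pos: "vol E > 0" by (simp add: E_def content_pos_lt_eq)
  have ne: "cbox a b \<noteq> {}" "cbox c d \<noteq> {}" "cbox p q \<noteq> {}"
    using A(3) B(3) E_pos by (auto simp: ab cd E_def)
  have point: "box_point a b y \<in> D" "box_point c d y \<in> D"
    "(1 - s) *\<^sub>R box_point a b y + s *\<^sub>R box_point c d y = box_point p q y"
    if "y \<in> unit_cube" for y
    using box_point_in[OF ne(1) that] box_point_in[OF ne(2) that] A(2) B(2)
    by (auto simp: ab cd p_def q_def box_point_interpolate)
  have E_sub: "E \<subseteq> interpolate s A B" and ED: "E \<subseteq> D"
  proof -
    have "w \<in> interpolate s A B \<and> w \<in> D" if w: "w \<in> E" for w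
    proof -
      obtain y where y: "y \<in> unit_cube" "w = box_point p q y"
        using box_point_image[OF ne(3)] w by (auto simp: E_def)
      have "w = (1 - s) *\<^sub>R box_point a b y + s *\<^sub>R box_point c d y"
        using point(3)[OF y(1)] y(2) by simp
      moreover have "box_point a b y \<in> A" "box_point c d y \<in> B"
        using box_point_in ne y(1) by (auto simp: ab cd)
      moreover have "(1 - s) *\<^sub>R box_point a b y + s *\<^sub>R box_point c d y \<in> D"
        by (rule convexD_alt[OF D(2) point(1,2)[OF y(1)]]) (use s in auto)
      ultimately show ?thesis unfolding interpolate_def by blast
    qed
    then show "E \<subseteq> interpolate s A B" "E \<subseteq> D" by auto
  qed
  have E_box: "is_cbox E" by (auto simp: is_cbox_def E_def)
  define m where "m = mass A \<rho>"
  have m: "m > 0" "m / vol A = \<rho>" "m / vol B = \<sigma>"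
    using A(3) B(3) \<rho> by (simp_all add: m_def mass)
      (simp_all add: mass[symmetric] m_def)
  define r where "r = m / vol E"
  have r: "r > 0" using m E_pos by (simp add: r_def)
  have energy: "vol E * H r \<le> (1 - s) * (vol A * H \<rho>) + s * (vol B * H \<sigma>)"
  proof -
    have "(\<Prod>i\<in>Basis. b \<bullet> i - a \<bullet> i) = vol A" "(\<Prod>i\<in>Basis. d \<bullet> i - c \<bullet> i) = vol B"
      "(\<Prod>i\<in>Basis. q \<bullet> i - p \<bullet> i) = vol E"
      by (simp_all only: ab cd E_def content_cbox'[OF ne(1)] content_cbox'[OF ne(2)]
          content_cbox'[OF ne(3)])
    moreover have "q \<bullet> i - p \<bullet> i = (1 - s) * (b \<bullet> i - a \<bullet> i) + s * (d \<bullet> i - c \<bullet> i)" for i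
      by (simp add: p_def q_def inner_simps algebra_simps)
    ultimately show ?thesis
      using box_energy_convex[of "Basis :: 'a set" "\<lambda>i. b \<bullet> i - a \<bullet> i" "\<lambda>i. d \<bullet> i - c \<bullet> i" s m]
        edges s m by (simp add: r_def)
  qed
  have cont: "continuous_on D (residue_density s (e * R))" "continuous_on D V"
      "continuous_on D (\<lambda>x. psi (u x))" "continuous_on D (\<lambda>x. pressure (u x))"
    by (rule continuous_on_residue_density continuous_on_data)+
  note int = integrable_on_box[OF cont(1) A(1,2)] integrable_on_box[OF cont(2) A(1,2)]
    integrable_on_box[OF cont(2) B(1,2)] integrable_on_box[OF cont(3) E_box ED]
    integrable_on_box[OF cont(4) E_box ED]
  have "integral A (residue_density s (e * R)) / vol A \<le>
      (1 - s) * (integral A V / vol A) + s * (integral B V / vol B)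
      + integral E (\<lambda>x. psi (u x)) / vol E"
  proof (rule has_integral_le)
    show "((\<lambda>y. residue_density s (e * R) (box_point a b y)) has_integral
        integral A (residue_density s (e * R)) / vol A) unit_cube"
      using has_integral_unit_cube int(1) A(3) unfolding ab by blast
    show "((\<lambda>y. (1 - s) * V (box_point a b y) + s * V (box_point c d y)
        + psi (u (box_point p q y))) has_integral
        (1 - s) * (integral A V / vol A) + s * (integral B V / vol B)
          + integral E (\<lambda>x. psi (u x)) / vol E) unit_cube"
      using has_integral_unit_cube[of V a b] has_integral_unit_cube[of V c d]
        has_integral_unit_cube[of "\<lambda>x. psi (u x)" p q] int A(3) B(3) E_pos
      unfolding ab cd E_def by (intro has_integral_add has_integral_mult_right) auto
    fix y :: 'a assume y: "y \<in> unit_cube"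
    show "residue_density s (e * R) (box_point a b y) \<le>
        (1 - s) * V (box_point a b y) + s * V (box_point c d y) + psi (u (box_point p q y))"
      using pointwise_transport[OF point(1,2)[OF y] s R osc e] point(3)[OF y] by simp
  qed
  then have "m * (integral A (residue_density s (e * R)) / vol A) \<le>
      m * ((1 - s) * (integral A V / vol A) + s * (integral B V / vol B)
      + integral E (\<lambda>x. psi (u x)) / vol E)"
    using m(1) by (intro mult_left_mono) auto
  also have "m * ((1 - s) * (integral A V / vol A) + s * (integral B V / vol B)
      + integral E (\<lambda>x. psi (u x)) / vol E) =
      (1 - s) * (m / vol A * integral A V) + s * (m / vol B * integral B V)
      + m / vol E * integral E (\<lambda>x. psi (u x))"
    by (simp add: distrib_left mult.left_commute[of m])
  also have "m * (integral A (residue_density s (e * R)) / vol A) =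
      \<rho> * integral A (residue_density s (e * R))"
    by (simp add: m(2)[symmetric])
  finally have moved: "\<rho> * integral A (residue_density s (e * R)) \<le>
      (1 - s) * (\<rho> * integral A V) + s * (\<sigma> * integral B V) + r * integral E (\<lambda>x. psi (u x))"
    by (simp only: m(2,3) r_def)
  have "integral E (\<lambda>x. r * psi (u x) - pressure (u x)) \<le> integral E (\<lambda>x. H r)"
  proof (rule integral_le)
    show "(\<lambda>x. r * psi (u x) - pressure (u x)) integrable_on E"
      using int by (intro integrable_diff integrable_on_mult_right)
    show "(\<lambda>x. H r) integrable_on E" unfolding E_def by (rule integrable_const)
    fix x assume "x \<in> E"
    then have "u x > 0" using ED u_pos by blast
    from tangent[OF this, of r] r show "r * psi (u x) - pressure (u x) \<le> H r"
      by (simp add: pressure_def algebra_simps)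
  qed
  also have "\<dots> = vol E * H r" by (simp add: E_def)
  also have "integral E (\<lambda>x. r * psi (u x) - pressure (u x)) =
      r * integral E (\<lambda>x. psi (u x)) - integral E (\<lambda>x. pressure (u x))"
    using int by (simp add: integral_diff integrable_on_mult_right)
  finally have tang: "r * integral E (\<lambda>x. psi (u x)) - integral E (\<lambda>x. pressure (u x)) \<le> vol E * H r" .
  have "integral E (\<lambda>x. pressure (u x)) = pressure_on E"
    unfolding pressure_on_def by (rule integral_cong) (use ED in auto)
  also have "\<dots> \<le> pressure_on Z"
    unfolding pressure_on_def
    by (intro integral_subset_le pressure_on_integrable E_box Z)
      (use E_sub Z in \<open>auto simp: pressure_nonneg u_pos\<close>)
  finally show ?thesis
    using moved tang energy unfolding source_value_def target_value_def
    by (simp add: distrib_left)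
qed

end

section \<open>Exhausting an open set by small boxes\<close>

definition box_family :: "'a::euclidean_space set \<Rightarrow> 'a set set \<Rightarrow> bool" where
  "box_family D F \<longleftrightarrow> finite F \<and> (\<forall>K\<in>F. is_cbox K \<and> K \<subseteq> D \<and> vol K > 0) \<and>
     (\<forall>K\<in>F. \<forall>L\<in>F. K \<noteq> L \<longrightarrow> interior K \<inter> interior L = {})"

lemma box_familyD:
  assumes "box_family D F"
  shows "finite F" "K \<in> F \<Longrightarrow> is_cbox K" "K \<in> F \<Longrightarrow> K \<subseteq> D" "K \<in> F \<Longrightarrow> vol K > 0"
    "K \<in> F \<Longrightarrow> L \<in> F \<Longrightarrow> K \<noteq> L \<Longrightarrow> interior K \<inter> interior L = {}"
  using assms unfolding box_family_def by blast+

lemma negligible_Int_cbox: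
  assumes "is_cbox K" "is_cbox L" "interior K \<inter> interior L = {}"
  shows "negligible (K \<inter> L)"
proof -
  obtain p q p' q' where "K = cbox p q" "L = cbox p' q'"
    using assms(1,2) by (auto simp: is_cbox_def)
  then obtain a b where ab: "K \<inter> L = cbox a b"
    using Int_interval[of p q p' q'] by simp
  then have "box a b = {}"
    using assms(3) interior_Int[of K L] by simp
  with ab show ?thesis by (simp add: negligible_interval)
qed

lemma integral_box_family:
  fixes f :: "'a::euclidean_space \<Rightarrow> real"
  assumes F: "box_family D F" and f: "f absolutely_integrable_on D"
  shows "(f has_integral (\<Sum>K\<in>F. integral K f)) (\<Union>F)"
proof (rule has_integral_Union)
  show "finite F" by (rule box_familyD(1)[OF F])
  fix K assume K: "K \<in> F"
  obtain a b where "K = cbox a b" using box_familyD(2)[OF F K] by (auto simp: is_cbox_def)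
  then have "f integrable_on K"
    using absolutely_integrable_on_subcbox[OF f, of a b] box_familyD(3)[OF F K]
    by (auto simp: absolutely_integrable_on_def)
  then show "(f has_integral integral K f) K" by (rule integrable_integral)
next
  show "pairwise (\<lambda>S S'. negligible (S \<inter> S')) F"
    using box_familyD(2,5)[OF F] by (auto simp: pairwise_def intro!: negligible_Int_cbox)
qed

text \<open>
  A gauge that keeps boxes inside \<open>D\<close> and small turns the covering lemma into a countable tiling of
  \<open>D\<close>; the families are its finite parts, and the integrals converge by dominated convergence.
\<close>

lemma exhaustion_by_boxes:
  fixes D :: "'a::euclidean_space set"
  assumes D: "open D" "bounded D" and d: "d > 0"
  obtains F :: "nat \<Rightarrow> 'a set set" where
    "\<And>n. box_family D (F n)"
    "\<And>n K x y. K \<in> F n \<Longrightarrow> x \<in> K \<Longrightarrow> y \<in> K \<Longrightarrow> norm (x - y) < d"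
    "\<And>f :: 'a \<Rightarrow> real. f absolutely_integrable_on D \<Longrightarrow>
      (\<lambda>n. \<Sum>K\<in>F n. integral K f) \<longlonglongrightarrow> integral D f"
proof (cases "D = {}")
  case True
  then show thesis using that[of "\<lambda>_. {}"] by (simp add: box_family_def)
next
  case False
  obtain r where r: "D \<subseteq> box (- r) r" using bounded_subset_box_symmetric[OF D(2)] by blast
  then have "D \<subseteq> cbox (- r) r" "box (- r) r \<noteq> {}"
    using False box_subset_cbox by blast+
  moreover define g where "g x = (if x \<in> D then D \<inter> ball x (d / 2) else ball x 1)" for x
  have "gauge g" using D d by (auto simp: gauge_def g_def)
  ultimately obtain \<D> where \<D>: "countable \<D>"
    "\<And>K. K \<in> \<D> \<Longrightarrow> interior K \<noteq> {} \<and> (\<exists>c d. K = cbox c d)"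
    "pairwise (\<lambda>A B. interior A \<inter> interior B = {}) \<D>"
    "\<And>K. K \<in> \<D> \<Longrightarrow> \<exists>x \<in> D \<inter> K. K \<subseteq> g x" "D \<subseteq> \<Union>\<D>"
    using covering_lemma[of D "- r" r g] by metis
  have ne: "\<D> \<noteq> {}" using \<D>(5) False by auto
  have small: "K \<subseteq> D \<and> (\<forall>x\<in>K. \<forall>y\<in>K. norm (x - y) < d)" if K: "K \<in> \<D>" for K
  proof -
    obtain z where z: "z \<in> D" "K \<subseteq> D \<inter> ball z (d / 2)"
      using \<D>(4)[OF K] by (auto simp: g_def)
    have "norm (x - y) < d" if "x \<in> K" "y \<in> K" for x y
    proof -
      have "dist z x < d / 2" "dist z y < d / 2" using z that by auto
      then show ?thesis using dist_triangle[of x y z] by (simp add: dist_norm norm_minus_commute)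
    qed
    with z show ?thesis by auto
  qed
  define F where "F n = from_nat_into \<D> ` {..<n}" for n
  have F_sub: "F n \<subseteq> \<D>" for n
    using from_nat_into[OF ne] by (auto simp: F_def)
  have vol_pos: "vol K > 0 \<and> is_cbox K" if K: "K \<in> \<D>" for K
  proof -
    obtain a b where ab: "K = cbox a b" using \<D>(2)[OF K] by blast
    then have "box a b \<noteq> {}" using \<D>(2)[OF K] by simp
    with ab show ?thesis by (auto simp: is_cbox_def content_pos_lt_eq box_ne_empty)
  qed
  have family: "box_family D (F n)" for n
    unfolding box_family_def
  proof (intro conjI ballI impI)
    show "finite (F n)" by (simp add: F_def)
    fix K assume "K \<in> F n"
    then have K: "K \<in> \<D>" using F_sub by blast
    show "is_cbox K" "vol K > 0" "K \<subseteq> D" using vol_pos[OF K] small[OF K] by auto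
    fix L assume "L \<in> F n" "K \<noteq> L"
    then show "interior K \<inter> interior L = {}"
      using K \<D>(3) F_sub[of n] by (auto simp: pairwise_def)
  qed
  show thesis
  proof (rule that[of F])
    show "box_family D (F n)" for n by (rule family)
    show "norm (x - y) < d" if "K \<in> F n" "x \<in> K" "y \<in> K" for n K x y
      using small F_sub that by blast
    fix f :: "'a \<Rightarrow> real" assume f: "f absolutely_integrable_on D"
    have Un_D: "\<Union>(F n) \<subseteq> D" for n using box_familyD(3)[OF family] by blast
    have restr: "((\<lambda>x. if x \<in> \<Union>(F n) then f x else 0) has_integral (\<Sum>K\<in>F n. integral K f)) D" for n
      using integral_box_family[OF family f, of n] has_integral_restrict[OF Un_D[of n]] by blast
    have "(\<lambda>n. integral D (\<lambda>x. if x \<in> \<Union>(F n) then f x else 0)) \<longlonglongrightarrow> integral D f"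
    proof (rule dominated_convergence(2))
      show "(\<lambda>x. if x \<in> \<Union>(F n) then f x else 0) integrable_on D" for n
        using restr by blast
      show "(\<lambda>x. norm (f x)) integrable_on D"
        using f by (simp add: absolutely_integrable_on_def)
      show "norm (if x \<in> \<Union>(F n) then f x else 0) \<le> norm (f x)" for n x by simp
      fix x assume "x \<in> D"
      then obtain K where K: "K \<in> \<D>" "x \<in> K" using \<D>(5) by auto
      then obtain m where m: "from_nat_into \<D> m = K"
        using from_nat_into_surj[OF \<D>(1)] by blast
      have "x \<in> \<Union>(F n)" if "n > m" for n
        using m K that by (auto simp: F_def)
      then show "(\<lambda>n. if x \<in> \<Union>(F n) then f x else 0) \<longlonglongrightarrow> f x"
        by (intro tendsto_eventually eventually_sequentiallyI[of "Suc m"]) auto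
    qed
    then show "(\<lambda>n. \<Sum>K\<in>F n. integral K f) \<longlonglongrightarrow> integral D f"
      by (simp only: integral_unique[OF restr])
  qed
qed

section \<open>The inequality on a bounded domain\<close>

lemma integral_average_times:
  fixes f h :: "'a::euclidean_space \<Rightarrow> real"
  assumes K: "is_cbox K" "vol K > 0"
    and int: "f integrable_on K" "h absolutely_integrable_on K" "(\<lambda>x. f x * h x) integrable_on K"
    and osc: "\<And>x y. x \<in> K \<Longrightarrow> y \<in> K \<Longrightarrow> \<bar>f x - f y\<bar> \<le> \<tau>"
  shows "\<bar>integral K f / vol K * integral K h - integral K (\<lambda>x. f x * h x)\<bar>
    \<le> \<tau> * integral K (\<lambda>x. \<bar>h x\<bar>)"
proof -
  obtain a b where ab: "K = cbox a b" using K(1) by (auto simp: is_cbox_def)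
  define m where "m = integral K f / vol K"
  have h: "h integrable_on K" "(\<lambda>x. \<bar>h x\<bar>) integrable_on K"
    using int(2) by (auto simp: absolutely_integrable_on_def)
  have avg: "\<bar>m - f x\<bar> \<le> \<tau>" if "x \<in> K" for x
  proof -
    have "((\<lambda>y. f y - f x) has_integral integral K f - f x * vol K) (cbox a b)"
      using has_integral_diff[OF integrable_integral[OF int(1)[unfolded ab]] has_integral_const[of "f x" a b]]
      by (simp add: ab mult.commute)
    then have "norm (integral K f - f x * vol K) \<le> \<tau> * vol (cbox a b)"
      by (rule has_integral_bound[rotated])
        (use osc[OF _ that] osc[OF that that] ab in auto)
    also have "integral K f - f x * vol K = (m - f x) * vol K"
      using K(2) by (simp add: m_def field_simps)
    finally show ?thesis using K(2) by (simp add: abs_mult ab)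
  qed
  have diff: "((\<lambda>x. (m - f x) * h x) has_integral
      m * integral K h - integral K (\<lambda>x. f x * h x)) K"
    unfolding left_diff_distrib
    by (intro has_integral_diff has_integral_mult_right integrable_integral h(1) int(3))
  then have "m * integral K h - integral K (\<lambda>x. f x * h x) = integral K (\<lambda>x. (m - f x) * h x)"
    by (simp add: integral_unique)
  moreover have "norm (integral K (\<lambda>x. (m - f x) * h x)) \<le> integral K (\<lambda>x. \<tau> * \<bar>h x\<bar>)"
  proof (rule integral_norm_bound_integral)
    show "(\<lambda>x. (m - f x) * h x) integrable_on K"
      using diff by blast
    show "(\<lambda>x. \<tau> * \<bar>h x\<bar>) integrable_on K" by (rule integrable_on_mult_right[OF h(2)])
    show "norm ((m - f x) * h x) \<le> \<tau> * \<bar>h x\<bar>" if "x \<in> K" for x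
      using mult_right_mono[OF avg[OF that], of "\<bar>h x\<bar>"] by (simp add: abs_mult)
  qed
  ultimately show ?thesis by (simp add: m_def)
qed

text \<open>
  Jensen's inequality from the tangent at the average.  If the average is \<open>0\<close>, where there is no
  tangent, the tangents at small \<open>z\<close> serve: they lie above \<open>- pressure z\<close>, which tends to \<open>0\<close>.
\<close>

lemma (in internal_energy) box_Jensen:
  fixes f :: "'a::euclidean_space \<Rightarrow> real"
  assumes K: "is_cbox K" "vol K > 0"
    and int: "f integrable_on K" "(\<lambda>x. H (f x)) integrable_on K"
    and nonneg: "\<And>x. x \<in> K \<Longrightarrow> f x \<ge> 0"
  shows "vol K * H (integral K f / vol K) \<le> integral K (\<lambda>x. H (f x))"
proof -
  obtain a b where ab: "K = cbox a b" using K(1) by (auto simp: is_cbox_def)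
  have below: "vol K * H z + psi z * (integral K f - z * vol K) \<le> integral K (\<lambda>x. H (f x))"
    if z: "z > 0" for z
  proof -
    have cst: "((\<lambda>x. c) has_integral vol K * c) K" for c :: real
      using has_integral_const[of c a b] by (simp add: ab)
    have "((\<lambda>x. H z + psi z * (f x - z)) has_integral
        vol K * H z + psi z * (integral K f - vol K * z)) K"
      by (intro has_integral_add has_integral_mult_right has_integral_diff cst
          integrable_integral int(1))
    from has_integral_le[OF this integrable_integral[OF int(2)]]
    show ?thesis using tangent[OF z] nonneg by (simp add: mult.commute)
  qed
  define m where "m = integral K f / vol K"
  have "m \<ge> 0" using K(2) nonneg by (simp add: m_def integral_nonneg int(1))
  show ?thesis
  proof (cases "m = 0")
    case False
    with \<open>m \<ge> 0\<close> have "m > 0" by simp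
    from below[OF this] K(2) show ?thesis by (simp add: m_def)
  next
    case True
    have "0 \<le> integral K (\<lambda>x. H (f x)) + e" if "e > 0" for e
    proof -
      have "e / vol K > 0" using that K(2) by simp
      then obtain z where z: "z > 0" "z * psi z - H z < e / vol K"
        using pressure_vanishes by blast
      then have "vol K * (z * psi z - H z) \<le> e"
        using K(2) by (simp add: field_simps)
      moreover have "integral K f = 0" using True K(2) by (simp add: m_def)
      ultimately show ?thesis using below[OF z(1)] by (simp add: algebra_simps)
    qed
    then have "0 \<le> integral K (\<lambda>x. H (f x))" by (rule field_le_epsilon)
    then show ?thesis unfolding m_def[symmetric] True by (simp add: H_zero)
  qed
qed

lemma bounded_times_image:
  fixes f h :: "'a \<Rightarrow> real"
  assumes "bounded (f ` D)" "bounded (h ` D)"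
  shows "bounded ((\<lambda>x. f x * h x) ` D)"
proof -
  obtain A B where "\<And>x. x \<in> D \<Longrightarrow> \<bar>f x\<bar> \<le> A" "\<And>x. x \<in> D \<Longrightarrow> \<bar>h x\<bar> \<le> B"
    using assms by (auto simp: bounded_iff)
  then have "\<bar>f x * h x\<bar> \<le> A * B" if "x \<in> D" for x
    unfolding abs_mult using that by (intro mult_mono) force+
  then show ?thesis by (auto simp: bounded_iff)
qed

context transport_data
begin

lemma absolutely_integrable_on_subbox:
  fixes f :: "'a \<Rightarrow> real"
  assumes "f absolutely_integrable_on D" "is_cbox K" "K \<subseteq> D"
  shows "f absolutely_integrable_on K" "f integrable_on K"
proof -
  show "f absolutely_integrable_on K"
    using assms absolutely_integrable_on_subcbox[OF assms(1)] by (auto simp: is_cbox_def)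
  then show "f integrable_on K" by (simp add: absolutely_integrable_on_def)
qed

text \<open>
  Boxes without target mass are no bricks; they contribute nothing because \<open>H 0 = 0\<close>.
\<close>

lemma family_inequality:
  assumes s: "0 < s" "s < 1"
    and R: "\<And>x y. x \<in> D \<Longrightarrow> y \<in> D \<Longrightarrow> norm (x - y) \<le> R"
    and osc: "\<And>x y. x \<in> D \<Longrightarrow> y \<in> D \<Longrightarrow> norm (x - y) \<le> s * R \<Longrightarrow> norm (g x - g y) \<le> e"
    and e: "e \<ge> 0"
    and F: "box_family D F"
    and \<rho>: "\<And>K. K \<in> F \<Longrightarrow> \<rho> K > 0" and \<sigma>: "\<And>K. K \<in> F \<Longrightarrow> \<sigma> K \<ge> 0"
    and mass: "(\<Sum>K\<in>F. mass K (\<rho> K)) = (\<Sum>K\<in>F. mass K (\<sigma> K))"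
  shows "- integral D (\<lambda>x. pressure (u x)) \<le>
    (\<Sum>K\<in>F. source_value s (e * R) K (\<rho> K)) + (\<Sum>K\<in>F. target_value s K (\<sigma> K))"
proof -
  let ?J = "{K \<in> F. \<sigma> K > 0}"
  obtain r where "D \<subseteq> cbox (- r) r" using bounded_subset_cbox_symmetric[OF D(3)] by blast
  moreover define Z where "Z = cbox (- r) r"
  ultimately have Z: "is_cbox Z" "D \<subseteq> Z" by (auto simp: is_cbox_def)
  have drop: "(\<Sum>K\<in>F. f K (\<sigma> K)) = (\<Sum>K\<in>?J. f K (\<sigma> K))" if "\<And>K. f K 0 = 0"
    for f :: "'a set \<Rightarrow> real \<Rightarrow> real"
  proof (rule sum.mono_neutral_right)
    show "\<forall>K\<in>F - ?J. f K (\<sigma> K) = 0"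
      using \<sigma> that by (metis (mono_tags, lifting) DiffE less_le mem_Collect_eq)
  qed (use box_familyD(1)[OF F] in auto)
  have "- pressure_on Z \<le>
    (\<Sum>K\<in>F. source_value s (e * R) K (\<rho> K)) + (\<Sum>K\<in>?J. target_value s K (\<sigma> K))"
  proof (rule brick_induction[where D = D and s = s, OF s additive_on_boxes_values])
    show "bricks D F (\<lambda>K. K) \<rho>" "bricks D ?J (\<lambda>K. K) \<sigma>"
      using box_familyD[OF F] \<rho> unfolding bricks_def by auto
    show "(\<Sum>K\<in>F. mass K (\<rho> K)) = (\<Sum>K\<in>?J. mass K (\<sigma> K))"
      using mass drop[of mass] by simp
    show "interpolate s K L \<subseteq> Z" if "K \<in> F" "L \<in> ?J" for K L
    proof
      fix z assume "z \<in> interpolate s K L"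
      then obtain x y where z: "z = (1 - s) *\<^sub>R x + s *\<^sub>R y" and xy: "x \<in> K" "y \<in> L"
        by (auto simp: interpolate_def)
      then have "x \<in> D" "y \<in> D" using box_familyD(3)[OF F] that by auto
      then have "z \<in> D" unfolding z by (rule convexD_alt[OF D(2)]) (use s in auto)
      then show "z \<in> Z" using Z by blast
    qed
  next
    fix A B Z \<rho> \<sigma>
    assume "is_cbox A" "is_cbox B" "is_cbox Z" "A \<subseteq> D" "B \<subseteq> D" "vol A > 0" "vol B > 0"
      "\<rho> > 0" "\<sigma> > 0" "mass A \<rho> = mass B \<sigma>" "interpolate s A B \<subseteq> Z"
    then show "- pressure_on Z \<le> source_value s (e * R) A \<rho> + target_value s B \<sigma>"
      using brick_pair[OF s R osc e] by blast
  qed (use pressure_on_nonneg pressure_on_split Z in auto)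
  moreover have "(\<Sum>K\<in>F. target_value s K (\<sigma> K)) = (\<Sum>K\<in>?J. target_value s K (\<sigma> K))"
    by (rule drop) (simp add: target_value_def H_zero)
  ultimately show ?thesis using pressure_on_le[OF Z(1)] by linarith
qed

text \<open>
  Replacing \<open>u\<close> by its average lowers the energy, by Jensen, and changes the linear terms by at
  most the oscillation \<open>\<tau>\<close>.
\<close>

lemma source_value_le:
  assumes s: "0 < s" "s < 1" and K: "is_cbox K" "K \<subseteq> D" "vol K > 0"
    and \<mu>: "0 \<le> \<mu>" "\<mu> \<le> 1"
    and osc: "\<And>x y. x \<in> K \<Longrightarrow> y \<in> K \<Longrightarrow> \<bar>u x - u y\<bar> \<le> \<tau>"
    and res: "residue_density s e absolutely_integrable_on K"
  shows "source_value s e K (\<mu> * (integral K u / vol K)) \<le>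
    \<mu> * integral K (\<lambda>x. (1 - s) * (H (u x) + u x * V x) - u x * residue_density s e x)
    + \<tau> * integral K (\<lambda>x. \<bar>V x\<bar> + \<bar>residue_density s e x\<bar>)"
proof -
  define a where "a = integral K u / vol K"
  let ?W = "residue_density s e"
  note cont = continuous_on_data(1,2,5) continuous_on_residue_density[of s e]
  have int: "u integrable_on K" "V integrable_on K" "(\<lambda>x. H (u x)) integrable_on K"
    "(\<lambda>x. u x * V x) integrable_on K" "(\<lambda>x. u x * ?W x) integrable_on K"
    by (intro integrable_on_box[OF _ K(1,2)] continuous_on_mult cont)+
  have V: "V absolutely_integrable_on K"
    using K(1) continuous_on_subset[OF cont(2) K(2)]
    by (auto simp: is_cbox_def intro: absolutely_integrable_continuous)
  have abs: "(\<lambda>x. \<bar>V x\<bar>) integrable_on K" "(\<lambda>x. \<bar>?W x\<bar>) integrable_on K"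
    using V res by (auto simp: absolutely_integrable_on_def)
  have pos: "u x \<ge> 0" if "x \<in> K" for x using u_pos K(2) that by force
  have "a \<ge> 0" using K(3) pos by (simp add: a_def integral_nonneg int(1))
  then have "vol K * H (\<mu> * a) \<le> vol K * (\<mu> * H a)"
    using H_scale_le[OF \<mu>] K(3) by (intro mult_left_mono) auto
  also have "\<dots> = \<mu> * (vol K * H a)" by simp
  also have "\<dots> \<le> \<mu> * integral K (\<lambda>x. H (u x))"
    unfolding a_def using box_Jensen[OF K(1,3) int(1,3) pos] \<mu> by (intro mult_left_mono) auto
  finally have energy: "vol K * H (\<mu> * a) \<le> \<mu> * integral K (\<lambda>x. H (u x))" .
  have tau: "\<tau> \<ge> 0"
  proof -
    obtain x where "x \<in> K" using K(3) by (cases "K = {}") auto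
    with osc[of x x] show ?thesis by simp
  qed
  have errV: "a * integral K V \<le> integral K (\<lambda>x. u x * V x) + \<tau> * integral K (\<lambda>x. \<bar>V x\<bar>)"
    using integral_average_times[OF K(1,3) int(1) V int(4) osc] by (simp add: a_def)
  have errW: "- (a * integral K ?W) \<le> - integral K (\<lambda>x. u x * ?W x) + \<tau> * integral K (\<lambda>x. \<bar>?W x\<bar>)"
    using integral_average_times[OF K(1,3) int(1) res int(5) osc] by (simp add: a_def)
  have nonneg: "0 \<le> \<tau> * integral K (\<lambda>x. \<bar>V x\<bar>)" "0 \<le> \<tau> * integral K (\<lambda>x. \<bar>?W x\<bar>)"
    using tau abs by (simp_all add: integral_nonneg)
  have "source_value s e K (\<mu> * a) =
      (1 - s) * (vol K * H (\<mu> * a)) + ((1 - s) * \<mu>) * (a * integral K V) + \<mu> * (- (a * integral K ?W))"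
    by (simp add: source_value_def algebra_simps)
  also have "\<dots> \<le> (1 - s) * (\<mu> * integral K (\<lambda>x. H (u x)))
      + ((1 - s) * \<mu>) * (integral K (\<lambda>x. u x * V x) + \<tau> * integral K (\<lambda>x. \<bar>V x\<bar>))
      + \<mu> * (- integral K (\<lambda>x. u x * ?W x) + \<tau> * integral K (\<lambda>x. \<bar>?W x\<bar>))"
    using energy errV errW s \<mu> by (intro add_mono mult_left_mono) auto
  also have "\<dots> = \<mu> * ((1 - s) * (integral K (\<lambda>x. H (u x)) + integral K (\<lambda>x. u x * V x))
        - integral K (\<lambda>x. u x * ?W x))
      + ((1 - s) * \<mu>) * (\<tau> * integral K (\<lambda>x. \<bar>V x\<bar>)) + \<mu> * (\<tau> * integral K (\<lambda>x. \<bar>?W x\<bar>))"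
    by (simp add: algebra_simps)
  also have "\<dots> \<le> \<mu> * ((1 - s) * (integral K (\<lambda>x. H (u x)) + integral K (\<lambda>x. u x * V x))
        - integral K (\<lambda>x. u x * ?W x))
      + 1 * (\<tau> * integral K (\<lambda>x. \<bar>V x\<bar>)) + 1 * (\<tau> * integral K (\<lambda>x. \<bar>?W x\<bar>))"
    using nonneg s \<mu> by (intro add_mono mult_right_mono order_refl mult_le_one) auto
  also have "\<dots> = \<mu> * integral K (\<lambda>x. (1 - s) * (H (u x) + u x * V x) - u x * ?W x)
    + \<tau> * integral K (\<lambda>x. \<bar>V x\<bar> + \<bar>?W x\<bar>)"
  proof -
    have "((\<lambda>x. (1 - s) * (H (u x) + u x * V x) - u x * ?W x) has_integral
        (1 - s) * (integral K (\<lambda>x. H (u x)) + integral K (\<lambda>x. u x * V x))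
        - integral K (\<lambda>x. u x * ?W x)) K"
      by (intro has_integral_diff has_integral_mult_right has_integral_add integrable_integral int)
    then show ?thesis
      using abs by (simp add: integral_unique integral_add distrib_left)
  qed
  finally show ?thesis by (simp add: a_def)
qed

lemma target_value_le:
  assumes s: "0 < s" "s < 1" and K: "is_cbox K" "K \<subseteq> D" "vol K > 0"
    and \<lambda>: "0 \<le> l" "l \<le> 1"
    and osc: "\<And>x y. x \<in> K \<Longrightarrow> y \<in> K \<Longrightarrow> \<bar>V x - V y\<bar> \<le> \<tau>"
    and w: "w absolutely_integrable_on K" "(\<lambda>x. H (w x)) integrable_on K"
      "(\<lambda>x. V x * w x) integrable_on K" "\<And>x. x \<in> K \<Longrightarrow> w x \<ge> 0"
  shows "target_value s K (l * (integral K w / vol K)) \<le>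
    l * integral K (\<lambda>x. s * (H (w x) + V x * w x)) + \<tau> * integral K (\<lambda>x. \<bar>w x\<bar>)"
proof -
  define b where "b = integral K w / vol K"
  have int: "w integrable_on K" "(\<lambda>x. \<bar>w x\<bar>) integrable_on K"
    using w(1) by (auto simp: absolutely_integrable_on_def)
  have V: "V integrable_on K" by (intro integrable_on_box[OF _ K(1,2)] continuous_on_data)
  have "b \<ge> 0" using K(3) w(4) by (simp add: b_def integral_nonneg int(1))
  then have "vol K * H (l * b) \<le> vol K * (l * H b)"
    using H_scale_le[OF \<lambda>] K(3) by (intro mult_left_mono) auto
  also have "\<dots> = l * (vol K * H b)" by simp
  also have "\<dots> \<le> l * integral K (\<lambda>x. H (w x))"
    unfolding b_def using box_Jensen[OF K(1,3) int(1) w(2,4)] \<lambda> by (intro mult_left_mono) auto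
  finally have energy: "vol K * H (l * b) \<le> l * integral K (\<lambda>x. H (w x))" .
  have tau: "\<tau> \<ge> 0"
  proof -
    obtain x where "x \<in> K" using K(3) by (cases "K = {}") auto
    with osc[of x x] show ?thesis by simp
  qed
  have err: "b * integral K V \<le> integral K (\<lambda>x. V x * w x) + \<tau> * integral K (\<lambda>x. \<bar>w x\<bar>)"
    using integral_average_times[OF K(1,3) V w(1,3) osc] by (simp add: b_def mult.commute)
  have nonneg: "0 \<le> \<tau> * integral K (\<lambda>x. \<bar>w x\<bar>)"
    using tau int by (simp add: integral_nonneg)
  have "target_value s K (l * b) = s * (vol K * H (l * b)) + (s * l) * (b * integral K V)"
    by (simp add: target_value_def algebra_simps)
  also have "\<dots> \<le> s * (l * integral K (\<lambda>x. H (w x)))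
      + (s * l) * (integral K (\<lambda>x. V x * w x) + \<tau> * integral K (\<lambda>x. \<bar>w x\<bar>))"
    using energy err s \<lambda> by (intro add_mono mult_left_mono) auto
  also have "\<dots> = l * (s * (integral K (\<lambda>x. H (w x)) + integral K (\<lambda>x. V x * w x)))
      + (s * l) * (\<tau> * integral K (\<lambda>x. \<bar>w x\<bar>))"
    by (simp add: algebra_simps)
  also have "\<dots> \<le> l * (s * (integral K (\<lambda>x. H (w x)) + integral K (\<lambda>x. V x * w x)))
      + 1 * (\<tau> * integral K (\<lambda>x. \<bar>w x\<bar>))"
    using nonneg s \<lambda> by (intro add_mono mult_right_mono order_refl mult_le_one) auto
  also have "\<dots> = l * integral K (\<lambda>x. s * (H (w x) + V x * w x)) + \<tau> * integral K (\<lambda>x. \<bar>w x\<bar>)"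
  proof -
    have *: "((\<lambda>x. s * (H (w x) + V x * w x)) has_integral
        s * (integral K (\<lambda>x. H (w x)) + integral K (\<lambda>x. V x * w x))) K"
      by (intro has_integral_mult_right has_integral_add integrable_integral w)
    show ?thesis by (simp only: integral_unique[OF *] mult_1)
  qed
  finally show ?thesis by (simp add: b_def)
qed

lemma absolutely_integrable_data:
  "u absolutely_integrable_on D" "V absolutely_integrable_on D"
  "(\<lambda>x. H (u x)) absolutely_integrable_on D" "(\<lambda>x. pressure (u x)) absolutely_integrable_on D"
  "(\<lambda>x. u x * V x) absolutely_integrable_on D"
  "residue_density s e absolutely_integrable_on D"
  "(\<lambda>x. u x * residue_density s e x) absolutely_integrable_on D"
  "(\<lambda>x. u x * (norm (g x))\<^sup>2) absolutely_integrable_on D"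
proof -
  have g: "bounded ((\<lambda>x. norm (g x)) ` D)"
    using bounded_data(3) by (auto simp: bounded_iff)
  then have g2: "bounded ((\<lambda>x. (norm (g x))\<^sup>2) ` D)"
    using bounded_times_image[OF g g] by (simp add: power2_eq_square)
  have W: "bounded (residue_density s e ` D)"
  proof -
    have const: "bounded ((\<lambda>x. c) ` D)" for c :: real
      by (rule bounded_subset[of "{c}"]) auto
    have "bounded ((\<lambda>x. psi (u x) + V x - (s / (2 * C * (1 - s))) * (norm (g x))\<^sup>2 - s * e) ` D)"
      by (intro bounded_minus_comp bounded_plus_comp bounded_data bounded_times_image g2 const)
    then show ?thesis by (simp add: residue_density_def[abs_def])
  qed
  note cont = continuous_on_data continuous_on_residue_density[of s e]
  note bdd = bounded_data W g2
  show "u absolutely_integrable_on D" "V absolutely_integrable_on D"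
    "(\<lambda>x. H (u x)) absolutely_integrable_on D" "(\<lambda>x. pressure (u x)) absolutely_integrable_on D"
    "residue_density s e absolutely_integrable_on D"
    by (intro absolutely_integrable_on_D cont bdd)+
  show "(\<lambda>x. u x * V x) absolutely_integrable_on D"
    "(\<lambda>x. u x * residue_density s e x) absolutely_integrable_on D"
    "(\<lambda>x. u x * (norm (g x))\<^sup>2) absolutely_integrable_on D"
    by (intro absolutely_integrable_on_D continuous_intros cont bounded_times_image bdd)+
qed

lemma integral_u_pos:
  assumes "K \<subseteq> D" "K \<in> lmeasurable" "\<not> negligible K" "u integrable_on K"
  shows "integral K u > 0"
proof -
  have m: "measure lebesgue K > 0"
    using assms(2,3) by (auto simp: negligible_iff_measure zero_less_measure_iff)
  have "((\<lambda>x. 1) has_integral measure lebesgue K) K"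
    using assms(2) by (simp add: has_integral_iff lmeasurable_iff_integrable_on lmeasure_integral)
  from has_integral_mult_right[OF this, of c0] have "c0 * measure lebesgue K \<le> integral K u"
    using assms(1) u_lower by (intro has_integral_le[OF _ integrable_integral[OF assms(4)]]) auto
  moreover have "c0 * measure lebesgue K > 0" using c0_pos m by simp
  ultimately show ?thesis by linarith
qed

text \<open>
  The mass of \<open>u\<close> and \<open>w\<close> on the boxes used so far need not agree; the larger one is scaled down,
  which costs nothing because \<open>H (t * x) \<le> t * H x\<close> for \<open>t \<le> 1\<close>, and the factors tend to \<open>1\<close>.
\<close>

lemma interpolated_inequality:
  assumes s: "0 < s" "s < 1" and ne: "D \<noteq> {}"
    and R: "\<And>x y. x \<in> D \<Longrightarrow> y \<in> D \<Longrightarrow> norm (x - y) \<le> R"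
    and osc: "\<And>x y. x \<in> D \<Longrightarrow> y \<in> D \<Longrightarrow> norm (x - y) \<le> s * R \<Longrightarrow> norm (g x - g y) \<le> e"
    and e: "e \<ge> 0"
    and w: "w absolutely_integrable_on D" "(\<lambda>x. H (w x)) absolutely_integrable_on D"
      "(\<lambda>x. V x * w x) absolutely_integrable_on D"
      "\<And>x. x \<in> D \<Longrightarrow> w x \<ge> 0" "integral D w = integral D u"
  shows "- integral D (\<lambda>x. pressure (u x)) \<le>
    integral D (\<lambda>x. (1 - s) * (H (u x) + u x * V x) - u x * residue_density s (e * R) x)
    + integral D (\<lambda>x. s * (H (w x) + V x * w x))"
proof -
  let ?W = "residue_density s (e * R)"
  let ?f1 = "\<lambda>x. (1 - s) * (H (u x) + u x * V x) - u x * ?W x"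
  let ?f2 = "\<lambda>x. s * (H (w x) + V x * w x)"
  let ?f3 = "\<lambda>x. \<bar>V x\<bar> + \<bar>?W x\<bar>" and ?f4 = "\<lambda>x. \<bar>w x\<bar>"
  note ai = absolutely_integrable_data(1-5) absolutely_integrable_data(6,7)[of s "e * R"]
  have f: "?f1 absolutely_integrable_on D" "?f2 absolutely_integrable_on D"
    "?f3 absolutely_integrable_on D" "?f4 absolutely_integrable_on D"
    using ai w
    by (auto intro!: set_integral_diff(1) set_integral_add(1) set_integrable_mult_right
        set_integrable_abs)
  define A where "A = integral D u"
  have "\<not> negligible D" using D(1) ne by (rule open_not_negligible)
  then have A: "A > 0"
    unfolding A_def using integral_u_pos[OF order_refl D_lmeasurable] ai(1)
    by (simp add: absolutely_integrable_on_def)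
  have tau: "- integral D (\<lambda>x. pressure (u x)) \<le>
      integral D ?f1 + integral D ?f2 + \<tau> * (integral D ?f3 + integral D ?f4)"
    if \<tau>: "\<tau> > 0" for \<tau>
  proof -
    obtain d1 where d1: "d1 > 0" "\<And>x y. x \<in> D \<Longrightarrow> y \<in> D \<Longrightarrow> dist x y < d1 \<Longrightarrow> dist (u x) (u y) < \<tau>"
      using uniformly_continuous_onE[OF unif_u \<tau>] by (metis dist_commute)
    obtain d2 where d2: "d2 > 0" "\<And>x y. x \<in> D \<Longrightarrow> y \<in> D \<Longrightarrow> dist x y < d2 \<Longrightarrow> dist (V x) (V y) < \<tau>"
      using uniformly_continuous_onE[OF unif_V \<tau>] by (metis dist_commute)
    obtain F where F: "\<And>n. box_family D (F n)"
      "\<And>n K x y. K \<in> F n \<Longrightarrow> x \<in> K \<Longrightarrow> y \<in> K \<Longrightarrow> norm (x - y) < min d1 d2"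
      "\<And>f :: 'a \<Rightarrow> real. f absolutely_integrable_on D \<Longrightarrow>
        (\<lambda>n. \<Sum>K\<in>F n. integral K f) \<longlonglongrightarrow> integral D f"
      using exhaustion_by_boxes[OF D(1,3), of "min d1 d2"] d1(1) d2(1) by auto
    define S where "S n f = (\<Sum>K\<in>F n. integral K f)" for n and f :: "'a \<Rightarrow> real"
    have S: "(\<lambda>n. S n f) \<longlonglongrightarrow> integral D f" if "f absolutely_integrable_on D" for f
      using F(3)[OF that] by (simp add: S_def)
    have Su: "(\<lambda>n. S n u) \<longlonglongrightarrow> A" and Sw: "(\<lambda>n. S n w) \<longlonglongrightarrow> A"
      using S[OF ai(1)] S[OF w(1)] w(5) by (simp_all add: A_def)
    define \<mu> where "\<mu> n = min 1 (S n w / S n u)" for n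
    define l where "l n = min 1 (S n u / S n w)" for n
    have ml: "\<mu> \<longlonglongrightarrow> 1" "l \<longlonglongrightarrow> 1"
    proof -
      have "\<mu> \<longlonglongrightarrow> min 1 (A / A)" "l \<longlonglongrightarrow> min 1 (A / A)"
        unfolding \<mu>_def l_def using A by (intro tendsto_intros Su Sw; simp)+
      then show "\<mu> \<longlonglongrightarrow> 1" "l \<longlonglongrightarrow> 1" using A by simp_all
    qed
    have step: "- integral D (\<lambda>x. pressure (u x)) \<le>
        \<mu> n * S n ?f1 + l n * S n ?f2 + \<tau> * (S n ?f3 + S n ?f4)"
      if pos: "S n u > 0" "S n w > 0" for n
    proof -
      have m01: "0 < \<mu> n" "\<mu> n \<le> 1" "0 \<le> l n" "l n \<le> 1"
        using pos by (auto simp: \<mu>_def l_def)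
      have eqm: "\<mu> n * S n u = l n * S n w"
        using pos by (auto simp: \<mu>_def l_def min_def field_simps)
      define \<rho> where "\<rho> K = \<mu> n * (integral K u / vol K)" for K
      define \<sigma> where "\<sigma> K = l n * (integral K w / vol K)" for K
      note FD = box_familyD[OF F(1)[of n]]
      have on_box: "f absolutely_integrable_on K" "f integrable_on K"
        if "K \<in> F n" "f absolutely_integrable_on D" for f :: "'a \<Rightarrow> real" and K
        using absolutely_integrable_on_subbox[OF that(2) FD(2,3)[OF that(1)]] by auto
      have "- integral D (\<lambda>x. pressure (u x)) \<le>
          (\<Sum>K\<in>F n. source_value s (e * R) K (\<rho> K)) + (\<Sum>K\<in>F n. target_value s K (\<sigma> K))"
      proof (rule family_inequality[OF s R osc e F(1)])
        fix K assume K: "K \<in> F n"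
        obtain a b where ab: "K = cbox a b" using FD(2)[OF K] by (auto simp: is_cbox_def)
        then have "vol K = 0" if "box a b = {}"
          using content_eq_0_interior[of a b] that by simp
        then have "\<not> negligible K" "K \<in> lmeasurable"
          using FD(4)[OF K] by (auto simp: ab negligible_interval)
        then have "integral K u > 0" using integral_u_pos FD(3)[OF K] on_box(2)[OF K ai(1)] by blast
        then show "\<rho> K > 0" using m01 FD(4)[OF K] by (simp add: \<rho>_def)
        have "integral K w \<ge> 0"
          using w(4) FD(3)[OF K] on_box(2)[OF K w(1)] by (intro integral_nonneg) auto
        then show "\<sigma> K \<ge> 0" using m01 FD(4)[OF K] by (simp add: \<sigma>_def)
      next
        have "(\<Sum>K\<in>F n. mass K (\<rho> K)) = \<mu> n * S n u" "(\<Sum>K\<in>F n. mass K (\<sigma> K)) = l n * S n w"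
          unfolding S_def sum_distrib_left \<rho>_def \<sigma>_def
          by (intro sum.cong refl; use FD(4) in force)+
        then show "(\<Sum>K\<in>F n. mass K (\<rho> K)) = (\<Sum>K\<in>F n. mass K (\<sigma> K))" using eqm by simp
      qed
      also have "\<dots> \<le> (\<Sum>K\<in>F n. \<mu> n * integral K ?f1 + \<tau> * integral K ?f3)
          + (\<Sum>K\<in>F n. l n * integral K ?f2 + \<tau> * integral K ?f4)"
      proof (intro add_mono sum_mono)
        fix K assume K: "K \<in> F n"
        have close: "dist x y < d1" "dist x y < d2" "x \<in> D" "y \<in> D" if "x \<in> K" "y \<in> K" for x y
          using F(2)[OF K that] FD(3)[OF K] that by (auto simp: dist_norm)
        have "\<bar>u x - u y\<bar> \<le> \<tau>" "\<bar>V x - V y\<bar> \<le> \<tau>" if "x \<in> K" "y \<in> K" for x y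
          using d1(2)[of x y] d2(2)[of x y] close[OF that] by (auto simp: dist_real_def)
        note oscs = this
        show "source_value s (e * R) K (\<rho> K) \<le> \<mu> n * integral K ?f1 + \<tau> * integral K ?f3"
          unfolding \<rho>_def
          by (rule source_value_le[OF s FD(2,3,4)[OF K]])
            (use m01 oscs on_box(1)[OF K ai(6)] in auto)
        show "target_value s K (\<sigma> K) \<le> l n * integral K ?f2 + \<tau> * integral K ?f4"
          unfolding \<sigma>_def
          by (rule target_value_le[OF s FD(2,3,4)[OF K]])
            (use m01 oscs on_box[OF K w(1)] on_box[OF K w(2)] on_box[OF K w(3)] w(4) FD(3)[OF K] in auto)
      qed
      also have "\<dots> = \<mu> n * S n ?f1 + l n * S n ?f2 + \<tau> * (S n ?f3 + S n ?f4)"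
        by (simp add: S_def sum.distrib sum_distrib_left distrib_left)
      finally show ?thesis .
    qed
    have lim: "(\<lambda>n. \<mu> n * S n ?f1 + l n * S n ?f2 + \<tau> * (S n ?f3 + S n ?f4)) \<longlonglongrightarrow>
        1 * integral D ?f1 + 1 * integral D ?f2 + \<tau> * (integral D ?f3 + integral D ?f4)"
      by (intro tendsto_intros ml S f)
    have "\<forall>\<^sub>F n in sequentially. S n u > 0" "\<forall>\<^sub>F n in sequentially. S n w > 0"
      using order_tendstoD(1)[OF Su A] order_tendstoD(1)[OF Sw A] .
    then have "\<forall>\<^sub>F n in sequentially. - integral D (\<lambda>x. pressure (u x)) \<le>
        \<mu> n * S n ?f1 + l n * S n ?f2 + \<tau> * (S n ?f3 + S n ?f4)"
      by eventually_elim (rule step)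
    from tendsto_lowerbound[OF lim this] show ?thesis by simp
  qed
  \<comment> \<open>the mesh is gone from the inequality, so the oscillation \<open>\<tau>\<close> may tend to \<open>0\<close>\<close>
  define c where "c = integral D ?f3 + integral D ?f4"
  show ?thesis
  proof (rule field_le_epsilon)
    fix \<epsilon> :: real assume "\<epsilon> > 0"
    then have "\<epsilon> / (\<bar>c\<bar> + 1) > 0" by (simp add: add_nonneg_pos)
    from tau[OF this] have "- integral D (\<lambda>x. pressure (u x)) \<le>
      integral D ?f1 + integral D ?f2 + \<epsilon> / (\<bar>c\<bar> + 1) * c" by (simp only: c_def)
    moreover have "\<epsilon> / (\<bar>c\<bar> + 1) * c \<le> \<epsilon> / (\<bar>c\<bar> + 1) * (\<bar>c\<bar> + 1)"
      using \<open>\<epsilon> > 0\<close> by (intro mult_left_mono) auto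
    moreover have "\<epsilon> / (\<bar>c\<bar> + 1) * (\<bar>c\<bar> + 1) = \<epsilon>"
      by (simp add: add_nonneg_eq_0_iff)
    ultimately show "- integral D (\<lambda>x. pressure (u x)) \<le> integral D ?f1 + integral D ?f2 + \<epsilon>"
      by linarith
  qed
qed

text \<open>
  To first order in \<open>s\<close> the interpolated inequality is the comparison of the energies of \<open>u\<close> and
  \<open>w\<close>: the terms of order \<open>0\<close> cancel because \<open>u * H' u = H u + pressure u\<close>.
\<close>

theorem entropy_inequality:
  assumes w: "w absolutely_integrable_on D" "(\<lambda>x. H (w x)) absolutely_integrable_on D"
      "(\<lambda>x. V x * w x) absolutely_integrable_on D"
      "\<And>x. x \<in> D \<Longrightarrow> w x \<ge> 0" "integral D w = integral D u"
  shows "integral D (\<lambda>x. H (u x) + u x * V x) \<le>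
    integral D (\<lambda>x. H (w x) + V x * w x) + integral D (\<lambda>x. u x * (norm (g x))\<^sup>2) / (2 * C)"
proof (cases "D = {}")
  case False
  define hu where "hu = integral D (\<lambda>x. H (u x) + u x * V x)"
  define hw where "hw = integral D (\<lambda>x. H (w x) + V x * w x)"
  define I where "I = integral D (\<lambda>x. u x * (norm (g x))\<^sup>2)"
  define P where "P = integral D (\<lambda>x. pressure (u x))"
  define A where "A = integral D u"
  obtain B where B: "B > 0" "\<And>x. x \<in> D \<Longrightarrow> norm x \<le> B" using D(3) by (auto simp: bounded_pos)
  define R where "R = 2 * B"
  have R: "norm (x - y) \<le> R" if "x \<in> D" "y \<in> D" for x y
    using norm_triangle_ineq4[of x y] B(2)[OF that(1)] B(2)[OF that(2)] by (simp add: R_def)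
  have R_pos: "R > 0" using B by (simp add: R_def)
  note ai = absolutely_integrable_data(1-5,8)
  note int = ai[THEN set_lebesgue_integral_eq_integral(1)] w(1-3)[THEN set_lebesgue_integral_eq_integral(1)]
  have hu: "((\<lambda>x. H (u x) + u x * V x) has_integral hu) D"
    and hw: "((\<lambda>x. H (w x) + V x * w x) has_integral hw) D"
    and I: "((\<lambda>x. u x * (norm (g x))\<^sup>2) has_integral I) D"
    and P: "((\<lambda>x. pressure (u x)) has_integral P) D" and A: "(u has_integral A) D"
    unfolding hu_def hw_def I_def P_def A_def by (intro integrable_integral integrable_add int)+
  have step: "hu \<le> hw + I / (2 * C * (1 - s)) + e * R * A"
    if s: "0 < s" "s < 1" and e: "e \<ge> 0"
      and osc: "\<And>x y. x \<in> D \<Longrightarrow> y \<in> D \<Longrightarrow> norm (x - y) \<le> s * R \<Longrightarrow> norm (g x - g y) \<le> e" for s e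
  proof -
    let ?f = "\<lambda>x. (1 - s) * (H (u x) + u x * V x) - u x * residue_density s (e * R) x"
    have "((\<lambda>x. (1 - s) * (H (u x) + u x * V x) - ((H (u x) + u x * V x) + pressure (u x)
        - s / (2 * C * (1 - s)) * (u x * (norm (g x))\<^sup>2) - (s * (e * R)) * u x)) has_integral
        (1 - s) * hu - (hu + P - s / (2 * C * (1 - s)) * I - (s * (e * R)) * A)) D"
      by (intro has_integral_diff has_integral_mult_right has_integral_add hu I P A)
    moreover have "(1 - s) * (H (u x) + u x * V x) - ((H (u x) + u x * V x) + pressure (u x)
        - s / (2 * C * (1 - s)) * (u x * (norm (g x))\<^sup>2) - (s * (e * R)) * u x) = ?f x" for x
    proof -
      have "u x * residue_density s (e * R) x = u x * psi (u x) + u x * V x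
          - s / (2 * C * (1 - s)) * (u x * (norm (g x))\<^sup>2) - (s * (e * R)) * u x"
        by (simp add: residue_density_def right_diff_distrib distrib_left)
      then show ?thesis by (simp add: pressure_def)
    qed
    ultimately have "(?f has_integral
        (1 - s) * hu - (hu + P - s / (2 * C * (1 - s)) * I - (s * (e * R)) * A)) D"
      by (simp only:)
    then have "integral D ?f = (1 - s) * hu - (hu + P - s / (2 * C * (1 - s)) * I - (s * (e * R)) * A)"
      by (rule integral_unique)
    moreover have "integral D (\<lambda>x. s * (H (w x) + V x * w x)) = s * hw"
      by (intro integral_unique has_integral_mult_right hw)
    ultimately have "- P \<le> (1 - s) * hu - (hu + P - s / (2 * C * (1 - s)) * I - (s * (e * R)) * A)
        + s * hw"
      using interpolated_inequality[OF s False R osc e w] by (simp only: P_def)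
    then have "s * hu \<le> s * (hw + I / (2 * C * (1 - s)) + e * R * A)"
      by (simp add: algebra_simps)
    then show ?thesis using s by simp
  qed
  have lim_s: "hu \<le> hw + I / (2 * C) + e * R * A" if e: "e > 0" for e
  proof -
    obtain d where d: "d > 0" "\<And>x y. x \<in> D \<Longrightarrow> y \<in> D \<Longrightarrow> dist x y < d \<Longrightarrow> dist (g x) (g y) < e"
      using uniformly_continuous_onE[OF unif_g e] by (metis dist_commute)
    have "\<forall>\<^sub>F s in at_right 0. 0 < s \<and> s < min 1 (d / R)"
      using d R_pos by (intro eventually_conj eventually_at_right_less order_tendstoD(2)[OF tendsto_ident_at]) auto
    then have "\<forall>\<^sub>F s in at_right 0. hu \<le> hw + I / (2 * C * (1 - s)) + e * R * A"
    proof eventually_elim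
      case (elim s)
      then have sR: "s * R < d" using R_pos by (simp add: pos_less_divide_eq)
      show ?case
      proof (rule step)
        show "norm (g x - g y) \<le> e" if "x \<in> D" "y \<in> D" "norm (x - y) \<le> s * R" for x y
          using d(2)[OF that(1,2)] that(3) sR by (simp add: dist_norm)
      qed (use elim e in auto)
    qed
    moreover have "((\<lambda>s. hw + I / (2 * C * (1 - s)) + e * R * A) \<longlongrightarrow>
        hw + I / (2 * C * (1 - 0)) + e * R * A) (at_right 0)"
      using C_pos by (intro tendsto_intros) auto
    ultimately show ?thesis
      by (auto dest: tendsto_lowerbound[rotated])
  qed
  have "((\<lambda>e. hw + I / (2 * C) + e * R * A) \<longlongrightarrow> hw + I / (2 * C) + 0 * R * A) (at_right 0)"
    by (intro tendsto_intros)
  moreover have "\<forall>\<^sub>F e in at_right 0. hu \<le> hw + I / (2 * C) + e * R * A"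
    using eventually_at_right_less[of "0::real"] by eventually_elim (rule lim_s)
  ultimately have "hu \<le> hw + I / (2 * C) + 0 * R * A"
    by (rule tendsto_lowerbound) simp
  then show ?thesis by (simp add: hu_def hw_def I_def)
qed auto

end

section \<open>Consequences of smoothness up to the boundary\<close>

lemma frechet_derivative_cong:
  assumes "x \<in> S" "\<And>y. y \<in> S \<Longrightarrow> f y = h y"
  shows "frechet_derivative f (at x within S) = frechet_derivative h (at x within S)"
    "f differentiable (at x within S) \<longleftrightarrow> h differentiable (at x within S)"
proof -
  have "(f has_derivative D) (at x within S) \<longleftrightarrow> (h has_derivative D) (at x within S)" for D
    using assms by (auto intro: has_derivative_transform[rotated 2])
  then show "frechet_derivative f (at x within S) = frechet_derivative h (at x within S)"
    "f differentiable (at x within S) \<longleftrightarrow> h differentiable (at x within S)"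
    by (simp_all add: frechet_derivative_def differentiable_def)
qed

text \<open>
  Only the values on \<open>S\<close> matter.  This allows \<open>deriv\<close> to replace the derivative within an open set.
\<close>

lemma Ck_on_cong: "(\<And>y. y \<in> S \<Longrightarrow> f y = h y) \<Longrightarrow> Ck_on k S f \<longleftrightarrow> Ck_on k S h"
proof (induction k arbitrary: f h)
  case 0
  then show ?case by (simp cong: continuous_on_cong)
next
  case (Suc k)
  have "Ck_on k S (\<lambda>x. frechet_derivative f (at x within S) d) \<longleftrightarrow>
      Ck_on k S (\<lambda>x. frechet_derivative h (at x within S) d)" for d
    by (rule Suc.IH) (simp add: frechet_derivative_cong(1)[OF _ Suc.prems])
  then show ?case by (simp add: frechet_derivative_cong(2)[OF _ Suc.prems])
qed

lemma smooth_on_cong: "(\<And>y. y \<in> S \<Longrightarrow> f y = h y) \<Longrightarrow> smooth_on S f \<longleftrightarrow> smooth_on S h"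
  unfolding smooth_on_def using Ck_on_cong by blast

lemma smooth_on_frechet:
  assumes "smooth_on S f"
  shows "x \<in> S \<Longrightarrow> f differentiable (at x within S)"
    "smooth_on S (\<lambda>x. frechet_derivative f (at x within S) d)"
proof -
  have "Ck_on (Suc k) S f" for k using assms unfolding smooth_on_def by blast
  then show "x \<in> S \<Longrightarrow> f differentiable (at x within S)"
    "smooth_on S (\<lambda>x. frechet_derivative f (at x within S) d)"
    by (auto simp: smooth_on_def)
qed

lemma smooth_on_imp_continuous_on: "smooth_on S f \<Longrightarrow> continuous_on S f"
  unfolding smooth_on_def by (metis Ck_on.simps(1))

lemma smooth_on_real:
  fixes f :: "real \<Rightarrow> real"
  assumes S: "open S" and f: "smooth_on S f"
  shows "x \<in> S \<Longrightarrow> (f has_real_derivative deriv f x) (at x)" "smooth_on S (deriv f)"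
proof -
  have D: "(f has_real_derivative deriv f x) (at x)" if "x \<in> S" for x
    using smooth_on_frechet(1)[OF f that]
    by (simp only: at_within_open[OF that S] DERIV_deriv_iff_real_differentiable)
  then show "x \<in> S \<Longrightarrow> (f has_real_derivative deriv f x) (at x)" .
  have "frechet_derivative f (at x within S) 1 = deriv f x" if "x \<in> S" for x
    using fun_cong[OF frechet_derivative_at[OF D[OF that, unfolded has_field_derivative_def]], of 1]
    by (simp add: at_within_open[OF that S])
  then show "smooth_on S (deriv f)"
    by (rule iffD1[OF smooth_on_cong smooth_on_frechet(2)[OF f, of 1]])
qed

lemma gradient_on_unique:
  fixes f :: "real^'n \<Rightarrow> real"
  assumes "x \<in> interior S" "(f has_derivative (\<lambda>h. d \<bullet> h)) (at x)"
  shows "gradient_on S f x = d"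
proof -
  have "frechet_derivative f (at x within S) = (\<lambda>h. d \<bullet> h)"
    using frechet_derivative_at[OF assms(2)] at_within_interior[OF assms(1)] by simp
  then show ?thesis by (simp add: gradient_on_def vec_eq_iff inner_axis)
qed

lemma smooth_on_gradient:
  fixes f :: "real^'n \<Rightarrow> real"
  assumes f: "smooth_on S f"
  shows "continuous_on S (gradient_on S f)"
    "x \<in> S \<Longrightarrow> gradient_on S f differentiable (at x within S)"
    "x \<in> interior S \<Longrightarrow> (f has_derivative (\<lambda>h. gradient_on S f x \<bullet> h)) (at x)"
proof -
  note comp = smooth_on_frechet(2)[OF f]
  show "continuous_on S (gradient_on S f)"
    unfolding gradient_on_def[abs_def]
    by (intro continuous_on_vec_lambda smooth_on_imp_continuous_on comp)
  show "gradient_on S f differentiable (at x within S)" if "x \<in> S"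
    unfolding differentiable_componentwise_within[of "gradient_on S f"]
  proof
    fix b :: "real^'n" assume "b \<in> Basis"
    then obtain i where b: "b = axis i 1" by (auto simp: Basis_vec_def)
    have "(\<lambda>y. gradient_on S f y \<bullet> b) = (\<lambda>y. frechet_derivative f (at y within S) (axis i 1))"
      by (simp add: b gradient_on_def inner_axis fun_eq_iff)
    then show "(\<lambda>y. gradient_on S f y \<bullet> b) differentiable (at x within S)"
      using smooth_on_frechet(1)[OF comp that] by simp
  qed
  show "(f has_derivative (\<lambda>h. gradient_on S f x \<bullet> h)) (at x)" if x: "x \<in> interior S"
  proof -
    have at: "at x within S = at x" by (rule at_within_interior[OF x])
    define L where "L = frechet_derivative f (at x)"
    have D: "(f has_derivative L) (at x)"
      using smooth_on_frechet(1)[OF f] interior_subset x at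
      unfolding L_def by (metis frechet_derivative_works subsetD)
    then interpret L: bounded_linear L by (rule has_derivative_bounded_linear)
    have "L h = gradient_on S f x \<bullet> h" for h
    proof -
      have "L h = L (\<Sum>i\<in>UNIV. h $ i *\<^sub>R axis i 1)"
        by (simp add: basis_expansion[of h, unfolded scalar_mult_eq_scaleR])
      also have "\<dots> = (\<Sum>i\<in>UNIV. h $ i * L (axis i 1))"
        by (simp add: L.sum L.scaleR)
      also have "\<dots> = gradient_on S f x \<bullet> h"
        by (simp add: gradient_on_def inner_vec_def at L_def mult.commute)
      finally show ?thesis .
    qed
    with D show ?thesis by (metis (no_types, lifting) ext)
  qed
qed

text \<open>
  Along a segment in the interior, \<open>V x - C / 2 * |x|\<^sup>2\<close> has a nonnegative second derivative.
\<close>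

lemma hessian_imp_strongly_convex:
  fixes V :: "real^'n \<Rightarrow> real"
  assumes V: "smooth_on S V" and S: "convex S"
    and hess: "\<And>x. x \<in> S \<Longrightarrow> matrix_le (C *\<^sub>R mat 1) (hessian_on S V x)"
    and x: "x \<in> interior S" and y: "y \<in> interior S" and s: "0 \<le> s" "s \<le> 1"
  shows "V ((1 - s) *\<^sub>R x + s *\<^sub>R y) + C / 2 * (s * (1 - s)) * (norm (x - y))\<^sup>2
    \<le> (1 - s) * V x + s * V y"
proof -
  define \<delta> where "\<delta> = y - x"
  define p where "p t = x + t *\<^sub>R \<delta>" for t
  define k where "k = C * (norm \<delta>)\<^sup>2"
  have p: "p t \<in> interior S" if "t \<in> {0..1}" for t
  proof -
    have "(1 - t) *\<^sub>R x + t *\<^sub>R y \<in> interior S"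
      by (rule convexD_alt[OF convex_interior[OF S] x y]) (use that in auto)
    then show ?thesis by (simp add: p_def \<delta>_def algebra_simps)
  qed
  have dp: "(p has_derivative (\<lambda>h. h *\<^sub>R \<delta>)) (at t)" for t
    unfolding p_def[abs_def] by (auto intro!: derivative_eq_intros)
  define f where "f t = V (p t) - k / 2 * t\<^sup>2" for t
  define f1 where "f1 t = gradient_on S V (p t) \<bullet> \<delta> - k * t" for t
  define f2 where "f2 t = (hessian_on S V (p t) *v \<delta>) \<bullet> \<delta> - k" for t
  have "convex_on {0..1} f"
  proof (rule f''_ge0_imp_convex)
    show "convex {0..1::real}" by simp
    fix t :: real assume t: "t \<in> {0..1}"
    have "((\<lambda>t. V (p t)) has_derivative (\<lambda>h. gradient_on S V (p t) \<bullet> (h *\<^sub>R \<delta>))) (at t)"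
      by (rule has_derivative_compose[OF dp smooth_on_gradient(3)[OF V p[OF t]]])
    then have "((\<lambda>t. V (p t)) has_real_derivative gradient_on S V (p t) \<bullet> \<delta>) (at t)"
      by (simp add: has_field_derivative_def mult_commute_abs)
    then show "(f has_real_derivative f1 t) (at t)"
      unfolding f_def[abs_def] f1_def by (auto intro!: derivative_eq_intros)
    have "(gradient_on S V has_derivative (\<lambda>h. hessian_on S V (p t) *v h)) (at (p t))"
      using smooth_on_gradient(2)[OF V, of "p t"] p[OF t] interior_subset[of S]
        at_within_interior[OF p[OF t]]
      unfolding jacobian_works hessian_on_def by auto
    from has_derivative_compose[OF dp this]
    have "((\<lambda>t. gradient_on S V (p t)) has_derivative (\<lambda>h. hessian_on S V (p t) *v (h *\<^sub>R \<delta>))) (at t)" .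
    from has_derivative_inner_left[OF this, of \<delta>]
    have "((\<lambda>t. gradient_on S V (p t) \<bullet> \<delta>) has_real_derivative (hessian_on S V (p t) *v \<delta>) \<bullet> \<delta>) (at t)"
      by (simp add: has_field_derivative_def mult_commute_abs matrix_vector_mult_scaleR)
    then show "(f1 has_real_derivative f2 t) (at t)"
      unfolding f1_def[abs_def] f2_def by (auto intro!: derivative_eq_intros)
    have "\<delta> \<bullet> ((C *\<^sub>R mat 1) *v \<delta>) \<le> \<delta> \<bullet> (hessian_on S V (p t) *v \<delta>)"
      using hess[of "p t"] p[OF t] interior_subset[of S] unfolding matrix_le_def by blast
    moreover have "(C *\<^sub>R mat 1) *v \<delta> = C *\<^sub>R \<delta>"
      by (simp add: scaleR_matrix_vector_assoc[symmetric])
    ultimately show "f2 t \<ge> 0"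
      by (simp add: f2_def k_def power2_norm_eq_inner inner_commute)
  qed
  from convex_onD[OF this, of s 0 1] s have "f s \<le> (1 - s) * f 0 + s * f 1" by simp
  moreover define z where "z = (1 - s) *\<^sub>R x + s *\<^sub>R y"
  moreover have "p s = z" "p 0 = x" "p 1 = y"
    by (simp_all add: p_def \<delta>_def z_def algebra_simps)
  moreover define N where "N = (norm (x - y))\<^sup>2"
  moreover have "k = C * N" by (simp add: k_def N_def \<delta>_def norm_minus_commute)
  ultimately have "V z - C * N / 2 * s\<^sup>2 \<le> (1 - s) * V x + s * (V y - C * N / 2)"
    by (simp add: f_def)
  then have "V z + C / 2 * (s * (1 - s)) * N \<le> (1 - s) * V x + s * V y"
    by (simp add: algebra_simps power2_eq_square diff_divide_distrib)
  then show ?thesis by (simp only: z_def N_def)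
qed

section \<open>From bounded pieces to the whole domain\<close>

lemma set_integrable_imp_integral:
  fixes f :: "'a::euclidean_space \<Rightarrow> real"
  assumes "set_integrable lborel A f"
  shows "f absolutely_integrable_on A" "integral A f = (LINT x:A|lborel. f x)"
proof -
  show "f absolutely_integrable_on A"
    using assms integrable_completion[of "\<lambda>x. indicator A x *\<^sub>R f x" lborel]
    unfolding set_integrable_def by (auto dest: borel_measurable_integrable)
  show "integral A f = (LINT x:A|lborel. f x)"
    using set_borel_integral_eq_integral(2)[OF assms] by simp
qed

lemma nn_set_integral_eq_integral:
  fixes f :: "'a::euclidean_space \<Rightarrow> real"
  assumes "set_integrable lborel A f" "\<And>x. x \<in> A \<Longrightarrow> 0 \<le> f x"
  shows "(\<integral>\<^sup>+x\<in>A. ennreal (f x) \<partial>lborel) = ennreal (integral A f)"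
proof -
  have "(\<integral>\<^sup>+x\<in>A. ennreal (f x) \<partial>lborel) = (\<integral>\<^sup>+x. ennreal (indicator A x *\<^sub>R f x) \<partial>lborel)"
    by (rule nn_integral_cong) (simp add: indicator_def)
  also have "\<dots> = ennreal (\<integral>x. indicator A x *\<^sub>R f x \<partial>lborel)"
    by (rule nn_integral_eq_integral) (use assms in \<open>auto simp: set_integrable_def indicator_def\<close>)
  finally show ?thesis
    by (simp add: set_integrable_imp_integral(2)[OF assms(1)] set_lebesgue_integral_def)
qed

lemma set_integrable_bounded:
  fixes f :: "'a::euclidean_space \<Rightarrow> real"
  assumes A: "A \<in> sets borel" "bounded A"
    and f: "(\<lambda>x. indicator A x *\<^sub>R f x) \<in> borel_measurable borel" "\<And>x. x \<in> A \<Longrightarrow> \<bar>f x\<bar> \<le> M"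
  shows "set_integrable lborel A f"
proof -
  have "integrable lborel (\<lambda>x. indicator A x *\<^sub>R (indicator A x *\<^sub>R f x))"
    by (rule integrableI_bounded_set_indicator[where B = M])
      (use A f emeasure_bounded_finite[OF A(2)] in \<open>auto simp: indicator_def\<close>)
  moreover have "indicator A x *\<^sub>R (indicator A x *\<^sub>R f x) = indicator A x *\<^sub>R f x" for x
    by (simp add: indicator_def)
  ultimately show ?thesis by (simp only: set_integrable_def)
qed

lemma (in internal_energy) H_comp_measurable:
  assumes f: "(\<lambda>x. indicator A x *\<^sub>R f x) \<in> borel_measurable borel" and "\<And>x. x \<in> A \<Longrightarrow> f x \<ge> 0"
  shows "(\<lambda>x. indicator A x *\<^sub>R H (f x)) \<in> borel_measurable borel"
proof -
  have "(\<lambda>x. indicator A x *\<^sub>R H (f x)) =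
      (\<lambda>x. if indicator A x *\<^sub>R f x \<ge> 0 then H (indicator A x *\<^sub>R f x) else 0)"
    using assms(2) by (auto simp: fun_eq_iff indicator_def H_zero)
  then show ?thesis using measurable_compose[OF f H_measurable] by simp
qed

text \<open>
  The assumptions on \<open>v\<close> say that \<open>v x\<close> is the generalized inverse of \<open>H'\<close> at \<open>- V x\<close>, that is,
  the point where \<open>z \<mapsto> H z + z * V x\<close> is least.
\<close>

locale energy_comparison = internal_energy H psi psi' "DIM('a)"
  for H psi psi' and S :: "'a::euclidean_space set" and u V v :: "'a \<Rightarrow> real" and g :: "'a \<Rightarrow> 'a"
    and C :: real +
  assumes S: "closed S" "convex S"
    and cont: "continuous_on S u" "continuous_on S V" "continuous_on S g"
    and u_pos: "x \<in> S \<Longrightarrow> 0 < u x"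
    and grad: "x \<in> interior S \<Longrightarrow> ((\<lambda>x. psi (u x) + V x) has_derivative (\<lambda>h. g x \<bullet> h)) (at x)"
    and C_pos: "C > 0"
    and V_convex: "x \<in> interior S \<Longrightarrow> y \<in> interior S \<Longrightarrow> 0 \<le> s \<Longrightarrow> s \<le> 1 \<Longrightarrow>
      V ((1 - s) *\<^sub>R x + s *\<^sub>R y) + C / 2 * (s * (1 - s)) * (norm (x - y))\<^sup>2
        \<le> (1 - s) * V x + s * V y"
    and psi_strict: "0 < a \<Longrightarrow> a < b \<Longrightarrow> psi a < psi b"
    and v_nonneg: "x \<in> S \<Longrightarrow> v x \<ge> 0"
    and v_pos: "x \<in> S \<Longrightarrow> v x > 0 \<Longrightarrow> psi (v x) = - V x"
    and v_zero: "x \<in> S \<Longrightarrow> v x = 0 \<Longrightarrow> z > 0 \<Longrightarrow> - V x \<le> psi z"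
    and V_below: "x \<in> S \<Longrightarrow> \<exists>z>0. - V x < psi z"
    and integrable: "set_integrable lborel (interior S) u" "set_integrable lborel (interior S) v"
    and same_mass: "(LINT x:interior S|lborel. u x) = (LINT x:interior S|lborel. v x)"
begin

text \<open>
  The integrand on the left-hand side: how much the energy with potential \<open>V x\<close> at the density \<open>u x\<close>
  exceeds its least value.
\<close>

definition gap :: "'a \<Rightarrow> real" where
  "gap x = H (u x) - H (v x) + (u x - v x) * V x"

lemma v_minimizes:
  assumes x: "x \<in> S" and z: "z \<ge> 0"
  shows "H (v x) + v x * V x \<le> H z + z * V x"
proof (cases "v x = 0")
  case False
  then have "v x > 0" using v_nonneg[OF x] by simp
  from tangent[OF this z] v_pos[OF x this] show ?thesis by (simp add: algebra_simps)
next
  case True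
  show ?thesis
  proof (cases "z = 0")
    case False
    have "0 \<le> H z + z * V x + e" if "e > 0" for e
    proof -
      obtain y where y: "y > 0" "y * psi y - H y < e" using pressure_vanishes \<open>e > 0\<close> by blast
      have "- V x * z \<le> psi y * z" using v_zero[OF x True y(1)] z by (rule mult_right_mono)
      with tangent[OF y(1) z] y(2) show ?thesis by (simp add: algebra_simps)
    qed
    then have "0 \<le> H z + z * V x" by (rule field_le_epsilon)
    with True show ?thesis by (simp add: H_zero)
  qed (simp add: True)
qed

lemma gap_nonneg: "x \<in> S \<Longrightarrow> gap x \<ge> 0"
  using v_minimizes[of x "u x"] u_pos[of x] by (simp add: gap_def algebra_simps)

text \<open>
  On a compact set \<open>- V\<close> has a largest value, and this is still below the supremum of \<open>H'\<close>.
\<close>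

lemma v_bounded: "\<exists>M>0. \<forall>x\<in>S \<inter> cball 0 r. v x \<le> M"
proof (cases "S \<inter> cball 0 r = {}")
  case False
  have "compact (S \<inter> cball 0 r)" using S(1) by (simp add: closed_Int_compact)
  then obtain x0 where x0: "x0 \<in> S \<inter> cball 0 r" "\<And>x. x \<in> S \<inter> cball 0 r \<Longrightarrow> V x0 \<le> V x"
    using continuous_attains_inf[OF _ False, of V] continuous_on_subset[OF cont(2)] by blast
  then obtain z where z: "z > 0" "- V x0 < psi z" using V_below by blast
  have "v x \<le> z" if "x \<in> S \<inter> cball 0 r" for x
  proof (rule ccontr)
    assume "\<not> v x \<le> z"
    then have "psi z < psi (v x)" "psi (v x) = - V x"
      using psi_strict[OF z(1), of "v x"] v_pos[of x] that z(1) by simp_all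
    with z(2) x0(2)[OF that] show False by simp
  qed
  with z(1) show ?thesis by blast
qed (auto intro: exI[of _ 1])

lemma v_positive_somewhere:
  assumes "interior S \<noteq> {}"
  shows "\<exists>x\<in>interior S. v x > 0"
proof (rule ccontr)
  assume "\<not> (\<exists>x\<in>interior S. v x > 0)"
  then have "v x = 0" if "x \<in> interior S" for x
    using v_nonneg[of x] that interior_subset[of S] by force
  then have "(LINT x:interior S|lborel. v x) = (LINT x:interior S|lborel. 0)"
    by (intro set_lebesgue_integral_cong) auto
  then have "(\<integral>x. indicator (interior S) x *\<^sub>R u x \<partial>lborel) = 0"
    using same_mass by (simp add: set_lebesgue_integral_def)
  moreover have "AE x in lborel. 0 \<le> indicator (interior S) x *\<^sub>R u x"
    using u_pos interior_subset[of S] by (intro AE_I2) (force simp: indicator_def)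
  ultimately have "AE x in lborel. indicator (interior S) x *\<^sub>R u x = 0"
    using integral_nonneg_eq_0_iff_AE integrable(1) unfolding set_integrable_def by blast
  then have "AE x in lborel. x \<notin> interior S"
    by (rule eventually_mono) (use u_pos interior_subset[of S] in \<open>force simp: indicator_def split: if_splits\<close>)
  then have "interior S \<in> null_sets lborel" by (simp add: AE_iff_null_sets)
  then have "negligible (interior S)"
    by (simp add: negligible_iff_null_sets null_sets_completionI)
  with assms show False using open_not_negligible by blast
qed

text \<open>
  Where \<open>v x0 > 0\<close>, \<open>- V x0\<close> exceeds \<open>H' (v x0 / 2)\<close>, and so does \<open>- V\<close> nearby.
\<close>

lemma positive_core:
  assumes "interior S \<noteq> {}"
  shows "\<exists>x0 r c. r > 0 \<and> c > 0 \<and> ball x0 r \<subseteq> interior S \<and> (\<forall>x\<in>ball x0 r. c \<le> v x)"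
proof -
  obtain x0 where x0: "x0 \<in> interior S" "v x0 > 0" using v_positive_somewhere[OF assms] by blast
  define c where "c = v x0 / 2"
  have c: "c > 0" "c < v x0" using x0 by (simp_all add: c_def)
  let ?T = "interior S \<inter> V -` {..< - psi c}"
  have "open ?T"
    by (rule continuous_open_preimage[OF continuous_on_subset[OF cont(2) interior_subset]]) auto
  moreover have "x0 \<in> ?T"
    using psi_strict[OF c] v_pos[of x0] x0 interior_subset[of S] by auto
  ultimately obtain r where r: "r > 0" "ball x0 r \<subseteq> ?T" by (meson open_contains_ball)
  have "c \<le> v x" if "x \<in> ball x0 r" for x
  proof (rule ccontr)
    assume less: "\<not> c \<le> v x"
    have x: "x \<in> S" "psi c < - V x" using r(2) that interior_subset[of S] by auto
    show False
    proof (cases "v x = 0")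
      case True
      with v_zero[OF x(1) True c(1)] x(2) show False by simp
    next
      case False
      then have "v x > 0" using v_nonneg[OF x(1)] by simp
      with psi_strict[of "v x" c] v_pos[OF x(1)] less x(2) show False by simp
    qed
  qed
  moreover have "ball x0 r \<subseteq> interior S" using r(2) by blast
  ultimately show ?thesis using r(1) c(1) by blast
qed

definition piece :: "nat \<Rightarrow> 'a set" where
  "piece n = interior S \<inter> ball 0 (real n)"

lemma piece_props: "open (piece n)" "convex (piece n)" "bounded (piece n)" "piece n \<in> sets borel"
  "piece n \<subseteq> interior S" "piece n \<subseteq> S \<inter> cball 0 (real n)"
  using S(2) interior_subset[of S]
  by (auto simp: piece_def convex_Int convex_interior intro: bounded_subset[OF bounded_ball])

lemma piece_transport:
  assumes "piece n \<noteq> {}"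
  obtains c0 where "transport_data H psi psi' (piece n) u V g C c0"
proof -
  let ?K = "S \<inter> cball 0 (real n)"
  have K: "compact ?K" "?K \<noteq> {}" using S(1) assms piece_props(6)[of n] by (auto simp: closed_Int_compact)
  obtain x1 where x1: "x1 \<in> ?K" "\<And>x. x \<in> ?K \<Longrightarrow> u x1 \<le> u x"
    using continuous_attains_inf[OF K, of u] continuous_on_subset[OF cont(1)] by blast
  have unif: "uniformly_continuous_on (piece n) f" if "continuous_on S f" for f :: "'a \<Rightarrow> 'b::metric_space"
  proof -
    have "uniformly_continuous_on ?K f"
      by (rule compact_uniformly_continuous[OF continuous_on_subset[OF that] K(1)]) auto
    then show ?thesis
      using piece_props(6)[of n] unfolding uniformly_continuous_on_def by (meson subsetD)
  qed
  have "transport_data H psi psi' (piece n) u V g C (u x1)"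
  proof unfold_locales
    show "open (piece n)" "convex (piece n)" "bounded (piece n)" by (rule piece_props)+
    show "uniformly_continuous_on (piece n) u" "uniformly_continuous_on (piece n) V"
      "uniformly_continuous_on (piece n) g"
      by (rule unif cont)+
    show "0 < u x1" using u_pos x1(1) by simp
    show "C > 0" by (rule C_pos)
    show "u x1 \<le> u x" if "x \<in> piece n" for x using x1(2) piece_props(6)[of n] that by blast
    show "((\<lambda>x. psi (u x) + V x) has_derivative (\<lambda>h. g x \<bullet> h)) (at x)" if "x \<in> piece n" for x
      using grad piece_props(5)[of n] that by blast
    show "V ((1 - s) *\<^sub>R x + s *\<^sub>R y) + C / 2 * (s * (1 - s)) * (norm (x - y))\<^sup>2
        \<le> (1 - s) * V x + s * V y" if "x \<in> piece n" "y \<in> piece n" "0 \<le> s" "s \<le> 1" for x y s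
      using V_convex piece_props(5)[of n] that by blast
  qed
  then show thesis by (rule that)
qed

lemma piece_integrable_continuous:
  fixes f :: "'a \<Rightarrow> real"
  assumes f: "continuous_on S f"
  shows "set_integrable lborel (piece n) f" "\<exists>M. \<forall>x\<in>piece n. \<bar>f x\<bar> \<le> M"
proof -
  let ?K = "S \<inter> cball 0 (real n)"
  have "compact ?K" using S(1) by (simp add: closed_Int_compact)
  then have "bounded (f ` ?K)"
    by (intro compact_imp_bounded compact_continuous_image continuous_on_subset[OF f]) auto
  then have "bounded (f ` piece n)"
    by (rule bounded_subset) (rule image_mono[OF piece_props(6)])
  then obtain M where M: "\<And>y. y \<in> f ` piece n \<Longrightarrow> norm y \<le> M" unfolding bounded_iff by blast
  then show "\<exists>M. \<forall>x\<in>piece n. \<bar>f x\<bar> \<le> M" by (auto intro!: exI[of _ M])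
  have "continuous_on (piece n) f"
    by (rule continuous_on_subset[OF f]) (use piece_props(6)[of n] in blast)
  then have "(\<lambda>x. indicator (piece n) x *\<^sub>R f x) \<in> borel_measurable borel"
    by (intro borel_measurable_continuous_on_indicator piece_props)
  then show "set_integrable lborel (piece n) f"
    by (rule set_integrable_bounded[OF piece_props(4,3)]) (use M in auto)
qed

lemma piece_integrable_bounded:
  assumes w: "(\<lambda>x. indicator (piece n) x *\<^sub>R w x) \<in> borel_measurable borel"
    and M: "M > 0" "\<And>x. x \<in> piece n \<Longrightarrow> 0 \<le> w x \<and> w x \<le> M"
  shows "set_integrable lborel (piece n) w" "set_integrable lborel (piece n) (\<lambda>x. H (w x))"
    "set_integrable lborel (piece n) (\<lambda>x. V x * w x)"
proof -
  show "set_integrable lborel (piece n) w"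
    by (rule set_integrable_bounded[OF piece_props(4,3) w, of M]) (use M in auto)
  show "set_integrable lborel (piece n) (\<lambda>x. H (w x))"
    by (rule set_integrable_bounded[OF piece_props(4,3) H_comp_measurable[OF w] H_bounds])
      (use M in auto)
  obtain N where N: "\<And>x. x \<in> piece n \<Longrightarrow> \<bar>V x\<bar> \<le> N"
    using piece_integrable_continuous(2)[OF cont(2)] by blast
  have "(\<lambda>x. indicator (piece n) x *\<^sub>R V x) \<in> borel_measurable borel"
    using piece_integrable_continuous(1)[OF cont(2), of n]
    by (auto simp: set_integrable_def dest: borel_measurable_integrable)
  then have "(\<lambda>x. (indicator (piece n) x *\<^sub>R V x) * (indicator (piece n) x *\<^sub>R w x)) \<in> borel_measurable borel"
    by (intro borel_measurable_times w)
  moreover have "(indicator (piece n) x *\<^sub>R V x) * (indicator (piece n) x *\<^sub>R w x) =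
      indicator (piece n) x *\<^sub>R (V x * w x)" for x
    by (simp add: indicator_def)
  ultimately have "(\<lambda>x. indicator (piece n) x *\<^sub>R (V x * w x)) \<in> borel_measurable borel" by (simp only:)
  then show "set_integrable lborel (piece n) (\<lambda>x. V x * w x)"
  proof (rule set_integrable_bounded[OF piece_props(4,3)])
    fix x assume x: "x \<in> piece n"
    show "\<bar>V x * w x\<bar> \<le> N * M"
      unfolding abs_mult using N[OF x] M(2)[OF x] by (intro mult_mono) auto
  qed
qed

lemma v_measurable: "(\<lambda>x. indicator (piece n) x *\<^sub>R v x) \<in> borel_measurable borel"
proof -
  have "set_integrable lborel (piece n) v"
    by (rule set_integrable_subset[OF integrable(2)]) (use piece_props[of n] in auto)
  then show ?thesis by (auto simp: set_integrable_def dest: borel_measurable_integrable)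
qed

lemma piece_integrable:
  "set_integrable lborel (piece n) u" "set_integrable lborel (piece n) v"
  "set_integrable lborel (piece n) (\<lambda>x. H (v x))" "set_integrable lborel (piece n) (\<lambda>x. V x * v x)"
  "set_integrable lborel (piece n) (\<lambda>x. H (u x) + u x * V x)"
  "set_integrable lborel (piece n) (\<lambda>x. u x * (norm (g x))\<^sup>2)"
proof -
  have H: "continuous_on S (\<lambda>x. H (u x))"
    by (rule continuous_on_compose2[OF continuous_on_H cont(1)]) (use u_pos in auto)
  show "set_integrable lborel (piece n) u"
    "set_integrable lborel (piece n) (\<lambda>x. H (u x) + u x * V x)"
    "set_integrable lborel (piece n) (\<lambda>x. u x * (norm (g x))\<^sup>2)"
    by (intro piece_integrable_continuous continuous_intros H cont)+
  obtain M where M: "M > 0" "\<forall>x\<in>S \<inter> cball 0 (real n). v x \<le> M"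
    using v_bounded[of "real n"] by blast
  have v0: "0 \<le> v x \<and> v x \<le> M" if "x \<in> piece n" for x
    using M(2) v_nonneg that piece_props(6)[of n] by blast
  show "set_integrable lborel (piece n) v" "set_integrable lborel (piece n) (\<lambda>x. H (v x))"
    "set_integrable lborel (piece n) (\<lambda>x. V x * v x)"
    by (rule piece_integrable_bounded[OF v_measurable M(1) v0]; assumption)+
qed

lemma piece_gap_integrable: "set_integrable lborel (piece n) gap"
proof -
  have "set_integrable lborel (piece n) (\<lambda>x. H (u x) + u x * V x - (H (v x) + V x * v x))"
    by (intro set_integral_diff set_integral_add piece_integrable)
  then show ?thesis by (simp add: gap_def[abs_def] algebra_simps)
qed

text \<open>
  The masses of \<open>u\<close> and \<open>v\<close> on a bounded piece differ.  The difference is spread over a fixed ball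
  \<open>B\<close> where \<open>v\<close> stays away from \<open>0\<close>, at a cost proportional to it.
\<close>

lemma piece_inequality:
  assumes c: "c > 0" and B: "ball x0 r \<subseteq> piece n" "r > 0"
    and v_B: "\<And>x. x \<in> ball x0 r \<Longrightarrow> c \<le> v x \<and> v x \<le> M"
    and close: "\<bar>integral (piece n) u - integral (piece n) v\<bar> \<le> c / 2 * measure lborel (ball x0 r)"
  shows "integral (piece n) gap \<le> integral (piece n) (\<lambda>x. u x * (norm (g x))\<^sup>2) / (2 * C)
    + (psi (M + c) - psi (c / 2)) * \<bar>integral (piece n) u - integral (piece n) v\<bar>"
proof -
  let ?D = "piece n" and ?B = "ball x0 r"
  define m where "m = measure lborel ?B"
  have m: "m > 0" using content_ball_pos[OF B(2), of x0] by (simp add: m_def)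
  define d where "d = integral ?D u - integral ?D v"
  define \<delta> where "\<delta> = d / m"
  have \<delta>: "\<bar>\<delta>\<bar> \<le> c / 2" using close m by (simp add: \<delta>_def d_def m_def abs_divide pos_divide_le_eq)
  define w where "w x = v x + \<delta> * indicator ?B x" for x
  define L where "L = psi (M + c) - psi (c / 2)"
  have "?D \<noteq> {}" using B by auto
  then obtain c0 where "transport_data H psi psi' ?D u V g C c0" by (rule piece_transport)
  then interpret D: transport_data H psi psi' ?D u V g C c0 .
  have D_S: "?D \<subseteq> S" using piece_props(6)[of n] by blast
  have ind: "(indicator ?B :: 'a \<Rightarrow> real) absolutely_integrable_on ?D" "integral ?D (indicator ?B) = m"
  proof -
    have *: "set_integrable lborel ?D (indicator ?B :: 'a \<Rightarrow> real)"
      by (rule set_integrable_bounded[OF piece_props(4,3), where M = 1])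
        (use piece_props(4)[of n] in \<open>auto simp: indicator_def\<close>)
    then show "(indicator ?B :: 'a \<Rightarrow> real) absolutely_integrable_on ?D"
      by (rule set_integrable_imp_integral)
    have "(LINT x:?D|lborel. indicat_real ?B x) = (\<integral>x. indicat_real ?B x \<partial>lborel)"
      unfolding set_lebesgue_integral_def using B(1)
      by (intro Bochner_Integration.integral_cong) (auto simp: indicator_def)
    then show "integral ?D (indicator ?B) = m"
      using set_integrable_imp_integral(2)[OF *] by (simp add: m_def)
  qed
  note ai = piece_integrable[of n, THEN set_integrable_imp_integral(1)]
  have w0: "w x \<ge> 0" if "x \<in> ?D" for x
    using v_nonneg[of x] D_S that v_B[of x] \<delta> c by (auto simp: w_def indicator_def abs_le_iff)
  \<comment> \<open>\<open>M\<close> bounds \<open>v\<close> on the ball only and does not depend on \<open>n\<close>; \<open>M'\<close> does\<close>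
  obtain M' where M': "M' > 0" "\<forall>x\<in>S \<inter> cball 0 (real n). v x \<le> M'"
    using v_bounded[of "real n"] by blast
  have bounds: "0 \<le> w x \<and> w x \<le> M' + c" if "x \<in> ?D" for x
  proof -
    have "v x \<le> M'" using M'(2) that piece_props(6)[of n] by blast
    moreover have "\<delta> * indicator ?B x \<le> c" using \<delta> c by (auto simp: indicator_def abs_le_iff)
    ultimately show ?thesis using w0[OF that] by (simp add: w_def)
  qed
  have "(\<lambda>x. indicator ?D x *\<^sub>R v x + \<delta> * indicator ?B x) \<in> borel_measurable borel"
    by (intro borel_measurable_add borel_measurable_times borel_measurable_const
        borel_measurable_indicator v_measurable) simp
  moreover have "indicator ?D x *\<^sub>R w x = indicator ?D x *\<^sub>R v x + \<delta> * indicator ?B x" for x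
    using B(1) by (auto simp: w_def indicator_def)
  ultimately have w_meas: "(\<lambda>x. indicator ?D x *\<^sub>R w x) \<in> borel_measurable borel"
    by (simp only:)
  have pos': "M' + c > 0" using M'(1) c by simp
  note w_ai = piece_integrable_bounded[OF w_meas pos' bounds, THEN set_integrable_imp_integral(1)]
  have w_mass: "integral ?D w = integral ?D u"
  proof -
    have "integral ?D w = integral ?D v + \<delta> * integral ?D (indicator ?B)"
      unfolding w_def[abs_def] using ai(2) ind(1)
      by (subst integral_add) (auto simp: absolutely_integrable_on_def intro: integrable_on_mult_right)
    then show ?thesis using m by (simp add: ind(2) \<delta>_def d_def)
  qed
  have cost: "H (w x) + V x * w x \<le> H (v x) + V x * v x + L * \<bar>\<delta>\<bar> * indicator ?B x"
    if x: "x \<in> ?D" for x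
  proof (cases "x \<in> ?B")
    case True
    have pos: "c / 2 \<le> w x" "w x \<le> M + c" "w x > 0" "c \<le> v x" "v x \<le> M" "v x > 0"
      using v_B[OF True] \<delta> c True by (auto simp: w_def abs_le_iff)
    have psiv: "psi (v x) = - V x" using v_pos[of x] D_S x pos by auto
    have "H (w x) + psi (w x) * (v x - w x) \<le> H (v x)" using tangent[of "w x" "v x"] pos by simp
    then have "H (w x) + V x * w x \<le> H (v x) + V x * v x + (psi (w x) - psi (v x)) * \<delta>"
      using True by (simp add: psiv w_def algebra_simps)
    also have "(psi (w x) - psi (v x)) * \<delta> \<le> \<bar>psi (w x) - psi (v x)\<bar> * \<bar>\<delta>\<bar>"
      using abs_ge_self[of "(psi (w x) - psi (v x)) * \<delta>"] by (simp only: abs_mult)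
    also have "\<bar>psi (w x) - psi (v x)\<bar> \<le> L"
      using psi_mono[of "c / 2" "w x"] psi_mono[of "w x" "M + c"]
        psi_mono[of "c / 2" "v x"] psi_mono[of "v x" "M + c"] pos c by (simp add: L_def)
    finally show ?thesis using True by (simp add: mult_right_mono)
  qed (simp add: w_def)
  have "integral ?D (\<lambda>x. H (u x) + u x * V x) \<le>
      integral ?D (\<lambda>x. H (w x) + V x * w x) + integral ?D (\<lambda>x. u x * (norm (g x))\<^sup>2) / (2 * C)"
    by (rule D.entropy_inequality[OF w_ai w0 w_mass])
  also have "integral ?D (\<lambda>x. H (w x) + V x * w x) \<le>
      integral ?D (\<lambda>x. H (v x) + V x * v x) + L * \<bar>\<delta>\<bar> * m"
  proof (rule has_integral_le)
    note int = ai[THEN set_lebesgue_integral_eq_integral(1)]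
      w_ai[THEN set_lebesgue_integral_eq_integral(1)]
      ind(1)[THEN set_lebesgue_integral_eq_integral(1)]
    show "((\<lambda>x. H (w x) + V x * w x) has_integral integral ?D (\<lambda>x. H (w x) + V x * w x)) ?D"
      by (intro integrable_integral integrable_add int)
    show "((\<lambda>x. H (v x) + V x * v x + L * \<bar>\<delta>\<bar> * indicator ?B x) has_integral
        integral ?D (\<lambda>x. H (v x) + V x * v x) + L * \<bar>\<delta>\<bar> * m) ?D"
      unfolding ind(2)[symmetric]
      by (intro has_integral_add has_integral_mult_right integrable_integral integrable_add int)
  qed (rule cost)
  also have "L * \<bar>\<delta>\<bar> * m = L * \<bar>d\<bar>" using m by (simp add: \<delta>_def abs_divide)
  finally have main: "integral ?D (\<lambda>x. H (u x) + u x * V x) - integral ?D (\<lambda>x. H (v x) + V x * v x) \<le>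
      integral ?D (\<lambda>x. u x * (norm (g x))\<^sup>2) / (2 * C) + L * \<bar>d\<bar>"
    by simp
  have "integral ?D (\<lambda>x. H (u x) + u x * V x) - integral ?D (\<lambda>x. H (v x) + V x * v x) = integral ?D gap"
  proof -
    note int = ai[THEN set_lebesgue_integral_eq_integral(1)]
    have "integral ?D (\<lambda>x. H (u x) + u x * V x) - integral ?D (\<lambda>x. H (v x) + V x * v x) =
        integral ?D (\<lambda>x. H (u x) + u x * V x - (H (v x) + V x * v x))"
      by (rule integral_diff[symmetric]) (intro integrable_add int)+
    then show ?thesis by (simp add: gap_def[abs_def] algebra_simps)
  qed
  with main show ?thesis by (simp only: L_def d_def)
qed

text \<open>
  The masses of \<open>u\<close> and \<open>v\<close> on the pieces converge to the same limit, so the cost of correcting them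
  tends to \<open>0\<close>.  As the gap is nonnegative, its integrals over the pieces increase to the integral
  over the whole domain, be it finite or not.
\<close>

theorem energy_comparison_inequality:
  "(\<integral>\<^sup>+x\<in>interior S. ennreal (gap x) \<partial>lborel) \<le>
    ennreal (1 / (2 * C)) * (\<integral>\<^sup>+x\<in>interior S. ennreal (u x * (norm (g x))\<^sup>2) \<partial>lborel)"
proof (cases "interior S = {}")
  case False
  let ?I = "\<integral>\<^sup>+x\<in>interior S. ennreal (u x * (norm (g x))\<^sup>2) \<partial>lborel"
  obtain x0 r c where core: "r > 0" "c > 0" "ball x0 r \<subseteq> interior S" "\<forall>x\<in>ball x0 r. c \<le> v x"
    using positive_core[OF False] by blast
  define m where "m = measure lborel (ball x0 r)"
  have m: "m > 0" using content_ball_pos[OF core(1), of x0] by (simp add: m_def)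
  have ball_far: "norm x < norm x0 + r" if "x \<in> ball x0 r" for x
    using that norm_triangle_ineq2[of x x0] by (simp add: dist_norm norm_minus_commute)
  obtain M where M: "M > 0" "\<forall>x\<in>S \<inter> cball 0 (norm x0 + r). v x \<le> M" using v_bounded by blast
  have v_B: "c \<le> v x \<and> v x \<le> M" if "x \<in> ball x0 r" for x
  proof -
    have "x \<in> S \<inter> cball 0 (norm x0 + r)"
      using that core(3) interior_subset[of S] ball_far[OF that] by auto
    with M(2) core(4) that show ?thesis by blast
  qed
  define L where "L = psi (M + c) - psi (c / 2)"
  define d where "d n = \<bar>integral (piece n) u - integral (piece n) v\<bar>" for n
  have Un: "(\<Union>n. piece n) = interior S"
    by (auto simp: piece_def reals_Archimedean2)
  have inc: "incseq piece" by (force simp: incseq_def piece_def)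
  have "(\<lambda>n. LINT x:piece n|lborel. f x) \<longlonglongrightarrow> (LINT x:interior S|lborel. f x)"
    if "set_integrable lborel (interior S) f" for f :: "'a \<Rightarrow> real"
    using set_integral_cont_up[of piece lborel f] inc that by (simp add: Un piece_props)
  from this[OF integrable(1)] this[OF integrable(2)]
  have lim: "(\<lambda>n. integral (piece n) u) \<longlonglongrightarrow> (LINT x:interior S|lborel. u x)"
    "(\<lambda>n. integral (piece n) v) \<longlonglongrightarrow> (LINT x:interior S|lborel. u x)"
    by (simp_all add: set_integrable_imp_integral(2)[OF piece_integrable(1)]
        set_integrable_imp_integral(2)[OF piece_integrable(2)] same_mass)
  have d: "d \<longlonglongrightarrow> 0"
    using tendsto_rabs[OF tendsto_diff[OF lim]] by (simp add: d_def[abs_def])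
  have gap_lim: "(\<lambda>n. \<integral>\<^sup>+x\<in>piece n. ennreal (gap x) \<partial>lborel) \<longlonglongrightarrow>
      (\<integral>\<^sup>+x\<in>interior S. ennreal (gap x) \<partial>lborel)"
  proof (rule nn_integral_LIMSEQ)
    show "incseq (\<lambda>n x. ennreal (gap x) * indicator (piece n) x)"
      using inc by (auto simp: incseq_def le_fun_def indicator_def intro!: mult_left_mono)
    show "(\<lambda>x. ennreal (gap x) * indicator (piece n) x) \<in> borel_measurable lborel" for n
    proof -
      have "(\<lambda>x. ennreal (indicator (piece n) x *\<^sub>R gap x)) \<in> borel_measurable lborel"
        using piece_gap_integrable[of n]
        by (intro measurable_compose[OF _ measurable_ennreal])
          (auto simp: set_integrable_def dest: borel_measurable_integrable)
      moreover have "ennreal (indicator (piece n) x *\<^sub>R gap x) = ennreal (gap x) * indicator (piece n) x" for x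
        by (simp add: indicator_def)
      ultimately show ?thesis by (simp only:)
    qed
    fix x :: 'a
    show "(\<lambda>n. ennreal (gap x) * indicator (piece n) x) \<longlonglongrightarrow> ennreal (gap x) * indicator (interior S) x"
    proof (cases "x \<in> interior S")
      case True
      then obtain k where "x \<in> piece k" using Un by blast
      then have "x \<in> piece n" if "n \<ge> k" for n using inc that by (auto simp: incseq_def)
      with True show ?thesis
        by (intro tendsto_eventually eventually_sequentiallyI[of k]) simp
    next
      case False
      then have "x \<notin> piece n" for n using Un by blast
      with False show ?thesis by simp
    qed
  qed
  show ?thesis
  proof (rule ennreal_le_epsilon)
    fix e :: real assume e: "e > 0"
    have "(\<lambda>n. L * d n) \<longlonglongrightarrow> L * 0" by (intro tendsto_intros d)
    then have "\<forall>\<^sub>F n in sequentially. L * d n < e" using e by (intro order_tendstoD(2)) auto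
    moreover have "\<forall>\<^sub>F n in sequentially. d n < c / 2 * m"
      using d core(2) m by (intro order_tendstoD(2)) auto
    moreover have "\<forall>\<^sub>F n in sequentially. norm x0 + r < real n"
      by (rule eventually_compose_filterlim[OF eventually_gt_at_top filterlim_real_sequentially])
    ultimately have "\<forall>\<^sub>F n in sequentially.
        (\<integral>\<^sup>+x\<in>piece n. ennreal (gap x) \<partial>lborel) \<le> ennreal (1 / (2 * C)) * ?I + ennreal e"
    proof eventually_elim
      case (elim n)
      have B: "ball x0 r \<subseteq> piece n"
        using core(3) ball_far elim(3) by (force simp: piece_def)
      let ?In = "integral (piece n) (\<lambda>x. u x * (norm (g x))\<^sup>2)"
      have "integral (piece n) gap \<le> ?In / (2 * C) + L * d n"
        using piece_inequality[OF core(2) B core(1) v_B] elim(2) by (simp add: d_def L_def m_def)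
      then have le: "integral (piece n) gap \<le> 1 / (2 * C) * ?In + e" using elim(1) by simp
      have pS: "x \<in> S" if "x \<in> piece n" for x using that piece_props(6)[of n] by blast
      have I_nonneg: "?In \<ge> 0"
        using pS u_pos set_integrable_imp_integral(1)[OF piece_integrable(6)]
        by (intro integral_nonneg) (auto simp: absolutely_integrable_on_def less_imp_le)
      have "(\<integral>\<^sup>+x\<in>piece n. ennreal (gap x) \<partial>lborel) = ennreal (integral (piece n) gap)"
        by (rule nn_set_integral_eq_integral[OF piece_gap_integrable]) (use gap_nonneg pS in auto)
      also have "\<dots> \<le> ennreal (1 / (2 * C) * ?In + e)" using le by (rule ennreal_leI)
      also have "\<dots> = ennreal (1 / (2 * C)) * ennreal ?In + ennreal e"
      proof -
        have C: "0 \<le> 1 / (2 * C)" using C_pos by simp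
        then have "0 \<le> 1 / (2 * C) * ?In" using I_nonneg by (rule mult_nonneg_nonneg)
        then show ?thesis
          using e by (simp only: ennreal_plus less_imp_le ennreal_mult[OF C I_nonneg])
      qed
      also have "ennreal ?In = (\<integral>\<^sup>+x\<in>piece n. ennreal (u x * (norm (g x))\<^sup>2) \<partial>lborel)"
        by (rule nn_set_integral_eq_integral[OF piece_integrable(6), symmetric])
          (use pS u_pos in \<open>auto simp: less_imp_le\<close>)
      also have "\<dots> \<le> ?I"
        using piece_props(5)[of n] by (intro nn_integral_mono) (auto simp: indicator_def)
      finally show ?case by (simp add: add_right_mono mult_left_mono)
    qed
    with gap_lim show "(\<integral>\<^sup>+x\<in>interior S. ennreal (gap x) \<partial>lborel) \<le>
        ennreal (1 / (2 * C)) * ?I + ennreal e"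
      by (rule tendsto_upperbound) simp
  qed
qed simp

end

section \<open>The energy density and its generalized inverse\<close>

text \<open>
  By monotonicity the two limits are the infimum and the supremum of \<open>\<psi>\<close>; between them the
  intermediate value theorem provides the preimage.
\<close>

lemma gen_inverse_real:
  fixes \<psi> :: "real \<Rightarrow> real"
  assumes mono: "\<And>a b. 0 < a \<Longrightarrow> a < b \<Longrightarrow> \<psi> a < \<psi> b" and cont: "continuous_on {0<..} \<psi>"
    and y: "ereal y < lim_infty \<psi>" and v: "ereal v = gen_inverse \<psi> (ereal y)"
  shows "\<exists>z>0. y < \<psi> z" "v \<ge> 0" "v > 0 \<Longrightarrow> \<psi> v = y" "v = 0 \<Longrightarrow> z > 0 \<Longrightarrow> y \<le> \<psi> z"
proof -
  have le: "\<psi> a \<le> \<psi> b" if "0 < a" "a \<le> b" for a b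
    using mono[of a b] that by (cases "a = b") auto
  have "((\<lambda>x. ereal (\<psi> x)) \<longlongrightarrow> (INF x\<in>{0<..}. ereal (\<psi> x))) (at_right 0)"
  proof (rule order_tendstoI)
    fix a assume "a < (INF x\<in>{0<..}. ereal (\<psi> x))"
    then have "a < ereal (\<psi> x)" if "x > 0" for x
      using that by (meson INF_lower greaterThan_iff less_le_trans)
    then show "\<forall>\<^sub>F x in at_right 0. a < ereal (\<psi> x)"
      using eventually_at_right_less[of "0::real"] by (rule eventually_mono[rotated])
  next
    fix a assume "(INF x\<in>{0<..}. ereal (\<psi> x)) < a"
    then obtain x0 where x0: "x0 > 0" "ereal (\<psi> x0) < a" by (auto simp: INF_less_iff)
    have "\<forall>\<^sub>F x in at_right 0. 0 < x \<and> x < x0"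
      using x0 by (intro eventually_conj eventually_at_right_less order_tendstoD(2)[OF tendsto_ident_at])
    then show "\<forall>\<^sub>F x in at_right 0. ereal (\<psi> x) < a"
      by eventually_elim (use mono x0 in \<open>meson ereal_less(2) less_ereal.simps(1) less_trans\<close>)
  qed
  then have zero: "lim_zero \<psi> = (INF x\<in>{0<..}. ereal (\<psi> x))"
    unfolding lim_zero_def by (intro tendsto_Lim) auto
  have "((\<lambda>x. ereal (\<psi> x)) \<longlongrightarrow> (SUP x\<in>{0<..}. ereal (\<psi> x))) at_top"
  proof (rule order_tendstoI)
    fix a assume "(SUP x\<in>{0<..}. ereal (\<psi> x)) < a"
    then have "ereal (\<psi> x) < a" if "x > 0" for x
      using that by (meson SUP_upper greaterThan_iff le_less_trans)
    then show "\<forall>\<^sub>F x in at_top. ereal (\<psi> x) < a"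
      using eventually_gt_at_top[of "0::real"] by (rule eventually_mono[rotated])
  next
    fix a assume "a < (SUP x\<in>{0<..}. ereal (\<psi> x))"
    then obtain x0 where x0: "x0 > 0" "a < ereal (\<psi> x0)" by (auto simp: less_SUP_iff)
    show "\<forall>\<^sub>F x in at_top. a < ereal (\<psi> x)"
      using eventually_gt_at_top[of x0]
      by eventually_elim (use mono[OF x0(1)] x0 in \<open>meson less_ereal.simps(1) less_trans\<close>)
  qed
  then have infty: "lim_infty \<psi> = (SUP x\<in>{0<..}. ereal (\<psi> x))"
    unfolding lim_infty_def by (intro tendsto_Lim) auto
  obtain b where b: "b > 0" "y < \<psi> b" using y by (auto simp: infty less_SUP_iff)
  then show "\<exists>z>0. y < \<psi> z" by blast
  have "v \<ge> 0 \<and> (v > 0 \<longrightarrow> \<psi> v = y) \<and> (v = 0 \<longrightarrow> (\<forall>z>0. y \<le> \<psi> z))"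
  proof (cases "ereal y \<le> lim_zero \<psi>")
    case True
    then have "v = 0" using v by (simp add: gen_inverse_def)
    moreover have "y \<le> \<psi> z" if "z > 0" for z
    proof -
      have "ereal y \<le> ereal (\<psi> z)"
        using True that unfolding zero by (meson INF_lower greaterThan_iff order_trans)
      then show ?thesis by simp
    qed
    ultimately show ?thesis by simp
  next
    case False
    then obtain a where a: "a > 0" "\<psi> a < y" by (auto simp: zero not_le INF_less_iff)
    have "a \<le> b" using le[of b a] a b by fastforce
    moreover have "continuous_on {a..b} \<psi>"
      by (rule continuous_on_subset[OF cont]) (use a in auto)
    ultimately obtain x where x: "a \<le> x" "\<psi> x = y" using IVT'[of \<psi> a y b] a b by auto
    have "inj_on (\<lambda>x. ereal (\<psi> x)) {0<..}"
    proof (rule inj_onI)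
      fix p q assume "p \<in> {0<..}" "q \<in> {0<..}" "ereal (\<psi> p) = ereal (\<psi> q)"
      then show "p = q" using mono[of p q] mono[of q p] by (cases p q rule: linorder_cases) auto
    qed
    then have "the_inv_into {0<..} (\<lambda>x. ereal (\<psi> x)) (ereal y) = x"
      by (rule the_inv_into_f_eq) (use x a in auto)
    then have "v = x" using v y False by (simp add: gen_inverse_def not_le[symmetric])
    with x a show ?thesis by simp
  qed
  then show "v \<ge> 0" "v > 0 \<Longrightarrow> \<psi> v = y" "v = 0 \<Longrightarrow> z > 0 \<Longrightarrow> y \<le> \<psi> z" by auto
qed

lemma strictly_convex_on_imp_convex_on:
  assumes "strictly_convex_on S f"
  shows "convex_on S f"
proof (rule convex_onI)
  fix t :: real and x y assume t: "0 < t" "t < 1" and xy: "x \<in> S" "y \<in> S"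
  show "f ((1 - t) *\<^sub>R x + t *\<^sub>R y) \<le> (1 - t) * f x + t * f y"
  proof (cases "x = y")
    case True
    then show ?thesis by (simp add: scaleR_left_distrib[symmetric] algebra_simps)
  next
    case False
    then show ?thesis using assms t xy unfolding strictly_convex_on_def by (metis less_imp_le)
  qed
next
  show "convex S" using assms by (simp add: strictly_convex_on_def)
qed

locale convex_energy =
  fixes H :: "real \<Rightarrow> real"
  assumes strictly_convex: "strictly_convex_on {0..} H" and smooth: "smooth_on {0<..} H" and zero: "H 0 = 0"
begin

lemma DERIV_H: "x > 0 \<Longrightarrow> (H has_real_derivative deriv H x) (at x)"
  and DERIV_psi: "x > 0 \<Longrightarrow> (deriv H has_real_derivative deriv (deriv H) x) (at x)"
  and continuous_on_psi': "continuous_on {0<..} (deriv (deriv H))"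
proof -
  have op: "open {(0::real)<..}" by simp
  note s1 = smooth_on_real(2)[OF op smooth]
  show "x > 0 \<Longrightarrow> (H has_real_derivative deriv H x) (at x)"
    using smooth_on_real(1)[OF op smooth] by simp
  show "x > 0 \<Longrightarrow> (deriv H has_real_derivative deriv (deriv H) x) (at x)"
    using smooth_on_real(1)[OF op s1] by simp
  show "continuous_on {0<..} (deriv (deriv H))"
    by (rule smooth_on_imp_continuous_on[OF smooth_on_real(2)[OF op s1]])
qed

lemma tangent:
  assumes "z > 0" "x \<ge> 0"
  shows "H z + deriv H z * (x - z) \<le> H x"
proof -
  have "H x - H z \<ge> deriv H z * (x - z)"
    by (rule convex_on_imp_above_tangent[OF strictly_convex_on_imp_convex_on[OF strictly_convex]])
      (use assms DERIV_H[OF assms(1)] in \<open>auto intro: has_field_derivative_at_within\<close>)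
  then show ?thesis by simp
qed

lemma psi_strict:
  assumes "0 < a" "a < b"
  shows "deriv H a < deriv H b"
proof (rule ccontr)
  assume neg: "\<not> deriv H a < deriv H b"
  define m where "m = (1 - 1 / 2) * a + 1 / 2 * b"
  have "deriv H b * (b - a) \<le> deriv H a * (b - a)" using neg assms by (intro mult_right_mono) auto
  then have "H b \<le> H a + deriv H a * (b - a)"
    using tangent[of b a] assms by (simp add: algebra_simps)
  moreover have "H m < (1 - 1 / 2) * H a + 1 / 2 * H b"
  proof -
    have "\<forall>t. 0 < t \<longrightarrow> t < 1 \<longrightarrow> H ((1 - t) *\<^sub>R a + t *\<^sub>R b) < (1 - t) * H a + t * H b"
      using strictly_convex assms unfolding strictly_convex_on_def by simp
    from this[rule_format, of "1 / 2"] show ?thesis by (simp add: m_def)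
  qed
  moreover have "H a + deriv H a * (m - a) \<le> H m"
    using tangent[of a m] assms by (simp add: m_def)
  moreover have "m - a = (b - a) / 2" by (simp add: m_def field_simps)
  ultimately show False by (simp add: field_simps)
qed

lemma U_of_nonneg: "x > 0 \<Longrightarrow> U_of H x \<ge> 0"
  using tangent[of x 0] by (simp add: U_of_def zero algebra_simps)

lemma deriv_U_of: "x > 0 \<Longrightarrow> deriv (U_of H) x = x * deriv (deriv H) x"
proof (rule DERIV_imp_deriv)
  assume x: "x > 0"
  have "((\<lambda>x. x * deriv H x - H x) has_real_derivative x * deriv (deriv H) x) (at x)"
    by (rule derivative_eq_intros DERIV_psi DERIV_H x refl | simp)+
  then show "(U_of H has_real_derivative x * deriv (deriv H) x) (at x)"
    by (simp add: U_of_def[abs_def])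
qed

text \<open>
  A convex function on the closed half-line may jump up at the end point.  The jump is
  \<open>- H (0+) = U (0+)\<close>, which is the infimum of the increasing function \<open>U\<close>; adding it to \<open>H\<close> away from
  \<open>0\<close> makes the energy density continuous and leaves its derivative alone.
\<close>

definition jump :: real where
  "jump = Inf (U_of H ` {0<..})"

definition continuous_energy :: "real \<Rightarrow> real" where
  "continuous_energy x = (if x > 0 then H x + jump else 0)"

lemma jump: "jump \<ge> 0" "x > 0 \<Longrightarrow> jump \<le> U_of H x" "e > 0 \<Longrightarrow> \<exists>x>0. U_of H x < jump + e"
proof -
  have bdd: "bdd_below (U_of H ` {0<..})"
    using U_of_nonneg by (auto intro!: bdd_belowI[of _ 0])
  have ne: "U_of H ` {0<..} \<noteq> {}" by simp
  show "jump \<ge> 0" unfolding jump_def by (rule cInf_greatest[OF ne]) (use U_of_nonneg in auto)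
  show "x > 0 \<Longrightarrow> jump \<le> U_of H x" unfolding jump_def by (rule cInf_lower[OF _ bdd]) auto
  show "\<exists>x>0. U_of H x < jump + e" if "e > 0"
    using cInf_lessD[OF ne, of "jump + e"] that by (auto simp: jump_def)
qed

text \<open>
  Since \<open>U\<^sub>2 = x * U' - U\<close> and \<open>U' = x * H''\<close>, the assumption on \<open>U\<^sub>2 + U / n\<close> is McCann's condition;
  lowering the pressure by the jump keeps it valid.
\<close>

lemma internal_energy_continuous_energy:
  assumes n: "n \<ge> 1" and U2: "\<And>x. x > 0 \<Longrightarrow> U2_of H x + 1 / real n * U_of H x \<ge> 0"
  shows "internal_energy continuous_energy (deriv H) (deriv (deriv H)) n"
proof
  show "n \<ge> 1" by (rule n)
  show "continuous_energy 0 = 0" by (simp add: continuous_energy_def)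
  show "(continuous_energy has_real_derivative deriv H x) (at x)" if x: "x > 0" for x
  proof (rule has_field_derivative_transform_within_open)
    show "((\<lambda>x. H x + jump) has_real_derivative deriv H x) (at x)"
      using DERIV_H[OF x] by (auto intro!: derivative_eq_intros)
    show "open {(0::real)<..}" "x \<in> {0<..}" using x by auto
  qed (simp add: continuous_energy_def)
  show "(deriv H has_real_derivative deriv (deriv H) x) (at x)" if "x > 0" for x
    by (rule DERIV_psi[OF that])
  show "continuous_energy z + deriv H z * (x - z) \<le> continuous_energy x" if "z > 0" "x \<ge> 0" for z x
    using tangent[OF that] jump(2)[OF that(1)] that
    by (auto simp: continuous_energy_def U_of_def algebra_simps)
  show "\<exists>x>0. x * deriv H x - continuous_energy x < e" if e: "e > 0" for e
  proof -
    obtain x where "x > 0" "U_of H x < jump + e" using jump(3)[OF e] by blast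
    then show ?thesis by (intro exI[of _ x]) (simp add: continuous_energy_def U_of_def)
  qed
  show "(1 - 1 / real n) * (x * deriv H x - continuous_energy x) \<le> x\<^sup>2 * deriv (deriv H) x"
    if x: "x > 0" for x
  proof -
    have "(1 - 1 / real n) * (x * deriv H x - continuous_energy x) \<le> (1 - 1 / real n) * U_of H x"
      using n x jump(1) by (intro mult_left_mono) (auto simp: continuous_energy_def U_of_def)
    also have "\<dots> \<le> x\<^sup>2 * deriv (deriv H) x"
      using U2[OF x] by (simp add: U2_of_def deriv_U_of[OF x] algebra_simps power2_eq_square)
    finally show ?thesis .
  qed
qed

end

theorem theorem1p6:
  fixes H :: "real \<Rightarrow> real"
    and S :: "(real^'d) set"
    and V v u :: "real^'d \<Rightarrow> real"
    and C :: real
  defines "\<psi> \<equiv> deriv H"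
    and "\<Omega> \<equiv> interior S"
  assumes H_convex: "strictly_convex_on {0..} H"
    and H_smooth: "smooth_on {0<..} H"
    and H_0: "H 0 = 0"
    and S: "closed S" "convex S"
    and V_smooth: "smooth_on S V"
    and v_eq: "\<And>x. x \<in> S \<Longrightarrow> ereal (v x) = gen_inverse \<psi> (ereal (- V x))"
    and v_integrable: "set_integrable lborel \<Omega> v"
    and U2_U: "\<And>x. x > 0 \<Longrightarrow> U2_of H x + 1 / real CARD('d) * U_of H x \<ge> 0"
    and V_less: "\<And>x. x \<in> S \<Longrightarrow> ereal (- V x) < lim_infty \<psi>"
    and C_pos: "C > 0"
    and V_hess: "\<And>x. x \<in> S \<Longrightarrow> matrix_le (C *\<^sub>R mat 1) (hessian_on S V x)"
    and u_smooth: "smooth_on S u"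
    and u_pos: "\<And>x. x \<in> S \<Longrightarrow> u x > 0"
    and u_mass: "ext_integral \<Omega> u = ext_integral \<Omega> v"
  shows "ext_integral \<Omega> (\<lambda>x. H (u x) - H (v x) + (u x - v x) * V x)
    \<le> ereal (1 / (2 * C)) *
      ext_integral \<Omega> (\<lambda>x. u x * (norm (gradient_on S (\<lambda>y. \<psi> (u y)) x + gradient_on S V x))\<^sup>2)"
proof -
  interpret E: convex_energy H by unfold_locales (rule H_convex H_smooth H_0)+
  define K where "K = E.continuous_energy"
  define \<psi>' where "\<psi>' = deriv \<psi>"
  define g where "g x = \<psi>' (u x) *\<^sub>R gradient_on S u x + gradient_on S V x" for x
  have \<Omega>_S: "\<Omega> \<subseteq> S" by (simp add: \<Omega>_def interior_subset)
  have \<psi>_mono: "\<psi> a < \<psi> b" if "0 < a" "a < b" for a b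
    using E.psi_strict that by (simp add: \<psi>_def)
  have \<psi>_DERIV: "(\<psi> has_real_derivative \<psi>' x) (at x)" if "x > 0" for x
    using E.DERIV_psi[OF that] by (simp add: \<psi>_def \<psi>'_def)
  have \<psi>_cont: "continuous_on {0<..} \<psi>"
    using \<psi>_DERIV by (intro continuous_at_imp_continuous_on ballI DERIV_isCont) auto
  have inv: "\<exists>z>0. - V x < \<psi> z" "v x \<ge> 0" "v x > 0 \<Longrightarrow> \<psi> (v x) = - V x"
      "v x = 0 \<Longrightarrow> z > 0 \<Longrightarrow> - V x \<le> \<psi> z" if x: "x \<in> S" for x z
    using gen_inverse_real[OF \<psi>_mono \<psi>_cont V_less[OF x] v_eq[OF x]] by simp_all
  have grad_\<psi>: "((\<lambda>y. \<psi> (u y)) has_derivative (\<lambda>h. (\<psi>' (u x) *\<^sub>R gradient_on S u x) \<bullet> h)) (at x)"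
    if x: "x \<in> \<Omega>" for x
  proof -
    have "u x > 0" using u_pos \<Omega>_S x by blast
    from \<psi>_DERIV[OF this] have "(\<psi> has_derivative (*) (\<psi>' (u x))) (at (u x))"
      by (simp add: has_field_derivative_def)
    from has_derivative_compose[OF smooth_on_gradient(3)[OF u_smooth x[unfolded \<Omega>_def]] this]
    show ?thesis by simp
  qed
  have g_eq: "gradient_on S (\<lambda>y. \<psi> (u y)) x + gradient_on S V x = g x" if x: "x \<in> \<Omega>" for x
    using gradient_on_unique[OF x[unfolded \<Omega>_def] grad_\<psi>[OF x]] by (simp add: g_def)
  \<comment> \<open>the equality of the extended integrals makes \<open>u\<close> integrable\<close>
  have u_int: "set_integrable lborel \<Omega> u" and mass: "(LINT x:\<Omega>|lborel. u x) = (LINT x:\<Omega>|lborel. v x)"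
  proof -
    have neg: "(\<integral>\<^sup>+x\<in>\<Omega>. ennreal (- u x) \<partial>lborel) = 0"
    proof -
      have "ennreal (- u x) * indicator \<Omega> x = 0" for x
        using u_pos[of x] \<Omega>_S by (auto simp: indicator_def ennreal_neg less_imp_le)
      then show ?thesis by (simp only: nn_integral_const mult_zero_left)
    qed
    have pos: "(\<integral>\<^sup>+x\<in>\<Omega>. ennreal (u x) \<partial>lborel) = (\<integral>\<^sup>+x. ennreal (norm (indicator \<Omega> x *\<^sub>R u x)) \<partial>lborel)"
      by (rule nn_integral_cong) (use u_pos \<Omega>_S in \<open>force simp: indicator_def\<close>)
    have "enn2ereal (\<integral>\<^sup>+x\<in>\<Omega>. ennreal (u x) \<partial>lborel) = ereal (LINT x:\<Omega>|lborel. v x)"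
      using u_mass ext_integral_eq_LINT[OF v_integrable] by (simp add: ext_integral_def neg zero_ennreal.rep_eq)
    then have "(\<integral>\<^sup>+x\<in>\<Omega>. ennreal (u x) \<partial>lborel) < \<infinity>"
      by (cases "\<integral>\<^sup>+x\<in>\<Omega>. ennreal (u x) \<partial>lborel") auto
    moreover have "(\<lambda>x. indicator \<Omega> x *\<^sub>R u x) \<in> borel_measurable borel"
      using smooth_on_imp_continuous_on[OF u_smooth] \<Omega>_S
      by (intro borel_measurable_continuous_on_indicator) (auto simp: \<Omega>_def intro: continuous_on_subset)
    ultimately show u_int: "set_integrable lborel \<Omega> u"
      unfolding set_integrable_def by (intro integrableI_bounded) (auto simp: pos)
    show "(LINT x:\<Omega>|lborel. u x) = (LINT x:\<Omega>|lborel. v x)"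
      using u_mass ext_integral_eq_LINT[OF v_integrable] ext_integral_eq_LINT[OF u_int] by simp
  qed
  interpret I: internal_energy K \<psi> \<psi>' "DIM(real^'d)"
    unfolding K_def \<psi>'_def \<psi>_def
    by (rule E.internal_energy_continuous_energy) (use U2_U in \<open>auto simp: Suc_le_eq\<close>)
  interpret I: energy_comparison K \<psi> \<psi>' S u V v g C
  proof
    show "closed S" "convex S" by (rule S)+
    show "continuous_on S u" "continuous_on S V"
      by (rule smooth_on_imp_continuous_on u_smooth V_smooth)+
    have "continuous_on S (\<lambda>x. \<psi>' (u x))"
      by (rule continuous_on_compose2[OF E.continuous_on_psi' smooth_on_imp_continuous_on[OF u_smooth],
            folded \<psi>_def \<psi>'_def]) (use u_pos in auto)
    then show "continuous_on S g"
      unfolding g_def[abs_def]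
      by (intro continuous_intros smooth_on_gradient(1) u_smooth V_smooth)
    show "0 < u x" if "x \<in> S" for x by (rule u_pos[OF that])
    show "((\<lambda>x. \<psi> (u x) + V x) has_derivative (\<lambda>h. g x \<bullet> h)) (at x)" if "x \<in> interior S" for x
      using has_derivative_add[OF grad_\<psi> smooth_on_gradient(3)[OF V_smooth], of x] that
      by (simp add: \<Omega>_def g_def inner_add_left)
    show "C > 0" by (rule C_pos)
    show "V ((1 - s) *\<^sub>R x + s *\<^sub>R y) + C / 2 * (s * (1 - s)) * (norm (x - y))\<^sup>2
        \<le> (1 - s) * V x + s * V y"
      if "x \<in> interior S" "y \<in> interior S" "0 \<le> s" "s \<le> 1" for x y s
      by (rule hessian_imp_strongly_convex[OF V_smooth S(2) V_hess that])
    show "\<psi> a < \<psi> b" if "0 < a" "a < b" for a b by (rule \<psi>_mono[OF that])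
    show "set_integrable lborel (interior S) u" "set_integrable lborel (interior S) v"
      "(LINT x:interior S|lborel. u x) = (LINT x:interior S|lborel. v x)"
      using u_int v_integrable mass by (simp_all add: \<Omega>_def)
  qed (use inv in auto)
  let ?D = "\<lambda>x. H (u x) - H (v x) + (u x - v x) * V x"
  let ?R = "\<lambda>x. u x * (norm (gradient_on S (\<lambda>y. \<psi> (u y)) x + gradient_on S V x))\<^sup>2"
  have K: "K z = (if z > 0 then H z + E.jump else 0)" for z
    by (simp add: K_def E.continuous_energy_def)
  \<comment> \<open>\<open>u\<close> is positive, so removing the jump raises \<open>H u\<close> at least as much as \<open>H v\<close>\<close>
  have D_le: "?D x \<le> I.gap x" if "x \<in> S" for x
    using inv(2)[OF that] u_pos[OF that] E.jump(1) H_0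
    by (cases "v x = 0") (auto simp: I.gap_def K)
  have "ext_integral \<Omega> ?D \<le> enn2ereal (\<integral>\<^sup>+x\<in>\<Omega>. ennreal (?D x) \<partial>lborel)"
    unfolding ext_integral_def by (simp add: ereal_diff_le_self)
  also have "\<dots> \<le> enn2ereal (\<integral>\<^sup>+x\<in>\<Omega>. ennreal (I.gap x) \<partial>lborel)"
    unfolding less_eq_ennreal.rep_eq[symmetric]
    by (intro nn_integral_mono) (use D_le \<Omega>_S in \<open>auto simp: indicator_def intro!: ennreal_leI\<close>)
  also have "\<dots> \<le> enn2ereal (ennreal (1 / (2 * C)) * (\<integral>\<^sup>+x\<in>\<Omega>. ennreal (u x * (norm (g x))\<^sup>2) \<partial>lborel))"
    unfolding less_eq_ennreal.rep_eq[symmetric] \<Omega>_def by (rule I.energy_comparison_inequality)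
  also have "(\<integral>\<^sup>+x\<in>\<Omega>. ennreal (u x * (norm (g x))\<^sup>2) \<partial>lborel) = (\<integral>\<^sup>+x\<in>\<Omega>. ennreal (?R x) \<partial>lborel)"
    by (intro nn_integral_cong) (auto simp: indicator_def g_eq)
  also have "enn2ereal (ennreal (1 / (2 * C)) * (\<integral>\<^sup>+x\<in>\<Omega>. ennreal (?R x) \<partial>lborel)) =
      ereal (1 / (2 * C)) * ext_integral \<Omega> ?R"
  proof -
    have "(\<integral>\<^sup>+x\<in>\<Omega>. ennreal (- ?R x) \<partial>lborel) = 0"
    proof -
      have "ennreal (- ?R x) * indicator \<Omega> x = 0" for x
      proof (cases "x \<in> \<Omega>")
        case True
        then have "0 \<le> ?R x" using u_pos[of x] \<Omega>_S by (auto simp: less_imp_le)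
        then show ?thesis by (simp add: ennreal_neg)
      qed simp
      then show ?thesis by (simp only: nn_integral_const mult_zero_left)
    qed
    then show ?thesis
      using C_pos by (simp add: ext_integral_def times_ennreal.rep_eq zero_ennreal.rep_eq)
  qed
  finally show ?thesis .
qed

end
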